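(* Let $G=\mathrm{Sp}_{2n}$ over $\mathbb F_q$. Fix a character $\chi\colon P\to\mathbb C^\times$, written as $\chi=\beta\circ\chi_{\det}$ with $\beta\colon\mathbb F_q^\times\to\mathbb C^\times$ a character. Suppose $\beta^2=1$ but $\beta\ne1$ (so that $\chi=\chi^J$). (a) If $n=2m$ is even, then the intertwining operator $I$ on $\operatorname{Ind}_P^G\chi$ is diagonalizable and has eigenvalues $$\left\{\beta(-1)^m(-1)^{m-\lfloor i/2\rfloor}q^{m^2+\lfloor i/2\rfloor^2}:0\le i\le n\right\}.$$ (b) If $n=2m+1$ is odd, then the intertwining operator $I$ on $\operatorname{Ind}_P^G\chi$ is diagonalizable and has eigenvalues $$\left\{\pm\sqrt{\beta(-1)}\,q^{m(m+1)+i(i+1)+\frac12}:0\le i\le m\right\}.$$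
   Context: $q$ is an odd prime power with $3\nmid q$, and $n\ge1$. $J=\begin{bmatrix}0&-1_n\\1_n&0\end{bmatrix}$. $\mathrm{Sp}_{2n}$ consists of $g\in\mathrm{GL}_{2n}(\mathbb F_q)$ with $g^\intercal Jg=J$. $P=\left\{\begin{bmatrix}A&B\\0&D\end{bmatrix}\in G\right\}$ with $n\times n$ blocks, and $U=\left\{\begin{bmatrix}1_n&B\\0&1_n\end{bmatrix}\in G\right\}$. $\chi_{\det}\colon P\to\mathbb F_q^\times$ is $\begin{bmatrix}A&B\\0&D\end{bmatrix}\mapsto(\det D)^{-1}$. (Every character of $P$ has the form $\beta\circ\chi_{\det}$.) The character $\chi^J$ is $\chi^J\left(\begin{bmatrix}A&B\\0&D\end{bmatrix}\right)=\chi\left(\begin{bmatrix}D&0\\0&A\end{bmatrix}\right)$. $\operatorname{Ind}_P^G\chi$ is the space of functions $f\colon G\to\mathbb C$ with $f(pg)=\chi(p)f(g)$ for $p\in P$, $g\in G$. The operator $I\colon\operatorname{Ind}_P^G\chi\to\operatorname{Ind}_P^G\chi^J$ is $(If)(g)=\sum_{u\in U}f(J^{-1}ug)$. The displayed collections are sets of eigenvalues (no multiplicities are asserted); $\sqrt{\beta(-1)}$ is a complex square root of $\beta(-1)\in\{\pm1\}$. *)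

theory Defs
  imports
    Complex_Main
    "HOL-Library.Cardinality"
    "HOL-Library.Function_Algebras"
    "Jordan_Normal_Form.Determinant"
begin

text \<open>
  The finite field is a type \<open>'a :: {field, finite}\<close>, and \<open>q\<close> is \<open>CARD('a)\<close> (automatically a
  prime power).
\<close>

definition mult_group :: "'a::field monoid" where
  "mult_group = \<lparr>carrier = UNIV - {0}, mult = (*), one = 1\<rparr>"

definition J_mat :: "nat \<Rightarrow> 'a::field mat" where
  "J_mat n = four_block_mat (0\<^sub>m n n) (- 1\<^sub>m n) (1\<^sub>m n) (0\<^sub>m n n)"

definition Sp :: "nat \<Rightarrow> 'a::field mat monoid" where
  "Sp n = \<lparr>carrier = {g \<in> carrier_mat (2 * n) (2 * n).
                        invertible_mat g \<and> transpose_mat g * J_mat n * g = J_mat n},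
           mult = (*), one = 1\<^sub>m (2 * n)\<rparr>"

definition siegel_P :: "nat \<Rightarrow> 'a::field mat set" where
  "siegel_P n = {g \<in> carrier (Sp n). \<exists>A \<in> carrier_mat n n. \<exists>B \<in> carrier_mat n n. \<exists>D \<in> carrier_mat n n.
                   g = four_block_mat A B (0\<^sub>m n n) D}"

definition siegel_U :: "nat \<Rightarrow> 'a::field mat set" where
  "siegel_U n = {g \<in> carrier (Sp n). \<exists>B \<in> carrier_mat n n.
                   g = four_block_mat (1\<^sub>m n) B (0\<^sub>m n n) (1\<^sub>m n)}"

definition chi_det :: "nat \<Rightarrow> 'a::field mat \<Rightarrow> 'a" where
  "chi_det n p = (case split_block p n n of (A, B, C, D) \<Rightarrow> inverse (det D))"

definition char_J :: "nat \<Rightarrow> ('a::field mat \<Rightarrow> complex) \<Rightarrow> 'a mat \<Rightarrow> complex" where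
  "char_J n \<chi> p = (case split_block p n n of (A, B, C, D) \<Rightarrow>
                     \<chi> (four_block_mat D (0\<^sub>m n n) (0\<^sub>m n n) A))"

text \<open>
  A function on the group is represented by a function on all matrices that vanishes outside the
  carrier; this makes the representation unique.
\<close>

definition Ind :: "nat \<Rightarrow> ('a::field mat \<Rightarrow> complex) \<Rightarrow> ('a mat \<Rightarrow> complex) set" where
  "Ind n \<chi> = {f. (\<forall>g. g \<notin> carrier (Sp n) \<longrightarrow> f g = 0) \<and>
                 (\<forall>p \<in> siegel_P n. \<forall>g \<in> carrier (Sp n). f (p * g) = \<chi> p * f g)}"

definition intertwiner :: "nat \<Rightarrow> ('a::field mat \<Rightarrow> complex) \<Rightarrow> 'a mat \<Rightarrow> complex" where
  "intertwiner n f g =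
     (if g \<in> carrier (Sp n)
      then \<Sum>u \<in> siegel_U n. f (inv\<^bsub>Sp n\<^esub> (J_mat n) * u * g)
      else 0)"

definition fun_scale :: "complex \<Rightarrow> ('b \<Rightarrow> complex) \<Rightarrow> 'b \<Rightarrow> complex" where
  "fun_scale c f = (\<lambda>x. c * f x)"

interpretation cfun: vector_space "fun_scale :: complex \<Rightarrow> ('b \<Rightarrow> complex) \<Rightarrow> 'b \<Rightarrow> complex"
  by unfold_locales (auto simp: fun_scale_def fun_eq_iff algebra_simps)

text \<open>
  For a linear \<open>T\<close>, diagonalizability on \<open>V\<close> in the following sense includes that \<open>T\<close> maps \<open>V\<close>
  into itself.
\<close>

definition diagonalizable_on ::
  "('b \<Rightarrow> complex) set \<Rightarrow> (('b \<Rightarrow> complex) \<Rightarrow> ('b \<Rightarrow> complex)) \<Rightarrow> bool" where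
  "diagonalizable_on V T \<longleftrightarrow>
     (\<exists>B. cfun.independent B \<and> cfun.span B = V \<and> (\<forall>b \<in> B. \<exists>c. T b = fun_scale c b))"

definition eigenvalues_on ::
  "('b \<Rightarrow> complex) set \<Rightarrow> (('b \<Rightarrow> complex) \<Rightarrow> ('b \<Rightarrow> complex)) \<Rightarrow> complex set" where
  "eigenvalues_on V T = {c. \<exists>f \<in> V. f \<noteq> 0 \<and> T f = fun_scale c f}"

end

theory Submission
  imports Defs
begin

text \<open>
  A function in \<open>Ind n \<chi>\<close> depends on \<open>g\<close> only through the tuple \<open>X\<close> of the bottom \<open>n\<close> rows of \<open>g\<close>, which is a basis
  of a Lagrangian subspace, and the equivariance says that a base change \<open>D\<close> of the Lagrangian multiplies the value by
  \<open>\<beta> (det D)\<close>.  In these terms (\<open>sections\<close>, \<open>opp_op\<close>) the intertwining operator is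
  \<open>(I F)(X) = \<Sum> F(Z)\<close>, summed over the isotropic tuples \<open>Z\<close> that are dual to \<open>X\<close>.  Up to normalisation its kernel is
  \<open>\<beta> (det <X, Z>)\<close> on pairs of opposite Lagrangians; for \<open>n = 1\<close> this is the Paley conference matrix of the
  projective line.
  
  The idea is to diagonalise together with \<open>I\<close> the sum \<open>A\<close> of all transvections
  \<open>x \<mapsto> x + t <x, u> u\<close>, weighted by \<open>\<beta> t\<close> (\<open>transv_op\<close>).  This operator comes from the centre of the group algebra
  and can be followed through an induction on \<open>n\<close>.  Let \<open>e, f\<close> span the last hyperbolic plane in rank
  \<open>n + 1\<close>.  A function \<open>F\<close> on frames of rank \<open>n + 1\<close> gives two functions on frames of rank \<open>n\<close>: the
  restriction \<open>(R F)(X) = F(X, e)\<close>, and the sum \<open>(S F)(X)\<close> of the values of \<open>F\<close> at the translates of \<open>(X, f)\<close> by the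
  unipotent radical of the stabiliser of the line of \<open>e\<close>.  With primes for the operators in rank \<open>n\<close>,
  
    \<open>R A = q A' R + (q - 1)^2 S\<close>,
    \<open>S A = q^2 A' S + \<beta> (-1) (q - 1)^2 q^(3n + 1) R\<close>,
    \<open>q^n R I = \<beta> (-1) I' S\<close>
  
  (lemmas \<open>res_transv\<close>, \<open>avg_transv\<close>, \<open>res_opp\<close>).  Over an eigenvalue of \<open>A'\<close> the first two identities describe \<open>A\<close> by a matrix of
  size two, whose eigenvalues are explicit.  Since \<open>F\<close> is determined by the restrictions of its translates
  (\<open>zero_if_res_zero\<close>), the operator \<open>A\<close> is annihilated by a polynomial with simple roots, hence
  diagonalisable, and by induction its eigenvalues are
  
    \<open>\<alpha>_j = (q - 1) q^(n - 1) s (q^(n - j) - q^j)\<close> for \<open>0 \<le> j \<le> n\<close>, where \<open>s^2 = \<beta> (-1) q\<close>;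
  
  the eigenvalue \<open>\<alpha>_j\<close> in rank \<open>n\<close> gives rise to those with the indices \<open>j\<close> and \<open>j + 1\<close> in rank \<open>n + 1\<close>.  The third identity then
  shows that \<open>I\<close> acts on the eigenspace of \<open>\<alpha>_j\<close> as the scalar
  
    \<open>\<lambda>_j = (\<beta> (-1) s)^n (-1)^j q^(C(n - j, 2) + C(j, 2))\<close>,
  
  where \<open>C\<close> is the binomial coefficient.  All indices occur, because a function in rank \<open>n\<close> can be extended to
  rank \<open>n + 1\<close> by zero off the frames whose span contains \<open>e\<close> (\<open>sections_extension\<close>, \<open>projections_nonzero_Suc\<close>).
  Finally, for \<open>n = 2m\<close> the numbers \<open>\<lambda>_j\<close> with \<open>j = m - k\<close> and \<open>j = m + k\<close> agree, and for \<open>n = 2m + 1\<close> those with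
  \<open>j = m - i\<close> and \<open>j = m + 1 + i\<close> are opposite; this gives the two lists.
\<close>

section \<open>Symplectic spaces and isometries\<close>

text \<open>
  The coordinates of \<open>F^(2n)\<close> are indexed by pairs \<open>(k, b)\<close>, where \<open>(k, True)\<close> and \<open>(k, False)\<close> belong
  to one hyperbolic plane.  All \<open>F^(2n)\<close> live in one type, and \<open>hspace n\<close> is literally contained in
  \<open>hspace (Suc n)\<close>, so that no embedding is needed in the induction on \<open>n\<close>.
\<close>
type_synonym 'a hvec = "nat \<times> bool \<Rightarrow> 'a"

definition smul :: "'a::field \<Rightarrow> 'a hvec \<Rightarrow> 'a hvec" (infixr "*s" 75) where
  "c *s x = (\<lambda>k. c * x k)"

definition hspace :: "nat \<Rightarrow> 'a::field hvec set" where
  "hspace n = {x. \<forall>k b. n \<le> k \<longrightarrow> x (k, b) = 0}"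

definition sform :: "nat \<Rightarrow> 'a::field hvec \<Rightarrow> 'a hvec \<Rightarrow> 'a" where
  "sform n x y = (\<Sum>k<n. x (k, True) * y (k, False) - x (k, False) * y (k, True))"

definition evec :: "nat \<Rightarrow> 'a::field hvec" where
  "evec n = (\<lambda>k. if k = (n, True) then 1 else 0)"

definition fvec :: "nat \<Rightarrow> 'a::field hvec" where
  "fvec n = (\<lambda>k. if k = (n, False) then 1 else 0)"

lemma smul_apply [simp]: "(c *s x) k = c * x k"
  by (simp add: smul_def)

lemma smul_zero [simp]: "c *s 0 = 0" "0 *s x = 0"
  by (auto simp: fun_eq_iff)

lemma smul_one [simp]: "1 *s x = x"
  by (auto simp: fun_eq_iff)

lemma evec_apply [simp]: "evec n (k, b) = (if k = n \<and> b then 1 else 0)"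
  by (simp add: evec_def)

lemma fvec_apply [simp]: "fvec n (k, b) = (if k = n \<and> \<not> b then 1 else 0)"
  by (simp add: fvec_def)

lemma hspace_zero [simp]: "0 \<in> hspace n"
  and hspace_add: "x \<in> hspace n \<Longrightarrow> y \<in> hspace n \<Longrightarrow> x + y \<in> hspace n"
  and hspace_diff: "x \<in> hspace n \<Longrightarrow> y \<in> hspace n \<Longrightarrow> x - y \<in> hspace n"
  and hspace_smul: "x \<in> hspace n \<Longrightarrow> c *s x \<in> hspace n"
  by (auto simp: hspace_def)

lemma hspace_uminus: "x \<in> hspace n \<Longrightarrow> - x \<in> hspace n"
  by (auto simp: hspace_def)

lemma hspace_sum: "(\<And>i. i \<in> I \<Longrightarrow> f i \<in> hspace n) \<Longrightarrow> sum f I \<in> hspace n"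
  by (induction I rule: infinite_finite_induct) (auto simp: hspace_add)

lemmas hspace_closed = hspace_zero hspace_add hspace_diff hspace_smul hspace_uminus

lemma hspace_SucI: "x \<in> hspace n \<Longrightarrow> x \<in> hspace (Suc n)"
  by (auto simp: hspace_def)

lemma hspace_top_coord: "x \<in> hspace n \<Longrightarrow> x (n, b) = 0"
  by (auto simp: hspace_def)

lemma evec_in_hspace [simp]: "i < n \<Longrightarrow> evec i \<in> hspace n"
  and fvec_in_hspace [simp]: "i < n \<Longrightarrow> fvec i \<in> hspace n"
  by (auto simp: hspace_def)

lemma hspace_0 [simp]: "hspace 0 = {0}"
  by (auto simp: hspace_def fun_eq_iff)

lemma sum_fun_apply: "(\<Sum>i\<in>I. f i) k = (\<Sum>i\<in>I. (f i :: 'b \<Rightarrow> 'c::comm_monoid_add) k)"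
  by (induction I rule: infinite_finite_induct) auto

lemma sform_add_left: "sform n (x + y) z = sform n x z + sform n y z"
  unfolding sform_def sum.distrib [symmetric] by (rule sum.cong) (auto simp: algebra_simps)

lemma sform_smul_left: "sform n (c *s x) z = c * sform n x z"
  unfolding sform_def sum_distrib_left by (rule sum.cong) (auto simp: algebra_simps)

lemma sform_skew: "sform n x y = - sform n y x"
  unfolding sform_def sum_negf [symmetric] by (rule sum.cong) (auto simp: algebra_simps)

lemma sform_uminus_left: "sform n (- x) z = - sform n x z"
  unfolding sform_def sum_negf [symmetric] by (rule sum.cong) (auto simp: algebra_simps)

lemma sform_diff_left: "sform n (x - y) z = sform n x z - sform n y z"
  unfolding sform_def sum_subtractf [symmetric] by (rule sum.cong) (auto simp: algebra_simps)

lemma sform_add_right: "sform n z (x + y) = sform n z x + sform n z y"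
  and sform_diff_right: "sform n z (x - y) = sform n z x - sform n z y"
  and sform_smul_right: "sform n z (c *s x) = c * sform n z x"
  and sform_uminus_right: "sform n z (- x) = - sform n z x"
  unfolding sform_skew [of n z]
  by (simp_all add: sform_add_left sform_smul_left sform_diff_left sform_uminus_left)

lemma sform_zero [simp]: "sform n 0 z = 0" "sform n z 0 = 0"
  by (simp_all add: sform_def)

lemma sform_sum_left: "sform n (sum f I) z = (\<Sum>i\<in>I. sform n (f i) z)"
  by (induction I rule: infinite_finite_induct) (simp_all only: simp_thms sum.infinite sum.empty sum.insert sform_add_left sform_zero)

lemma sform_sum_right: "sform n z (sum f I) = (\<Sum>i\<in>I. sform n z (f i))"
  by (induction I rule: infinite_finite_induct) (simp_all only: simp_thms sum.infinite sum.empty sum.insert sform_add_right sform_zero)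

lemma sform_self [simp]: "sform n x x = 0"
  by (simp add: sform_def algebra_simps)

lemmas sform_linear = sform_add_left sform_add_right sform_diff_left sform_diff_right
  sform_smul_left sform_smul_right sform_uminus_left sform_uminus_right

lemma sform_Suc:
  "sform (Suc n) x y = sform n x y + (x (n, True) * y (n, False) - x (n, False) * y (n, True))"
  by (simp add: sform_def)

lemma sform_top [simp]: "sform n (evec n) z = 0" "sform n z (evec n) = 0"
  "sform n (fvec n) z = 0" "sform n z (fvec n) = 0"
  by (simp_all add: sform_def)

lemma sform_evec_left: "i < n \<Longrightarrow> sform n (evec i) x = x (i, False)"
  and sform_fvec_left: "i < n \<Longrightarrow> sform n (fvec i) x = - x (i, True)"
  by (simp_all add: sform_def if_distrib if_distribR sum.delta cong: if_cong)

lemma sform_nondegenerate: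
  assumes "x \<in> hspace n" "\<And>y. y \<in> hspace n \<Longrightarrow> sform n y x = 0"
  shows "x = 0"
proof
  fix k :: "nat \<times> bool"
  obtain i b where k: "k = (i, b)" by (cases k)
  show "x k = 0 k"
  proof (cases "i < n")
    case True
    then show ?thesis
      using assms(2)[of "evec i"] assms(2)[of "fvec i"] k
      by (cases b) (auto simp: sform_evec_left sform_fvec_left)
  qed (use assms(1) k in \<open>auto simp: hspace_def\<close>)
qed

text \<open>
  The decomposition of \<open>hspace (Suc n)\<close> into \<open>hspace n\<close> and the hyperbolic plane spanned by \<open>evec n\<close> and
  \<open>fvec n\<close>, for which \<open>sform (Suc n) (evec n) (fvec n) = 1\<close>.
\<close>
definition hcons :: "nat \<Rightarrow> 'a::field hvec \<Rightarrow> 'a \<Rightarrow> 'a \<Rightarrow> 'a hvec" where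
  "hcons n u a b = u + a *s evec n + b *s fvec n"

lemma hspace_Suc_bij:
  "bij_betw (\<lambda>(u, a, b). hcons n u a b) (hspace n \<times> UNIV \<times> UNIV) (hspace (Suc n))"
proof (rule bij_betwI[where g = "\<lambda>x. (\<lambda>(k, b). if k = n then 0 else x (k, b), x (n, True), x (n, False))"])
  show "(\<lambda>(u, a, b). hcons n u a b) \<in> hspace n \<times> UNIV \<times> UNIV \<rightarrow> hspace (Suc n)"
    by (auto simp: hcons_def hspace_def)
qed (auto simp: hcons_def hspace_def fun_eq_iff le_Suc_eq)

lemma finite_hspace [simp]: "finite (hspace n :: 'a::{field, finite} hvec set)"
  by (induction n) (auto simp: bij_betw_finite[OF hspace_Suc_bij, symmetric])

lemma card_hspace: "card (hspace n :: 'a::{field, finite} hvec set) = CARD('a) ^ (2 * n)"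
  by (induction n)
    (simp_all add: bij_betw_same_card[OF hspace_Suc_bij, symmetric] card_cartesian_product)

lemma sum_hspace_Suc:
  fixes f :: "'a::{field, finite} hvec \<Rightarrow> 'b::comm_monoid_add"
  shows "(\<Sum>x\<in>hspace (Suc n). f x) = (\<Sum>u\<in>hspace n. \<Sum>a\<in>UNIV. \<Sum>b\<in>UNIV. f (hcons n u a b))"
  unfolding sum.reindex_bij_betw[OF hspace_Suc_bij, symmetric]
  by (simp add: sum.cartesian_product case_prod_unfold)

lemma sum_hspace_shift:
  fixes f :: "'a::{field, finite} hvec \<Rightarrow> 'b::comm_monoid_add"
  assumes "v \<in> hspace n"
  shows "(\<Sum>x\<in>hspace n. f (x + v)) = (\<Sum>x\<in>hspace n. f x)"
  by (rule sum.reindex_bij_witness[where j = "\<lambda>x. x + v" and i = "\<lambda>x. x - v"])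
    (use assms in \<open>auto intro: hspace_closed\<close>)

lemma sum_hspace_smul:
  fixes f :: "'a::{field, finite} hvec \<Rightarrow> 'b::comm_monoid_add"
  assumes "c \<noteq> 0"
  shows "(\<Sum>x\<in>hspace n. f (c *s x)) = (\<Sum>x\<in>hspace n. f x)"
  by (rule sum.reindex_bij_witness[where j = "\<lambda>x. c *s x" and i = "\<lambda>x. inverse c *s x"])
    (use assms in \<open>auto simp: fun_eq_iff intro: hspace_smul\<close>)

lemma sum_field_shift:
  fixes f :: "'a::{field, finite} \<Rightarrow> 'b::comm_monoid_add"
  shows "(\<Sum>x\<in>UNIV. f (x + v)) = (\<Sum>x\<in>UNIV. f x)"
  by (rule sum.reindex_bij_witness[where j = "\<lambda>x. x + v" and i = "\<lambda>x. x - v"]) auto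

lemma sum_field_affine:
  fixes f :: "'a::{field, finite} \<Rightarrow> 'b::comm_monoid_add"
  assumes "c \<noteq> 0"
  shows "(\<Sum>x\<in>UNIV. f (c * x + v)) = (\<Sum>x\<in>UNIV. f x)"
  by (rule sum.reindex_bij_witness[where j = "\<lambda>x. c * x + v" and i = "\<lambda>x. (x - v) / c"]) (use assms in auto)

text \<open>
  Linearity is required on the whole type rather than on \<open>hspace n\<close>, which spares membership conditions;
  all isometries below are given by formulas that make sense everywhere.
\<close>
definition isometries :: "nat \<Rightarrow> ('a::field hvec \<Rightarrow> 'a hvec) set" where
  "isometries n = {g. (\<forall>x\<in>hspace n. g x \<in> hspace n) \<and> (\<forall>x y. g (x + y) = g x + g y) \<and>
     (\<forall>c x. g (c *s x) = c *s g x) \<and> (\<forall>x\<in>hspace n. \<forall>y\<in>hspace n. sform n (g x) (g y) = sform n x y)}"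

lemma isometryD:
  assumes "g \<in> isometries n"
  shows "x \<in> hspace n \<Longrightarrow> g x \<in> hspace n" "g (x + y) = g x + g y" "g (c *s x) = c *s g x"
    "x \<in> hspace n \<Longrightarrow> y \<in> hspace n \<Longrightarrow> sform n (g x) (g y) = sform n x y"
  using assms by (auto simp: isometries_def)

lemma isometry_zero: "g \<in> isometries n \<Longrightarrow> g 0 = 0"
  using isometryD(3)[of g n 0 0] by simp

lemma isometry_sum: "g \<in> isometries n \<Longrightarrow> g (sum f I) = (\<Sum>i\<in>I. g (f i))"
  by (induction I rule: infinite_finite_induct)
    (simp_all only: simp_thms sum.infinite sum.empty sum.insert isometry_zero isometryD(2))

lemma isometry_diff: 
  assumes "g \<in> isometries n" shows "g (x - y) = g x - g y"
  using isometryD(2)[OF assms, of "x - y" y] by (simp add: algebra_simps)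

text \<open>
  An isometry of a nondegenerate form is injective, and \<open>hspace n\<close> is finite.
\<close>
lemma isometry_bij:
  fixes g :: "'a::{field, finite} hvec \<Rightarrow> 'a hvec"
  assumes g: "g \<in> isometries n"
  shows "bij_betw g (hspace n) (hspace n)"
proof -
  have "inj_on g (hspace n)"
  proof (rule inj_onI)
    fix x y assume xy: "x \<in> hspace n" "y \<in> hspace n" "g x = g y"
    have "x - y = 0"
    proof (rule sform_nondegenerate)
      fix z :: "'a hvec" assume z: "z \<in> hspace n"
      have "sform n z (x - y) = sform n (g z) (g (x - y))"
        by (rule isometryD(4)[OF g, symmetric]) (use xy z in \<open>auto intro: hspace_closed\<close>)
      then show "sform n z (x - y) = 0" using xy by (simp add: isometry_diff[OF g])
    qed (use xy in \<open>auto intro: hspace_closed\<close>)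
    then show "x = y" by simp
  qed
  moreover have "g ` hspace n \<subseteq> hspace n" using isometryD(1)[OF g] by auto
  ultimately show ?thesis
    using endo_inj_surj[of "hspace n" g] by (auto simp: bij_betw_def)
qed

definition transv :: "nat \<Rightarrow> 'a::field hvec \<Rightarrow> 'a \<Rightarrow> 'a hvec \<Rightarrow> 'a hvec" where
  "transv n u t x = x + (t * sform n x u) *s u"

lemma transv_isometry:
  assumes "u \<in> hspace n"
  shows "transv n u t \<in> isometries n"
proof -
  have "sform n (transv n u t x) (transv n u t y) = sform n x y" for x y
    using sform_skew[of n u y] by (simp add: transv_def sform_linear)
  then show ?thesis
    using assms unfolding isometries_def
    by (auto simp: transv_def sform_linear fun_eq_iff algebra_simps intro!: hspace_add hspace_smul)
qed

lemma isometry_transv: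
  assumes "g \<in> isometries n" "u \<in> hspace n" "x \<in> hspace n"
  shows "g (transv n u t x) = transv n (g u) t (g x)"
  unfolding transv_def isometryD(2,3)[OF assms(1)] isometryD(4)[OF assms(1,3,2)] by (rule refl)

lemma transv_zero [simp]: "transv n u t 0 = 0"
  by (simp add: transv_def)

section \<open>Lagrangian frames\<close>

definition lincomb :: "nat \<Rightarrow> (nat \<Rightarrow> 'a::field) \<Rightarrow> (nat \<Rightarrow> 'a hvec) \<Rightarrow> 'a hvec" where
  "lincomb n a X = (\<Sum>j<n. a j *s X j)"

definition row_act :: "nat \<Rightarrow> 'a::field mat \<Rightarrow> (nat \<Rightarrow> 'a hvec) \<Rightarrow> nat \<Rightarrow> 'a hvec" where
  "row_act n D X = (\<lambda>i. if i < n then lincomb n (\<lambda>j. D $$ (i, j)) X else 0)"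

text \<open>
  Tuples of length \<open>n\<close> are functions that vanish from \<open>n\<close> on, so that a tuple is determined by its
  entries below \<open>n\<close>.
\<close>
definition isotuples :: "nat \<Rightarrow> (nat \<Rightarrow> 'a::field hvec) set" where
  "isotuples n = {X. (\<forall>i<n. X i \<in> hspace n) \<and> (\<forall>i\<ge>n. X i = 0) \<and>
     (\<forall>i<n. \<forall>j<n. sform n (X i) (X j) = 0)}"

definition duals :: "nat \<Rightarrow> (nat \<Rightarrow> 'a::field hvec) \<Rightarrow> (nat \<Rightarrow> 'a hvec) set" where
  "duals n X = {Z \<in> isotuples n. \<forall>i<n. \<forall>j<n. sform n (Z i) (X j) = (if i = j then 1 else 0)}"

text \<open>
  A frame is a basis of a Lagrangian subspace.  Linear independence is expressed by the existence of an
  isotropic dual tuple; this is also the half of a symplectic matrix that completes the frame.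
\<close>
definition frames :: "nat \<Rightarrow> (nat \<Rightarrow> 'a::field hvec) set" where
  "frames n = {X \<in> isotuples n. duals n X \<noteq> {}}"

lemma isotuplesD:
  assumes "X \<in> isotuples n"
  shows "X i \<in> hspace n" "i \<ge> n \<Longrightarrow> X i = 0" "sform n (X i) (X j) = 0"
  using assms by (cases "i < n"; cases "j < n"; simp add: isotuples_def not_less)+

lemma framesD: 
  assumes "X \<in> frames n"
  shows "X \<in> isotuples n" "X i \<in> hspace n" "i \<ge> n \<Longrightarrow> X i = 0" "sform n (X i) (X j) = 0"
  using assms isotuplesD[of X n] by (auto simp: frames_def)

lemma lincomb_hspace: "(\<And>j. j < n \<Longrightarrow> X j \<in> hspace m) \<Longrightarrow> lincomb n a X \<in> hspace m"
  by (auto simp: lincomb_def intro!: hspace_sum hspace_smul)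

lemma lincomb_isometry:
  "g \<in> isometries m \<Longrightarrow> g (lincomb n a X) = lincomb n a (g \<circ> X)"
  unfolding lincomb_def by (simp only: isometry_sum isometryD(3) o_apply)

lemma row_act_isometry:
  "g \<in> isometries m \<Longrightarrow> g \<circ> row_act n D X = row_act n D (g \<circ> X)"
  by (auto simp: row_act_def fun_eq_iff lincomb_isometry isometry_zero)

lemma sform_lincomb_left: "sform m (lincomb n a X) z = (\<Sum>j<n. a j * sform m (X j) z)"
  and sform_lincomb_right: "sform m z (lincomb n a X) = (\<Sum>j<n. a j * sform m z (X j))"
  by (simp_all add: lincomb_def sform_sum_left sform_sum_right sform_linear)

lemma isotuples_isometry:
  assumes "g \<in> isometries n" "X \<in> isotuples n"
  shows "g \<circ> X \<in> isotuples n"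
  using assms by (auto simp: isotuples_def isometryD isometry_zero)

lemma duals_isometry_image:
  assumes "g \<in> isometries n" "X \<in> isotuples n" "Z \<in> duals n X"
  shows "g \<circ> Z \<in> duals n (g \<circ> X)"
  using assms isotuples_isometry[OF assms(1)]
  by (auto simp: duals_def isometryD isometry_zero isotuplesD)

lemma frames_isometry:
  assumes "g \<in> isometries n" "X \<in> frames n"
  shows "g \<circ> X \<in> frames n"
  using assms duals_isometry_image[OF assms(1)] isotuples_isometry[OF assms(1)]
  by (fastforce simp: frames_def)

lemma duals_isometry:
  fixes g :: "'a::{field, finite} hvec \<Rightarrow> 'a hvec"
  assumes g: "g \<in> isometries n" and X: "X \<in> isotuples n"
  shows "bij_betw (\<lambda>Z. g \<circ> Z) (duals n X) (duals n (g \<circ> X))"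
proof (rule bij_betw_imageI)
  note bij = isometry_bij[OF g]
  show "inj_on (\<lambda>Z. g \<circ> Z) (duals n X)"
  proof (rule inj_onI)
    fix Z W assume Z: "Z \<in> duals n X" and W: "W \<in> duals n X" and eq: "g \<circ> Z = g \<circ> W"
    show "Z = W"
    proof
      fix i
      have "g (Z i) = g (W i)" using eq by (simp add: fun_eq_iff)
      moreover have "Z i \<in> hspace n" "W i \<in> hspace n"
        using Z W by (auto simp: duals_def isotuplesD)
      ultimately show "Z i = W i" using bij by (auto simp: bij_betw_def inj_on_def)
    qed
  qed
  show "(\<lambda>Z. g \<circ> Z) ` duals n X = duals n (g \<circ> X)"
  proof (intro equalityI subsetI)
    fix Z assume "Z \<in> duals n (g \<circ> X)"
    then have Z: "Z \<in> isotuples n" and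
      dual: "\<And>i j. i < n \<Longrightarrow> j < n \<Longrightarrow> sform n (Z i) (g (X j)) = (if i = j then 1 else 0)"
      by (auto simp: duals_def)
    have "\<forall>i. \<exists>y\<in>hspace n. g y = Z i"
      using bij isotuplesD(1)[OF Z] by (metis bij_betw_imp_surj_on imageE)
    then obtain W' where W': "\<And>i. W' i \<in> hspace n" "\<And>i. g (W' i) = Z i" by metis
    define W where "W = (\<lambda>i. if i < n then W' i else 0)"
    have gW: "g \<circ> W = Z"
      using W' isotuplesD(2)[OF Z] isometry_zero[OF g] by (auto simp: W_def fun_eq_iff)
    have "W \<in> duals n X"
      using W' dual isotuplesD(3)[OF Z]
        isometryD(4)[OF g, symmetric] isotuplesD(1)[OF X]
      by (auto simp: duals_def isotuples_def W_def)
    then show "Z \<in> (\<lambda>Z. g \<circ> Z) ` duals n X" using gW by auto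
  qed (use duals_isometry_image[OF g X] in auto)
qed

lemma finite_isotuples [simp]: "finite (isotuples n :: (nat \<Rightarrow> 'a::{field, finite} hvec) set)"
proof (rule finite_subset)
  show "isotuples n \<subseteq> {X. \<forall>i. (i \<in> {..<n} \<longrightarrow> X i \<in> (hspace n :: 'a hvec set)) \<and> (i \<notin> {..<n} \<longrightarrow> X i = 0)}"
    by (auto simp: isotuples_def)
  show "finite {X. \<forall>i. (i \<in> {..<n} \<longrightarrow> X i \<in> (hspace n :: 'a hvec set)) \<and> (i \<notin> {..<n} \<longrightarrow> X i = 0)}"
    by (rule finite_set_of_finite_funs) auto
qed

lemma finite_duals [simp]: "finite (duals n (X :: nat \<Rightarrow> 'a::{field, finite} hvec))"
  by (auto simp: duals_def)

lemma det_nonzero_inverse: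
  assumes "D \<in> carrier_mat n n" "det D \<noteq> (0 :: 'a::field)"
  obtains B where "B \<in> carrier_mat n n" "B * D = 1\<^sub>m n" "D * B = 1\<^sub>m n" "det B \<noteq> 0"
proof -
  from det_non_zero_imp_unit[OF assms, where b = "()"] obtain B where
    B: "B \<in> carrier_mat n n" "B * D = 1\<^sub>m n" "D * B = 1\<^sub>m n"
    by (auto simp: Units_def ring_mat_def)
  have "det B * det D = 1" using det_mult[OF B(1) assms(1)] B(2) by simp
  then have "det B \<noteq> 0" by auto
  with B that show thesis by blast
qed

lemma row_act_row_act:
  assumes "D \<in> carrier_mat n n" "E \<in> carrier_mat n n"
  shows "row_act n D (row_act n E X) = row_act n (D * E) X"
proof (intro ext)
  fix i k
  show "row_act n D (row_act n E X) i k = row_act n (D * E) X i k"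
  proof (cases "i < n")
    case True
    have "(\<Sum>j<n. D $$ (i, j) * (\<Sum>l<n. E $$ (j, l) * X l k)) =
          (\<Sum>l<n. (\<Sum>j<n. D $$ (i, j) * E $$ (j, l)) * X l k)"
      unfolding sum_distrib_left sum_distrib_right by (subst sum.swap) (simp only: mult.assoc)
    also have "\<dots> = (\<Sum>l<n. (D * E) $$ (i, l) * X l k)"
      using True assms by (intro sum.cong refl) (simp add: scalar_prod_def lessThan_atLeast0)
    finally have "(\<Sum>j<n. D $$ (i, j) * row_act n E X j k) = (\<Sum>l<n. (D * E) $$ (i, l) * X l k)"
      by (simp add: row_act_def lincomb_def sum_fun_apply)
    then show ?thesis using True
      by (simp add: row_act_def[of n D] row_act_def[of n "D * E"] lincomb_def sum_fun_apply)
  qed (simp add: row_act_def)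
qed

lemma row_act_one: "(\<And>i. i \<ge> n \<Longrightarrow> X i = 0) \<Longrightarrow> row_act n (1\<^sub>m n) X = X"
  by (auto simp: row_act_def lincomb_def fun_eq_iff sum_fun_apply if_distrib if_distribR not_less
      cong: if_cong)

lemma isotuples_row_act: "X \<in> isotuples n \<Longrightarrow> row_act n D X \<in> isotuples n"
  by (auto simp: isotuples_def row_act_def sform_lincomb_left sform_lincomb_right intro!: lincomb_hspace)

text \<open>
  The contragredient matrix acts on dual tuples.
\<close>
lemma duals_row_act:
  assumes D: "D \<in> carrier_mat n n" "B \<in> carrier_mat n n" "D * B = 1\<^sub>m n"
    and Z: "Z \<in> duals n X"
  shows "row_act n (transpose_mat B) Z \<in> duals n (row_act n D X)"
proof -
  have "sform n (row_act n (transpose_mat B) Z i) (row_act n D X j) = (if i = j then 1 else 0)"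
    if ij: "i < n" "j < n" for i j
  proof -
    have "sform n (row_act n (transpose_mat B) Z i) (row_act n D X j) =
          (\<Sum>k<n. B $$ (k, i) * (\<Sum>l<n. D $$ (j, l) * (if k = l then 1 else 0)))"
      using ij Z D unfolding row_act_def
      by (simp only: if_True sform_lincomb_left) (auto simp: sform_lincomb_right duals_def intro!: sum.cong)
    also have "\<dots> = (\<Sum>k<n. D $$ (j, k) * B $$ (k, i))"
      by (intro sum.cong refl) (simp add: if_distrib mult.commute cong: if_cong)
    also have "\<dots> = (D * B) $$ (j, i)"
      using ij D(1,2) by (simp add: scalar_prod_def lessThan_atLeast0)
    finally show ?thesis unfolding D(3) using ij by auto
  qed
  moreover have "row_act n (transpose_mat B) Z \<in> isotuples n"
    using Z by (auto simp: duals_def isotuples_row_act)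
  ultimately show ?thesis by (simp add: duals_def)
qed

lemma frames_row_act:
  assumes "D \<in> carrier_mat n n" "det D \<noteq> 0" "X \<in> frames n"
  shows "row_act n D X \<in> frames n"
proof -
  obtain B where "B \<in> carrier_mat n n" "D * B = 1\<^sub>m n" using det_nonzero_inverse[OF assms(1,2)] by blast
  then show ?thesis using assms duals_row_act[of D n B] isotuples_row_act[of X n D]
    by (fastforce simp: frames_def)
qed

section \<open>Extending a frame by one vector\<close>

definition snoc :: "nat \<Rightarrow> (nat \<Rightarrow> 'a::field hvec) \<Rightarrow> 'a hvec \<Rightarrow> nat \<Rightarrow> 'a hvec" where
  "snoc n X w = (\<lambda>i. if i < n then X i else if i = n then w else 0)"

lemma snoc_cong: "(\<And>i. i < n \<Longrightarrow> X i = Y i) \<Longrightarrow> v = w \<Longrightarrow> snoc n X v = snoc n Y w"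
  by (auto simp: snoc_def fun_eq_iff)

lemma lincomb_Suc: "lincomb (Suc n) a X = lincomb n a X + a n *s X n"
  by (simp add: lincomb_def)

lemma lincomb_cong:
  "(\<And>j. j < n \<Longrightarrow> a j = b j) \<Longrightarrow> (\<And>j. j < n \<Longrightarrow> X j = Y j) \<Longrightarrow> lincomb n a X = lincomb n b Y"
  unfolding lincomb_def by (rule sum.cong) simp_all

lemma lincomb_delta:
  assumes "i < n"
  shows "lincomb n (\<lambda>j. if i = j then 1 else 0) X = X i"
proof -
  have "lincomb n (\<lambda>j. if i = j then 1 else 0) X = (\<Sum>j<n. if i = j then X j else 0)"
    unfolding lincomb_def by (rule sum.cong) auto
  then show ?thesis using assms by (simp only: sum.delta' finite_lessThan lessThan_iff if_True)
qed

lemma lincomb_one_mat: "i < n \<Longrightarrow> lincomb n (\<lambda>j. 1\<^sub>m n $$ (i, j)) X = X i"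
  using lincomb_delta[of i n X] lincomb_cong[of n "\<lambda>j. 1\<^sub>m n $$ (i, j)" "\<lambda>j. if i = j then 1 else 0" X X]
  by simp

lemma lincomb_snoc: "lincomb n a (snoc n X w) = lincomb n a X"
  by (rule lincomb_cong) (auto simp: snoc_def)

lemma row_act_snoc:
  assumes "\<And>i. i < n \<Longrightarrow> lincomb n (\<lambda>j. D $$ (i, j)) X + D $$ (i, n) *s w = Y i"
    and "lincomb n (\<lambda>j. D $$ (n, j)) X + D $$ (n, n) *s w = v"
  shows "row_act (Suc n) D (snoc n X w) = snoc n Y v"
proof
  fix i
  have "lincomb (Suc n) (\<lambda>j. D $$ (i, j)) (snoc n X w) = lincomb n (\<lambda>j. D $$ (i, j)) X + D $$ (i, n) *s w" for i
    by (simp only: lincomb_Suc lincomb_snoc) (simp add: snoc_def)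
  then show "row_act (Suc n) D (snoc n X w) i = snoc n Y v i"
    using assms by (auto simp: row_act_def snoc_def less_Suc_eq)
qed

lemma isotuples_snoc:
  assumes "X \<in> isotuples n" "w \<in> hspace (Suc n)" "\<And>i. i < n \<Longrightarrow> sform (Suc n) (X i) w = 0"
  shows "snoc n X w \<in> isotuples (Suc n)"
proof -
  have "sform (Suc n) (snoc n X w i) (snoc n X w j) = 0" if "i < Suc n" "j < Suc n" for i j
    using that assms isotuplesD[OF assms(1)] sform_skew[of "Suc n" w "X j"]
    by (auto simp: snoc_def less_Suc_eq sform_Suc hspace_top_coord)
  moreover have "snoc n X w i \<in> hspace (Suc n)" for i
    using assms(2) isotuplesD(1)[OF assms(1), of i] by (auto simp: snoc_def intro: hspace_SucI)
  ultimately show ?thesis by (auto simp: isotuples_def) (simp add: snoc_def)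
qed

lemma frames_snoc:
  assumes X: "X \<in> frames n"
    and w: "w \<in> hspace (Suc n)" "\<And>x. x \<in> hspace n \<Longrightarrow> sform (Suc n) x w = 0"
    and w': "w' \<in> hspace (Suc n)" "\<And>x. x \<in> hspace n \<Longrightarrow> sform (Suc n) x w' = 0"
    and dual: "sform (Suc n) w' w = 1"
  shows "snoc n X w \<in> frames (Suc n)"
proof -
  obtain Z where Xt: "X \<in> isotuples n" and Z: "Z \<in> isotuples n"
    and ZX: "\<And>i j. i < n \<Longrightarrow> j < n \<Longrightarrow> sform n (Z i) (X j) = (if i = j then 1 else 0)"
    using X by (auto simp: frames_def duals_def)
  note Xh = isotuplesD(1)[OF Xt] and Zh = isotuplesD(1)[OF Z]
  have X_tuple: "snoc n X w \<in> isotuples (Suc n)" by (rule isotuples_snoc[OF Xt w(1) w(2)[OF Xh]])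
  have Z_tuple: "snoc n Z w' \<in> isotuples (Suc n)" by (rule isotuples_snoc[OF Z w'(1) w'(2)[OF Zh]])
  have lift: "sform (Suc n) (Z i) (X j) = sform n (Z i) (X j)" for i j
    by (simp add: sform_Suc hspace_top_coord[OF Xh] hspace_top_coord[OF Zh])
  have "sform (Suc n) (snoc n Z w' i) (snoc n X w j) = (if i = j then 1 else 0)"
    if "i < Suc n" "j < Suc n" for i j
    using that ZX[of i j] w(2)[OF Zh, of i] w'(2)[OF Xh, of j] dual sform_skew[of "Suc n" w' "X j"] lift[of i j]
    by (auto simp: snoc_def less_Suc_eq)
  then have "snoc n Z w' \<in> duals (Suc n) (snoc n X w)" using Z_tuple by (simp add: duals_def)
  then show ?thesis using X_tuple by (auto simp: frames_def)
qed

lemma frames_snoc_evec: "X \<in> frames n \<Longrightarrow> snoc n X (evec n) \<in> frames (Suc n)"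
  and frames_snoc_fvec: "X \<in> frames n \<Longrightarrow> snoc n X (fvec n) \<in> frames (Suc n)"
  by (rule frames_snoc[of X n "evec n" "- fvec n"];
      simp add: sform_Suc sform_linear hspace_top_coord hspace_uminus)
    (rule frames_snoc[of X n "fvec n" "evec n"]; simp add: sform_Suc hspace_top_coord)

text \<open>
  The maps \<open>nu n v c\<close> form the unipotent radical of the stabiliser of the line of \<open>evec n\<close>; the maps
  \<open>mu n v c\<close> do the same for \<open>fvec n\<close>.  Both are defined without reference to a decomposition of \<open>x\<close>, by
  its coordinates at \<open>n\<close>.
\<close>
definition nu :: "nat \<Rightarrow> 'a::field hvec \<Rightarrow> 'a \<Rightarrow> 'a hvec \<Rightarrow> 'a hvec" where
  "nu n v c x = x - sform n x v *s evec n + x (n, False) *s (v + c *s evec n)"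

definition mu :: "nat \<Rightarrow> 'a::field hvec \<Rightarrow> 'a \<Rightarrow> 'a hvec \<Rightarrow> 'a hvec" where
  "mu n v c x = x + sform n x v *s fvec n + x (n, True) *s (v + c *s fvec n)"

lemma nu_isometry:
  assumes "v \<in> hspace n"
  shows "nu n v c \<in> isometries (Suc n)"
proof -
  have "sform (Suc n) (nu n v c x) (nu n v c y) = sform (Suc n) x y" for x y
    using sform_skew[of n v y] hspace_top_coord[OF assms]
    by (simp add: nu_def sform_Suc sform_linear algebra_simps)
  moreover have "nu n v c x \<in> hspace (Suc n)" if "x \<in> hspace (Suc n)" for x
    using that assms unfolding nu_def
    by (intro hspace_add hspace_diff hspace_smul hspace_SucI[OF assms]) auto
  moreover have "nu n v c (x + y) = nu n v c x + nu n v c y" "nu n v c (d *s x) = d *s nu n v c x" for x y d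
    by (auto simp: nu_def sform_linear fun_eq_iff algebra_simps)
  ultimately show ?thesis by (auto simp: isometries_def)
qed

lemma mu_isometry:
  assumes "v \<in> hspace n"
  shows "mu n v c \<in> isometries (Suc n)"
proof -
  have "sform (Suc n) (mu n v c x) (mu n v c y) = sform (Suc n) x y" for x y
    using sform_skew[of n v y] hspace_top_coord[OF assms]
    by (simp add: mu_def sform_Suc sform_linear algebra_simps)
  moreover have "mu n v c x \<in> hspace (Suc n)" if "x \<in> hspace (Suc n)" for x
    using that assms unfolding mu_def
    by (intro hspace_add hspace_diff hspace_smul hspace_SucI[OF assms]) auto
  moreover have "mu n v c (x + y) = mu n v c x + mu n v c y" "mu n v c (d *s x) = d *s mu n v c x" for x y d
    by (auto simp: mu_def sform_linear fun_eq_iff algebra_simps)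
  ultimately show ?thesis by (auto simp: isometries_def)
qed

lemma nu_nu:
  assumes "w \<in> hspace n"
  shows "nu n v c (nu n w d x) = nu n (v + w) (c + d - sform n w v) x"
  using hspace_top_coord[OF assms]
  by (auto simp: nu_def sform_linear fun_eq_iff algebra_simps)

section \<open>Sections and their operators\<close>

type_synonym 'a frame_fun = "(nat \<Rightarrow> 'a hvec) \<Rightarrow> complex"

text \<open>
  A nontrivial quadratic character of the multiplicative group.  Its value at \<open>0\<close> is arbitrary; sums
  below run over nonzero arguments only.  The number \<open>q\<close> is a parameter so that it can be written without
  reference to the type.
\<close>
locale quadratic_character =
  fixes \<beta> :: "'a::{field, finite} \<Rightarrow> complex" and q :: complex
  assumes q_def: "q = of_nat CARD('a)"
    and mult: "x \<noteq> 0 \<Longrightarrow> y \<noteq> 0 \<Longrightarrow> \<beta> (x * y) = \<beta> x * \<beta> y"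
    and square: "x \<noteq> 0 \<Longrightarrow> \<beta> x * \<beta> x = 1"
    and nontrivial: "\<exists>x. x \<noteq> 0 \<and> \<beta> x \<noteq> 1"
begin

lemma q_nonzero [simp]: "q \<noteq> 0"
  by (simp add: q_def)

lemma one [simp]: "\<beta> 1 = 1"
  using mult[of 1 1] square[of 1] by simp

lemma nonzero: "x \<noteq> 0 \<Longrightarrow> \<beta> x \<noteq> 0"
  using square[of x] by auto

lemma mult_square: "x \<noteq> 0 \<Longrightarrow> y \<noteq> 0 \<Longrightarrow> \<beta> (x * y * y) = \<beta> x"
  using square[of y] by (simp add: mult mult.assoc)

lemma inverse: "x \<noteq> 0 \<Longrightarrow> \<beta> (inverse x) = \<beta> x"
  using mult_square[of "inverse x" x] by simp

lemma sum_units: "(\<Sum>t\<in>- {0}. \<beta> t) = 0"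
proof -
  obtain c where c: "c \<noteq> 0" "\<beta> c \<noteq> 1" using nontrivial by blast
  have "(\<Sum>t\<in>- {0}. \<beta> t) = (\<Sum>t\<in>- {0}. \<beta> (c * t))"
    by (rule sum.reindex_bij_witness[where i = "\<lambda>t. c * t" and j = "\<lambda>t. t / c"]) (use c in auto)
  also have "\<dots> = \<beta> c * (\<Sum>t\<in>- {0}. \<beta> t)"
    unfolding sum_distrib_left by (rule sum.cong) (auto simp: mult c)
  finally show ?thesis using c by auto
qed

lemma card_units: "of_nat (card (- {0 :: 'a})) = q - 1"
  by (simp add: Compl_eq_Diff_UNIV card_Diff_subset of_nat_diff Suc_leI q_def)

text \<open>
  The functions on frames that model the induced representation: the symplectic group acts from one
  side and the base change of the Lagrangian, from the other side, through \<open>\<beta> \<circ> det\<close>.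
\<close>
definition sections :: "nat \<Rightarrow> 'a frame_fun set" where
  "sections n = {F. (\<forall>X. X \<notin> frames n \<longrightarrow> F X = 0) \<and>
     (\<forall>D\<in>carrier_mat n n. det D \<noteq> 0 \<longrightarrow> (\<forall>X\<in>frames n. F (row_act n D X) = \<beta> (det D) * F X))}"

lemma sections_row_act:
  "F \<in> sections n \<Longrightarrow> D \<in> carrier_mat n n \<Longrightarrow> det D \<noteq> 0 \<Longrightarrow> X \<in> frames n \<Longrightarrow>
    F (row_act n D X) = \<beta> (det D) * F X"
  by (auto simp: sections_def)

lemma sections_upper_triangular:
  assumes F: "F \<in> sections (Suc n)" and X: "snoc n X w \<in> frames (Suc n)"
    and M: "M \<in> carrier_mat n n" "det M \<noteq> 0" and c: "c \<noteq> 0"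
  shows "F (snoc n (\<lambda>i. row_act n M X i + b i *s w) (c *s w)) = \<beta> (det M * c) * F (snoc n X w)"
proof -
  define D where "D = four_block_mat M (mat n 1 (\<lambda>(i, _). b i)) (0\<^sub>m 1 n) (mat 1 1 (\<lambda>_. c))"
  have D: "D \<in> carrier_mat (Suc n) (Suc n)" using M by (auto simp: D_def)
  have "det (mat 1 1 (\<lambda>_. c)) = c"
    by (subst det_single) auto
  then have det: "det D = det M * c"
    unfolding D_def using M by (subst det_four_block_mat_lower_left_zero) auto
  have "row_act (Suc n) D (snoc n X w) = snoc n (\<lambda>i. row_act n M X i + b i *s w) (c *s w)"
  proof (rule row_act_snoc)
    show "lincomb n (\<lambda>j. D $$ (i, j)) X + D $$ (i, n) *s w = row_act n M X i + b i *s w" if "i < n" for i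
      using that M lincomb_cong[of n "\<lambda>j. D $$ (i, j)" "\<lambda>j. M $$ (i, j)" X X]
      by (simp add: D_def row_act_def)
    show "lincomb n (\<lambda>j. D $$ (n, j)) X + D $$ (n, n) *s w = c *s w"
      using M lincomb_cong[of n "\<lambda>j. D $$ (n, j)" "\<lambda>j. 0" X X]
      by (simp add: D_def) (simp add: lincomb_def)
  qed
  then show ?thesis using sections_row_act[OF F D _ X] det M c by simp
qed

text \<open>
  The recursion identities below need only three kinds of base change: this one,
  \<open>sections_add_to_last\<close> and \<open>sections_row_act_front\<close>.
\<close>
lemma sections_add_last:
  assumes F: "F \<in> sections (Suc n)" and X: "snoc n X w \<in> frames (Suc n)" and c: "c \<noteq> 0"
  shows "F (snoc n (\<lambda>i. X i + b i *s w) (c *s w)) = \<beta> c * F (snoc n X w)"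
proof -
  have "snoc n (\<lambda>i. X i + b i *s w) (c *s w) =
        snoc n (\<lambda>i. row_act n (1\<^sub>m n) X i + b i *s w) (c *s w)"
    by (rule snoc_cong) (simp_all only: row_act_def if_True lincomb_one_mat)
  then show ?thesis using sections_upper_triangular[OF F X _ _ c, of "1\<^sub>m n" b] by simp
qed

lemma sections_row_act_front:
  assumes F: "F \<in> sections (Suc n)" and X: "snoc n X w \<in> frames (Suc n)"
    and M: "M \<in> carrier_mat n n" "det M \<noteq> 0"
  shows "F (snoc n (row_act n M X) w) = \<beta> (det M) * F (snoc n X w)"
  using sections_upper_triangular[OF F X M, of 1 "\<lambda>_. 0"] by simp

lemma sections_add_to_last:
  assumes F: "F \<in> sections (Suc n)" and X: "snoc n X w \<in> frames (Suc n)"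
  shows "F (snoc n X (w + lincomb n a X)) = F (snoc n X w)"
proof -
  define D where "D = four_block_mat (1\<^sub>m n) (0\<^sub>m n 1) (mat 1 n (\<lambda>(_, j). a j)) (1\<^sub>m 1)"
  have D: "D \<in> carrier_mat (Suc n) (Suc n)" by (auto simp: D_def)
  have det: "det D = 1"
    unfolding D_def by (subst det_four_block_mat_upper_right_zero) auto
  have "row_act (Suc n) D (snoc n X w) = snoc n X (w + lincomb n a X)"
  proof (rule row_act_snoc)
    show "lincomb n (\<lambda>j. D $$ (i, j)) X + D $$ (i, n) *s w = X i" if "i < n" for i
      using that lincomb_cong[of n "\<lambda>j. D $$ (i, j)" "\<lambda>j. 1\<^sub>m n $$ (i, j)" X X]
      by (simp add: D_def lincomb_one_mat)
    show "lincomb n (\<lambda>j. D $$ (n, j)) X + D $$ (n, n) *s w = w + lincomb n a X"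
      using lincomb_cong[of n "\<lambda>j. D $$ (n, j)" a X X]
      by (simp add: D_def add.commute)
  qed
  then show ?thesis using sections_row_act[OF F D _ X] det by simp
qed

text \<open>
  The transvections \<open>transv n u t\<close> with \<open>\<beta> t = 1\<close> and those with \<open>\<beta> t = -1\<close> are unions of conjugacy
  classes, so this weighted sum acts through the centre of the group algebra.  On Lagrangians it is the
  adjacency operator of the dual polar graph, with signs: for \<open>u\<close> outside the Lagrangian of \<open>X\<close> the
  transvection moves it to a neighbour, and for \<open>u\<close> inside the sum over \<open>t\<close> is zero.
\<close>
definition transv_op :: "nat \<Rightarrow> 'a frame_fun \<Rightarrow> 'a frame_fun" where
  "transv_op n F X = (if X \<in> frames n then \<Sum>u\<in>hspace n. \<Sum>t\<in>- {0}. \<beta> t * F (transv n u t \<circ> X) else 0)"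

text \<open>
  In matrix terms the dual tuples \<open>Z\<close> of \<open>X\<close> are the bottom rows of \<open>J^(-1) u g\<close>, for \<open>u\<close> in the
  unipotent radical of the Siegel parabolic and \<open>X\<close> the bottom rows of \<open>g\<close>; see
  \<open>unipotent_duals_bij\<close>.
\<close>
definition opp_op :: "nat \<Rightarrow> 'a frame_fun \<Rightarrow> 'a frame_fun" where
  "opp_op n F X = (if X \<in> frames n then \<Sum>Z\<in>duals n X. F Z else 0)"

definition translate :: "nat \<Rightarrow> ('a hvec \<Rightarrow> 'a hvec) \<Rightarrow> 'a frame_fun \<Rightarrow> 'a frame_fun" where
  "translate n g F X = (if X \<in> frames n then F (g \<circ> X) else 0)"

text \<open>
  Together with \<open>avg_op\<close> this is the passage from rank \<open>n + 1\<close> to rank \<open>n\<close>: a function on frames is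
  evaluated at the frames that contain \<open>evec n\<close>, or summed over an orbit of the maps \<open>nu n v c\<close> in
  the open set of Lagrangians that do not contain it.
\<close>
definition res_op :: "nat \<Rightarrow> 'a frame_fun \<Rightarrow> 'a frame_fun" where
  "res_op n F X = (if X \<in> frames n then F (snoc n X (evec n)) else 0)"

definition avg :: "nat \<Rightarrow> 'a frame_fun \<Rightarrow> 'a frame_fun" where
  "avg n F Y = (if Y \<in> frames (Suc n) then \<Sum>v\<in>hspace n. \<Sum>c\<in>UNIV. F (nu n v c \<circ> Y) else 0)"

definition avg_op :: "nat \<Rightarrow> 'a frame_fun \<Rightarrow> 'a frame_fun" where
  "avg_op n F X = (if X \<in> frames n then avg n F (snoc n X (fvec n)) else 0)"

lemma sections_translate:
  assumes "F \<in> sections n" "g \<in> isometries n"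
  shows "translate n g F \<in> sections n"
  using assms unfolding sections_def translate_def
  by (auto simp: row_act_isometry frames_row_act frames_isometry)

lemma sections_sum:
  assumes "\<And>i. i \<in> I \<Longrightarrow> f i \<in> sections n"
  shows "(\<lambda>X. \<Sum>i\<in>I. c i * f i X) \<in> sections n"
  using assms unfolding sections_def by (auto simp: sum_distrib_left algebra_simps intro!: sum.cong)

lemma sections_transv_op:
  assumes F: "F \<in> sections n"
  shows "transv_op n F \<in> sections n"
proof -
  have "transv_op n F = (\<lambda>X. \<Sum>p\<in>hspace n \<times> - {0}. \<beta> (snd p) * translate n (transv n (fst p) (snd p)) F X)"
    by (auto simp: transv_op_def translate_def fun_eq_iff sum.cartesian_product case_prod_unfold)
  then show ?thesis by (auto intro!: sections_sum sections_translate F transv_isometry)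
qed

lemma sections_avg:
  assumes F: "F \<in> sections (Suc n)"
  shows "avg n F \<in> sections (Suc n)"
proof -
  have "avg n F = (\<lambda>X. \<Sum>p\<in>hspace n \<times> UNIV. 1 * translate (Suc n) (nu n (fst p) (snd p)) F X)"
    by (auto simp: avg_def translate_def fun_eq_iff sum.cartesian_product case_prod_unfold)
  then show ?thesis by (auto intro!: sections_sum[where c = "\<lambda>_. 1", simplified] sections_translate F nu_isometry)
qed

lemma sections_res_op:
  assumes F: "F \<in> sections (Suc n)"
  shows "res_op n F \<in> sections n"
  unfolding sections_def res_op_def
  by (auto simp: frames_row_act sections_row_act_front[OF F frames_snoc_evec])

lemma sections_avg_op:
  assumes F: "F \<in> sections (Suc n)"
  shows "avg_op n F \<in> sections n"
  unfolding sections_def avg_op_def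
  by (auto simp: frames_row_act sections_row_act_front[OF sections_avg[OF F] frames_snoc_fvec])

text \<open>
  The maps \<open>nu n v c\<close> form a group, by \<open>nu_nu\<close>.
\<close>
lemma avg_nu_invariant:
  assumes v: "v \<in> hspace n" and Y: "Y \<in> frames (Suc n)"
  shows "avg n F (nu n v c \<circ> Y) = avg n F Y"
proof -
  have "nu n w d \<circ> (nu n v c \<circ> Y) = nu n (w + v) (d + (c - sform n v w)) \<circ> Y" for w d
    by (auto simp: fun_eq_iff nu_nu[OF v] algebra_simps)
  then have "avg n F (nu n v c \<circ> Y) =
      (\<Sum>w\<in>hspace n. \<Sum>d\<in>UNIV. F (nu n (w + v) (d + (c - sform n v w)) \<circ> Y))"
    using frames_isometry[OF nu_isometry[OF v] Y] by (simp add: avg_def)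
  also have "\<dots> = (\<Sum>w\<in>hspace n. \<Sum>d\<in>UNIV. F (nu n (w + v) d \<circ> Y))"
    by (intro sum.cong refl sum_field_shift)
  also have "\<dots> = avg n F Y"
    using sum_hspace_shift[OF v, of "\<lambda>w. \<Sum>d\<in>UNIV. F (nu n w d \<circ> Y)"] Y by (simp add: avg_def)
  finally show ?thesis .
qed

text \<open>
  Conjugation by an isometry permutes the transvections and preserves their parameter \<open>t\<close>.
\<close>
lemma transv_op_translate:
  assumes g: "g \<in> isometries n" and X: "X \<in> frames n"
  shows "transv_op n F (g \<circ> X) = (\<Sum>u\<in>hspace n. \<Sum>t\<in>- {0}. \<beta> t * F (g \<circ> (transv n u t \<circ> X)))"
proof -
  have "transv n (g u) t \<circ> (g \<circ> X) = g \<circ> (transv n u t \<circ> X)" if "u \<in> hspace n" for u t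
    using isometry_transv[OF g that framesD(2)[OF X]] by (auto simp: fun_eq_iff)
  then have "(\<Sum>u\<in>hspace n. \<Sum>t\<in>- {0}. \<beta> t * F (g \<circ> (transv n u t \<circ> X))) =
        (\<Sum>u\<in>hspace n. \<Sum>t\<in>- {0}. \<beta> t * F (transv n (g u) t \<circ> (g \<circ> X)))"
    by (intro sum.cong) simp_all
  also have "\<dots> = transv_op n F (g \<circ> X)"
    using sum.reindex_bij_betw[OF isometry_bij[OF g], of "\<lambda>u. \<Sum>t\<in>- {0}. \<beta> t * F (transv n u t \<circ> (g \<circ> X))"]
      frames_isometry[OF g X] by (simp add: transv_op_def)
  finally show ?thesis by simp
qed

end

section \<open>Transvections and the restriction to one isotropic vector\<close>

lemma sum_swap_pairs:
  "(\<Sum>u\<in>U. \<Sum>a\<in>A. \<Sum>b\<in>B. \<Sum>t\<in>T. h u a b t) = (\<Sum>b\<in>B. \<Sum>t\<in>T. \<Sum>u\<in>U. \<Sum>a\<in>A. h u a b t)"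
proof -
  have "(\<Sum>u\<in>U. \<Sum>a\<in>A. \<Sum>b\<in>B. \<Sum>t\<in>T. h u a b t) = (\<Sum>u\<in>U. \<Sum>b\<in>B. \<Sum>a\<in>A. \<Sum>t\<in>T. h u a b t)"
    by (rule sum.cong [OF refl], rule sum.swap)
  also have "\<dots> = (\<Sum>b\<in>B. \<Sum>u\<in>U. \<Sum>a\<in>A. \<Sum>t\<in>T. h u a b t)"
    by (rule sum.swap)
  also have "\<dots> = (\<Sum>b\<in>B. \<Sum>u\<in>U. \<Sum>t\<in>T. \<Sum>a\<in>A. h u a b t)"
    by (rule sum.cong [OF refl], rule sum.cong [OF refl], rule sum.swap)
  also have "\<dots> = (\<Sum>b\<in>B. \<Sum>t\<in>T. \<Sum>u\<in>U. \<Sum>a\<in>A. h u a b t)"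
    by (rule sum.cong [OF refl], rule sum.swap)
  finally show ?thesis .
qed

lemma sum_split_zero:
  fixes f :: "'a::{zero, finite} \<Rightarrow> 'b::comm_monoid_add"
  shows "(\<Sum>x\<in>UNIV. f x) = f 0 + (\<Sum>x\<in>- {0}. f x)"
proof -
  have "(UNIV :: 'a set) = insert 0 (- {0})" by auto
  then show ?thesis by (metis ComplD finite insertI1 sum.insert)
qed

lemma nu_snoc_fvec:
  assumes "\<And>i. X i \<in> hspace n"
  shows "nu n v c \<circ> snoc n X (fvec n) =
    snoc n (\<lambda>i. X i - sform n (X i) v *s evec n) (fvec n + (v + c *s evec n))"
  using hspace_top_coord[OF assms] by (auto simp: snoc_def nu_def fun_eq_iff)

lemma mu_snoc_evec:
  assumes "\<And>i. X i \<in> hspace n"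
  shows "mu n v c \<circ> snoc n X (evec n) =
    snoc n (\<lambda>i. X i + sform n (X i) v *s fvec n) (evec n + (v + c *s fvec n))"
  using hspace_top_coord[OF assms] by (auto simp: snoc_def mu_def fun_eq_iff)

lemma transv_hcons_snoc:
  assumes "\<And>i. X i \<in> hspace n" "u \<in> hspace n"
  shows "transv (Suc n) (hcons n u a b) t \<circ> snoc n X w =
    snoc n (\<lambda>i. X i + (t * sform n (X i) u) *s hcons n u a b) (transv (Suc n) (hcons n u a b) t w)"
proof -
  have "transv (Suc n) (hcons n u a b) t (X i) = X i + (t * sform n (X i) u) *s hcons n u a b" for i
    using hspace_top_coord[OF assms(1)[of i]] 
    by (simp add: transv_def sform_Suc hcons_def sform_linear)
  then show ?thesis by (auto simp: snoc_def fun_eq_iff)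
qed

lemma transv_hcons_evec:
  assumes "u \<in> hspace n"
  shows "transv (Suc n) (hcons n u a b) t (evec n) = evec n + (t * b) *s hcons n u a b"
  using hspace_top_coord[OF assms] by (simp add: transv_def sform_Suc hcons_def)

lemma transv_hcons_fvec:
  assumes "u \<in> hspace n"
  shows "transv (Suc n) (hcons n u a b) t (fvec n) = fvec n - (t * a) *s hcons n u a b"
  using hspace_top_coord[OF assms] by (auto simp: transv_def sform_Suc hcons_def fun_eq_iff)

definition coeff_vecs :: "nat \<Rightarrow> (nat \<Rightarrow> 'a::zero) set" where
  "coeff_vecs n = {a. \<forall>i\<ge>n. a i = 0}"

lemma coeff_vecs_Suc_bij: "bij_betw (\<lambda>(a, c). a(n := c)) (coeff_vecs n \<times> UNIV) (coeff_vecs (Suc n))"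
proof (rule bij_betwI[where g = "\<lambda>a. (a(n := 0), a n)"])
  show "(\<lambda>(a, c). a(n := c)) \<in> coeff_vecs n \<times> UNIV \<rightarrow> coeff_vecs (Suc n)"
    by (auto simp: coeff_vecs_def)
qed (auto simp: coeff_vecs_def fun_eq_iff le_Suc_eq)

lemma finite_coeff_vecs [simp]: "finite (coeff_vecs n :: (nat \<Rightarrow> 'a::{zero, finite}) set)"
  and card_coeff_vecs: "card (coeff_vecs n :: (nat \<Rightarrow> 'a::{zero, finite}) set) = CARD('a) ^ n"
proof (induction n)
  case 0
  have "coeff_vecs 0 = {\<lambda>_. 0 :: 'a}" by (auto simp: coeff_vecs_def)
  then show "finite (coeff_vecs 0 :: (nat \<Rightarrow> 'a) set)" "card (coeff_vecs 0 :: (nat \<Rightarrow> 'a) set) = CARD('a) ^ 0"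
    by simp_all
next
  case (Suc n)
  show "finite (coeff_vecs (Suc n) :: (nat \<Rightarrow> 'a) set)"
    using Suc(1) by (simp add: bij_betw_finite[OF coeff_vecs_Suc_bij, symmetric])
  show "card (coeff_vecs (Suc n) :: (nat \<Rightarrow> 'a) set) = CARD('a) ^ Suc n"
    using Suc(2) by (simp add: bij_betw_same_card[OF coeff_vecs_Suc_bij, symmetric] card_cartesian_product)
qed

lemma lincomb_add: "lincomb n (\<lambda>i. a i + b i) X = lincomb n a X + lincomb n b X"
  by (auto simp: lincomb_def fun_eq_iff sum_fun_apply sum.distrib algebra_simps)

lemma sum_delta_mult:
  fixes f g :: "nat \<Rightarrow> 'a::field"
  assumes "j < n" "\<And>k. k < n \<Longrightarrow> g k = (if k = j then d else 0)"
  shows "(\<Sum>k<n. f k * g k) = f j * d"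
proof -
  have "(\<Sum>k<n. f k * g k) = (\<Sum>k<n. if k = j then f k * d else 0)"
    by (rule sum.cong) (auto simp: assms(2))
  then show ?thesis using assms(1) by simp
qed

text \<open>
  The isometry that carries the standard frame to \<open>X\<close> and the complementary standard frame to \<open>- Z\<close>.
\<close>
lemma frame_isometry:
  fixes X :: "nat \<Rightarrow> 'a::field hvec"
  assumes X: "X \<in> isotuples n" and Z: "Z \<in> duals n X"
  shows "(\<lambda>x. lincomb n (\<lambda>i. x (i, True)) X - lincomb n (\<lambda>i. x (i, False)) Z) \<in> isometries n"
    (is "?g \<in> _")
proof -
  have Zt: "Z \<in> isotuples n" and ZX: "\<And>i j. i < n \<Longrightarrow> j < n \<Longrightarrow> sform n (Z i) (X j) = (if i = j then 1 else 0)"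
    using Z by (auto simp: duals_def)
  have XZ: "\<And>i j. i < n \<Longrightarrow> j < n \<Longrightarrow> sform n (X i) (Z j) = - (if j = i then 1 else 0)"
    by (subst sform_skew) (simp add: ZX)
  have "?g (x + y) = ?g x + ?g y" "?g (c *s x) = c *s ?g x" for x y c
    by (auto simp: lincomb_def fun_eq_iff sum_fun_apply sum.distrib algebra_simps sum_distrib_left)
  moreover have "?g x \<in> hspace n" for x
    by (intro hspace_diff lincomb_hspace isotuplesD(1)[OF X] isotuplesD(1)[OF Zt])
  moreover have "sform n (?g x) (?g y) = sform n x y" for x y
  proof -
    have 1: "(\<Sum>j<n. y (j, False) * sform n (X i) (Z j)) = y (i, False) * - 1" if "i < n" for i
      by (rule sum_delta_mult) (use that in \<open>auto simp: XZ\<close>)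
    have 2: "(\<Sum>j<n. y (j, True) * sform n (Z i) (X j)) = y (i, True) * 1" if "i < n" for i
      by (rule sum_delta_mult) (use that in \<open>auto simp: ZX\<close>)
    have "sform n (?g x) (?g y) =
      - (\<Sum>i<n. x (i, True) * (\<Sum>j<n. y (j, False) * sform n (X i) (Z j)))
      - (\<Sum>i<n. x (i, False) * (\<Sum>j<n. y (j, True) * sform n (Z i) (X j)))"
      by (simp only: sform_diff_left sform_lincomb_left)
        (simp add: sform_diff_right sform_lincomb_right isotuplesD(3)[OF X] isotuplesD(3)[OF Zt] sum_negf)
    also have "\<dots> = - (\<Sum>i<n. x (i, True) * (y (i, False) * - 1)) - (\<Sum>i<n. x (i, False) * (y (i, True) * 1))"
      using 1 2 by (intro arg_cong2[of _ _ _ _ "(-)"] arg_cong[of _ _ uminus] sum.cong) auto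
    also have "\<dots> = sform n x y" by (simp add: sform_def sum_subtractf sum_negf)
    finally show ?thesis .
  qed
  ultimately show ?thesis by (simp add: isometries_def)
qed

text \<open>
  A Lagrangian is its own orthogonal complement.  If \<open>v\<close> is orthogonal to the frame \<open>X\<close>, pull it back by
  an isometry that carries the standard frame to \<open>X\<close>; there the claim can be read off the coordinates.
\<close>
lemma frame_perp_bij:
  fixes X :: "nat \<Rightarrow> 'a::{field, finite} hvec"
  assumes X: "X \<in> frames n"
  shows "bij_betw (\<lambda>a. lincomb n a X) (coeff_vecs n) {v \<in> hspace n. \<forall>i<n. sform n (X i) v = 0}"
proof -
  obtain Z where Z: "Z \<in> duals n X" using X by (auto simp: frames_def)
  have Xt: "X \<in> isotuples n" using X by (simp add: frames_def)
  define g where "g = (\<lambda>x. lincomb n (\<lambda>i. x (i, True)) X - lincomb n (\<lambda>i. x (i, False)) Z)"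
  have g: "g \<in> isometries n" unfolding g_def by (rule frame_isometry[OF Xt Z])
  have Z_pair: "sform n (Z i) (lincomb n a X) = a i" if i: "i < n" for a i
  proof -
    have "sform n (Z i) (X k) = (if k = i then 1 else 0)" if "k < n" for k
      using Z i that by (auto simp: duals_def)
    then show ?thesis
      using sum_delta_mult[OF i, of "\<lambda>j. sform n (Z i) (X j)" 1 a] by (simp add: sform_lincomb_right)
  qed
  have "inj_on (\<lambda>a. lincomb n a X) (coeff_vecs n)"
  proof (rule inj_onI)
    fix a b :: "nat \<Rightarrow> 'a" assume ab: "a \<in> coeff_vecs n" "b \<in> coeff_vecs n" "lincomb n a X = lincomb n b X"
    show "a = b"
    proof
      show "a i = b i" for i
        using ab Z_pair[of i a] Z_pair[of i b] by (cases "i < n") (auto simp: coeff_vecs_def)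
    qed
  qed
  moreover have "lincomb n a X \<in> {v \<in> hspace n. \<forall>i<n. sform n (X i) v = 0}" for a
    using framesD(2,4)[OF X] by (auto intro!: lincomb_hspace simp: sform_lincomb_right)
  moreover have "v \<in> (\<lambda>a. lincomb n a X) ` coeff_vecs n"
    if v: "v \<in> hspace n" "\<forall>i<n. sform n (X i) v = 0" for v
  proof -
    obtain x where x: "x \<in> hspace n" "v = g x"
      using isometry_bij[OF g] v(1) by (auto simp: bij_betw_def)
    have "x (i, False) = 0" if i: "i < n" for i
    proof -
      have "g (evec i) = lincomb n (\<lambda>j. if i = j then 1 else 0) X - lincomb n (\<lambda>_. 0) Z"
        unfolding g_def by (intro arg_cong2[of _ _ _ _ "(-)"] lincomb_cong) auto
      then have "g (evec i) = X i" using i by (simp add: lincomb_delta) (simp add: lincomb_def)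
      then have "sform n (evec i) x = 0"
        using isometryD(4)[OF g, of "evec i" x] x v(2) i by simp
      then show ?thesis using i by (simp add: sform_evec_left)
    qed
    then have "v = lincomb n (\<lambda>i. if i < n then x (i, True) else 0) X - lincomb n (\<lambda>_. 0) Z"
      unfolding x(2) g_def by (intro arg_cong2[of _ _ _ _ "(-)"] lincomb_cong) auto
    then have "v = lincomb n (\<lambda>i. if i < n then x (i, True) else 0) X"
      by (simp add: lincomb_def)
    then show ?thesis by (auto simp: coeff_vecs_def)
  qed
  ultimately show ?thesis by (auto simp: bij_betw_def)
qed

context quadratic_character
begin

lemma avg_op_eq:
  assumes "X \<in> frames n"
  shows "avg_op n F X = (\<Sum>v\<in>hspace n. \<Sum>c\<in>UNIV. F (nu n v c \<circ> snoc n X (fvec n)))"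
  using assms frames_snoc_fvec[OF assms] by (simp add: avg_op_def avg_def)

text \<open>
  Write \<open>u = u' + a e + b f\<close> with \<open>u'\<close> in \<open>hspace n\<close>.  For \<open>b = 0\<close> the transvection fixes \<open>e\<close> and acts on
  the other vectors as the transvection of \<open>u'\<close>, up to multiples of \<open>e\<close>; these terms give the first summand,
  with a factor \<open>q\<close> from \<open>a\<close>.  For \<open>b \<noteq> 0\<close> the line of \<open>e\<close> is moved, and the new Lagrangian is a
  translate by some \<open>nu n v c\<close>, where \<open>(v, c)\<close> runs over all parameters once for each pair \<open>(b, t)\<close>.  The base
  change has determinant \<open>t b^2\<close>, and its sign cancels the weight \<open>\<beta> t\<close>.
\<close>
lemma res_transv:
  assumes F: "F \<in> sections (Suc n)" and X: "X \<in> frames n"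
  shows "res_op n (transv_op (Suc n) F) X = q * transv_op n (res_op n F) X + (q - 1)\<^sup>2 * avg_op n F X"
proof -
  note Xh = framesD(2)[OF X]
  define G where "G = (\<lambda>v c. F (nu n v c \<circ> snoc n X (fvec n)))"
  define T where "T = (\<lambda>u a b t. \<beta> t * F (transv (Suc n) (hcons n u a b) t \<circ> snoc n X (evec n)))"
  have T0: "T u a 0 t = \<beta> t * res_op n F (transv n u t \<circ> X)" if u: "u \<in> hspace n" for u a t
  proof -
    have fr: "transv n u t \<circ> X \<in> frames n" by (rule frames_isometry[OF transv_isometry[OF u] X])
    have "transv (Suc n) (hcons n u a 0) t \<circ> snoc n X (evec n) =
      snoc n (\<lambda>i. (transv n u t \<circ> X) i + (t * sform n (X i) u * a) *s evec n) (1 *s evec n)"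
      unfolding transv_hcons_snoc[of X n, OF Xh u] transv_hcons_evec[OF u]
      by (rule snoc_cong) (auto simp: transv_def hcons_def fun_eq_iff algebra_simps)
    then show ?thesis
      using sections_add_last[OF F frames_snoc_evec[OF fr], of 1 "\<lambda>i. t * sform n (X i) u * a"] fr
      by (simp add: T_def res_op_def)
  qed
  \<comment> \<open>The new last vector is \<open>t b^2 w\<close>, where \<open>w\<close> is the last vector of the translate by \<open>nu\<close>.\<close>
  have T1: "T u a b t = G (inverse b *s u) (inverse b * a + 1 / (t * b * b))"
    if u: "u \<in> hspace n" and b: "b \<noteq> 0" and t: "t \<noteq> 0" for u a b t
  proof -
    let ?v = "inverse b *s u" and ?c = "inverse b * a + 1 / (t * b * b)"
    have v: "?v \<in> hspace n" using u by (rule hspace_smul)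
    define w where "w = fvec n + (?v + ?c *s evec n)"
    define Y where "Y = (\<lambda>i. X i - sform n (X i) ?v *s evec n)"
    have nu: "nu n ?v ?c \<circ> snoc n X (fvec n) = snoc n Y w"
      unfolding Y_def w_def by (rule nu_snoc_fvec[of X n, OF Xh])
    have fr: "snoc n Y w \<in> frames (Suc n)"
      unfolding nu[symmetric] by (rule frames_isometry[OF nu_isometry[OF v] frames_snoc_fvec[OF X]])
    have "transv (Suc n) (hcons n u a b) t \<circ> snoc n X (evec n) =
        snoc n (\<lambda>i. Y i + (t * sform n (X i) u * b) *s w) ((t * b * b) *s w)"
      unfolding transv_hcons_snoc[of X n, OF Xh u] transv_hcons_evec[OF u]
      by (rule snoc_cong) (use b t in \<open>auto simp: Y_def w_def hcons_def fun_eq_iff sform_linear field_simps\<close>)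
    then have "T u a b t = \<beta> t * (\<beta> (t * b * b) * F (snoc n Y w))"
      using sections_add_last[OF F fr, of "t * b * b"] b t by (simp add: T_def)
    then show ?thesis using square[OF t] b t nu by (simp add: mult_square mult.assoc[symmetric] G_def)
  qed
  have "res_op n (transv_op (Suc n) F) X = (\<Sum>u\<in>hspace n. \<Sum>a\<in>UNIV. \<Sum>b\<in>UNIV. \<Sum>t\<in>- {0}. T u a b t)"
    using X frames_snoc_evec[OF X] by (simp add: res_op_def transv_op_def sum_hspace_Suc T_def)
  also have "\<dots> = (\<Sum>u\<in>hspace n. \<Sum>a\<in>(UNIV :: 'a set). \<Sum>t\<in>- {0}. T u a 0 t)
      + (\<Sum>u\<in>hspace n. \<Sum>a\<in>UNIV. \<Sum>b\<in>- {0}. \<Sum>t\<in>- {0}. T u a b t)"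
    by (simp add: sum_split_zero[of "\<lambda>b. \<Sum>t\<in>- {0}. T _ _ b t"] sum.distrib)
  also have "(\<Sum>u\<in>hspace n. \<Sum>a\<in>(UNIV :: 'a set). \<Sum>t\<in>- {0}. T u a 0 t) = q * transv_op n (res_op n F) X"
    using X by (simp add: T0 transv_op_def q_def sum_distrib_left cong: sum.cong)
  also have "(\<Sum>u\<in>hspace n. \<Sum>a\<in>UNIV. \<Sum>b\<in>- {0}. \<Sum>t\<in>- {0}. T u a b t) =
      (\<Sum>b\<in>- {0}. \<Sum>t\<in>- {0}. \<Sum>u\<in>hspace n. \<Sum>a\<in>UNIV. G (inverse b *s u) (inverse b * a + 1 / (t * b * b)))"
    by (subst sum_swap_pairs) (auto intro!: sum.cong T1)
  also have "\<dots> = (\<Sum>b\<in>- {0 :: 'a}. \<Sum>t\<in>- {0 :: 'a}. avg_op n F X)"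
  proof (intro sum.cong refl)
    fix b t :: 'a assume "b \<in> - {0}" "t \<in> - {0}"
    then have b: "inverse b \<noteq> 0" by simp
    have "(\<Sum>u\<in>hspace n. \<Sum>a\<in>UNIV. G (inverse b *s u) (inverse b * a + 1 / (t * b * b))) =
          (\<Sum>u\<in>hspace n. \<Sum>a\<in>UNIV. G (inverse b *s u) a)"
      by (intro sum.cong refl sum_field_affine b)
    then show "(\<Sum>u\<in>hspace n. \<Sum>a\<in>UNIV. G (inverse b *s u) (inverse b * a + 1 / (t * b * b))) = avg_op n F X"
      using sum_hspace_smul[OF b, of "\<lambda>u. \<Sum>a\<in>UNIV. G u a" n] by (simp add: avg_op_eq[OF X] G_def)
  qed
  also have "\<dots> = (q - 1)\<^sup>2 * avg_op n F X"
    by (simp add: card_units power2_eq_square)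
  finally show ?thesis .
qed

end

section \<open>Transvections and the average over a unipotent radical\<close>

context quadratic_character
begin

text \<open>
  The maps \<open>nu n v c\<close> move a frame through \<open>evec n\<close> only by multiples of \<open>evec n\<close>.
\<close>
lemma avg_snoc_evec:
  assumes F: "F \<in> sections (Suc n)" and X: "X \<in> frames n"
  shows "avg n F (snoc n X (evec n)) = q ^ (2 * n + 1) * res_op n F X"
proof -
  note Xh = framesD(2)[OF X]
  have "F (nu n v c \<circ> snoc n X (evec n)) = res_op n F X" if v: "v \<in> hspace n" for v c
  proof -
    have "nu n v c \<circ> snoc n X (evec n) =
        snoc n (\<lambda>i. X i + (- sform n (X i) v) *s evec n) (1 *s evec n)"
      using hspace_top_coord[OF Xh] by (auto simp: snoc_def nu_def fun_eq_iff)
    then show ?thesis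
      using sections_add_last[OF F frames_snoc_evec[OF X], of 1 "\<lambda>i. - sform n (X i) v"] X
      by (simp add: res_op_def)
  qed
  then show ?thesis using frames_snoc_evec[OF X]
    by (simp add: avg_def card_hspace q_def cong: sum.cong)
qed

text \<open>
  With \<open>\<Phi> v c\<close> the summand on the left, the sum splits according to whether \<open>c\<close> is zero.  For \<open>c \<noteq> 0\<close> the frame
  is equivalent, under some \<open>nu\<close>, to a transvection of \<open>X\<close> extended by \<open>fvec n\<close> (the relation
  between upper and lower unipotent matrices in \<open>SL_2\<close>); this gives the values of \<open>transv_op\<close>.  For
  \<open>c = 0\<close> and \<open>v\<close> in the span of \<open>X\<close> the Lagrangian contains \<open>evec n\<close>, which gives the restriction.  For the
  remaining \<open>v\<close> with \<open>c = 0\<close> there is no such description; but \<open>\<Phi> (v + x) c = \<Phi> v (c - sform n x v)\<close> for \<open>x\<close> in the span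
  of \<open>X\<close> shows that the sum over these \<open>v\<close> does not depend on \<open>c\<close>, and so it is the mean of the
  terms with \<open>c \<noteq> 0\<close>.
\<close>
lemma sum_avg_mu:
  assumes F: "F \<in> sections (Suc n)" and X: "X \<in> frames n"
  shows "(q - 1) * (\<Sum>v\<in>hspace n. \<Sum>c\<in>UNIV. avg n F (mu n v c \<circ> snoc n X (evec n))) =
    (q - 1) * q ^ (3 * n + 1) * res_op n F X + \<beta> (- 1) * q * transv_op n (avg_op n F) X"
proof -
  note Xh = framesD(2)[OF X]
  have H: "avg n F \<in> sections (Suc n)" by (rule sections_avg[OF F])
  define \<Phi> where "\<Phi> = (\<lambda>v c. avg n F (mu n v c \<circ> snoc n X (evec n)))"
  define N where "N = {v \<in> hspace n. \<forall>i<n. sform n (X i) v = 0}"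
  have fr: "mu n v c \<circ> snoc n X (evec n) \<in> frames (Suc n)" if "v \<in> hspace n" for v c
    by (rule frames_isometry[OF mu_isometry[OF that] frames_snoc_evec[OF X]])
  have l_hspace: "lincomb n a X \<in> hspace n" for a by (rule lincomb_hspace) (rule Xh)
  have X_l: "sform n (X i) (lincomb n a X) = 0" for i a
    by (simp add: sform_lincomb_right framesD(4)[OF X])
  \<comment> \<open>If \<open>c \<noteq> 0\<close>, then \<open>c^(-1)\<close> times the last vector has \<open>fvec n\<close>-coordinate one, so it can play the role of \<open>fvec n\<close>.\<close>
  have invert: "\<Phi> v c = \<beta> c * avg_op n F (transv n v (- inverse c) \<circ> X)" if v: "v \<in> hspace n" and c: "c \<noteq> 0" for v c
  proof -
    let ?v = "inverse c *s v"
    define Y where "Y = transv n v (- inverse c) \<circ> X"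
    have Y: "Y \<in> frames n" unfolding Y_def by (rule frames_isometry[OF transv_isometry[OF v] X])
    note Yh = framesD(2)[OF Y]
    have v': "?v \<in> hspace n" using v by (rule hspace_smul)
    define w where "w = fvec n + (?v + inverse c *s evec n)"
    define T where "T = (\<lambda>i. Y i - sform n (Y i) ?v *s evec n)"
    have nu: "nu n ?v (inverse c) \<circ> snoc n Y (fvec n) = snoc n T w"
      unfolding T_def w_def by (rule nu_snoc_fvec[of Y n, OF Yh])
    have frT: "snoc n T w \<in> frames (Suc n)"
      unfolding nu[symmetric] by (rule frames_isometry[OF nu_isometry[OF v'] frames_snoc_fvec[OF Y]])
    have "mu n v c \<circ> snoc n X (evec n) = snoc n (\<lambda>i. T i + sform n (X i) v *s w) (c *s w)"
      unfolding mu_snoc_evec[of X n, OF Xh]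
      by (rule snoc_cong)
        (use c in \<open>auto simp: T_def Y_def w_def transv_def fun_eq_iff sform_linear field_simps\<close>)
    then have "\<Phi> v c = \<beta> c * avg n F (snoc n T w)"
      using sections_add_last[OF H frT c] by (simp add: \<Phi>_def)
    also have "avg n F (snoc n T w) = avg_op n F Y"
      unfolding nu[symmetric] avg_nu_invariant[OF v' frames_snoc_fvec[OF Y]] using Y by (simp add: avg_op_def)
    finally show ?thesis by (simp add: Y_def)
  qed
  \<comment> \<open>Subtracting from the last vector the same combination of the other vectors changes \<open>c\<close>.\<close>
  have shift: "\<Phi> (v + lincomb n a X) c = \<Phi> v (c - sform n (lincomb n a X) v)" if v: "v \<in> hspace n" for v c a
  proof -
    let ?c = "c - sform n (lincomb n a X) v"
    define T where "T = (\<lambda>i. X i + sform n (X i) v *s fvec n)"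
    define w where "w = evec n + (v + ?c *s fvec n)"
    have 1: "mu n v ?c \<circ> snoc n X (evec n) = snoc n T w"
      unfolding T_def w_def by (rule mu_snoc_evec[of X n, OF Xh])
    have "lincomb n a T = lincomb n a X + sform n (lincomb n a X) v *s fvec n"
      by (simp add: T_def sform_lincomb_left lincomb_def fun_eq_iff sum_fun_apply distrib_left
          sum.distrib sum_distrib_right mult.assoc sform_sum_left sform_smul_left)
    then have "mu n (v + lincomb n a X) c \<circ> snoc n X (evec n) = snoc n T (w + lincomb n a T)"
      unfolding mu_snoc_evec[of X n, OF Xh]
      by (intro snoc_cong) (simp_all add: T_def w_def sform_linear X_l fun_eq_iff algebra_simps)
    then show ?thesis using sections_add_to_last[OF H, of T w a] fr[OF v, of ?c] 1 by (simp add: \<Phi>_def)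
  qed
  have N: "finite N" "N \<subseteq> hspace n" by (auto simp: N_def)
  have "\<Phi> v 0 = q ^ (2 * n + 1) * res_op n F X" if "v \<in> N" for v
  proof -
    have "v \<in> (\<lambda>a. lincomb n a X) ` coeff_vecs n"
      using bij_betw_imp_surj_on[OF frame_perp_bij[OF X]] that unfolding N_def by simp
    then obtain a where a: "v = lincomb n a X" by (rule imageE)
    have "mu n 0 0 \<circ> snoc n X (evec n) = snoc n X (evec n)"
      unfolding mu_snoc_evec[of X n, OF Xh] by (rule snoc_cong) auto
    then show ?thesis using shift[of 0 a 0] a avg_snoc_evec[OF F X] by (simp add: \<Phi>_def)
  qed
  moreover have "of_nat (card N) = q ^ n"
    using bij_betw_same_card[OF frame_perp_bij[OF X]] by (simp add: N_def card_coeff_vecs q_def)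
  ultimately have sum_N: "(\<Sum>v\<in>N. \<Phi> v 0) = q ^ (3 * n + 1) * res_op n F X"
    by (simp add: power_add[symmetric] mult.assoc[symmetric])
  \<comment> \<open>For \<open>v\<close> outside \<open>N\<close> the shift of \<open>c\<close> takes every value when \<open>a\<close> varies.\<close>
  have equi: "(\<Sum>v\<in>hspace n - N. \<Phi> v c) = (\<Sum>v\<in>hspace n - N. \<Phi> v c')" for c c'
  proof -
    have A: "of_nat (card (coeff_vecs n :: (nat \<Rightarrow> 'a) set)) * (\<Sum>v\<in>hspace n - N. \<Phi> v d) =
        (\<Sum>v\<in>hspace n - N. \<Sum>a\<in>coeff_vecs n. \<Phi> v (d - sform n (lincomb n a X) v))" for d
    proof -
      have coset: "(\<Sum>v\<in>hspace n - N. \<Phi> v d) = (\<Sum>v\<in>hspace n - N. \<Phi> v (d - sform n (lincomb n a X) v))" for a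
      proof -
        have "(\<Sum>v\<in>hspace n - N. \<Phi> v d) = (\<Sum>v\<in>hspace n - N. \<Phi> (v + lincomb n a X) d)"
          by (rule sum.reindex_bij_witness[where i = "\<lambda>v. v + lincomb n a X" and j = "\<lambda>v. v - lincomb n a X"])
            (auto simp: N_def sform_linear X_l intro: hspace_closed l_hspace)
        also have "\<dots> = (\<Sum>v\<in>hspace n - N. \<Phi> v (d - sform n (lincomb n a X) v))"
          by (rule sum.cong) (auto simp: shift)
        finally show ?thesis .
      qed
      have "(\<Sum>a\<in>(coeff_vecs n :: (nat \<Rightarrow> 'a) set). \<Sum>v\<in>hspace n - N. \<Phi> v d) =
          (\<Sum>a\<in>coeff_vecs n. \<Sum>v\<in>hspace n - N. \<Phi> v (d - sform n (lincomb n a X) v))"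
        by (rule sum.cong [OF refl], rule coset)
      then show ?thesis by (subst sum.swap) simp
    qed
    have shift_a: "(\<Sum>a\<in>coeff_vecs n. \<Phi> v (c - sform n (lincomb n a X) v)) =
        (\<Sum>a\<in>coeff_vecs n. \<Phi> v (c' - sform n (lincomb n a X) v))" if v: "v \<in> hspace n - N" for v
    proof -
      obtain i where i: "i < n" "sform n (X i) v \<noteq> 0" using v by (auto simp: N_def)
      define b where "b = (\<lambda>j. if j = i then (c - c') / sform n (X i) v else 0)"
      have b: "b \<in> coeff_vecs n" using i by (auto simp: b_def coeff_vecs_def)
      have "sform n (lincomb n b X) v = sform n (X i) v * ((c - c') / sform n (X i) v)"
        unfolding sform_lincomb_left
        using sum_delta_mult[OF i(1), of b "(c - c') / sform n (X i) v" "\<lambda>j. sform n (X j) v"]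
        by (simp add: b_def mult.commute)
      then have lb: "sform n (lincomb n b X) v = c - c'" using i by simp
      have "(\<Sum>a\<in>coeff_vecs n. \<Phi> v (c - sform n (lincomb n a X) v)) =
          (\<Sum>a\<in>coeff_vecs n. \<Phi> v (c - sform n (lincomb n (\<lambda>j. a j + b j) X) v))"
        by (rule sum.reindex_bij_witness[where i = "\<lambda>a j. a j + b j" and j = "\<lambda>a j. a j - b j"])
          (use b in \<open>simp_all add: coeff_vecs_def\<close>)
      also have "\<dots> = (\<Sum>a\<in>coeff_vecs n. \<Phi> v (c' - sform n (lincomb n a X) v))"
        unfolding lincomb_add sform_add_left lb by (simp add: algebra_simps)
      finally show ?thesis .
    qed
    have "of_nat (card (coeff_vecs n :: (nat \<Rightarrow> 'a) set)) * (\<Sum>v\<in>hspace n - N. \<Phi> v c) =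
        of_nat (card (coeff_vecs n :: (nat \<Rightarrow> 'a) set)) * (\<Sum>v\<in>hspace n - N. \<Phi> v c')"
      unfolding A by (rule sum.cong [OF refl], rule shift_a)
    then show ?thesis by (simp add: card_coeff_vecs)
  qed
  have split: "(\<Sum>v\<in>hspace n. \<Phi> v c) = (\<Sum>v\<in>hspace n - N. \<Phi> v c) + (\<Sum>v\<in>N. \<Phi> v c)" for c
    using sum.subset_diff[OF N(2) finite_hspace] .
  have "(\<Sum>c\<in>- {0}. \<Sum>v\<in>hspace n. \<Phi> v c) = (\<Sum>c\<in>- {0}. \<Sum>v\<in>hspace n. \<beta> c * avg_op n F (transv n v (- inverse c) \<circ> X))"
    by (intro sum.cong refl invert) auto
  also have "\<dots> = (\<Sum>t\<in>- {0}. \<Sum>v\<in>hspace n. \<beta> (- 1) * (\<beta> t * avg_op n F (transv n v t \<circ> X)))"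
  proof (rule sum.reindex_bij_witness[where i = "\<lambda>t. - inverse t" and j = "\<lambda>c. - inverse c"])
    fix c :: 'a assume "c \<in> - {0}"
    then have "\<beta> (- 1) * \<beta> (- inverse c) = \<beta> c"
      using mult[of "- 1" "- inverse c"] by (simp add: inverse)
    then show "(\<Sum>v\<in>hspace n. \<beta> (- 1) * (\<beta> (- inverse c) * avg_op n F (transv n v (- inverse c) \<circ> X))) =
        (\<Sum>v\<in>hspace n. \<beta> c * avg_op n F (transv n v (- inverse c) \<circ> X))"
      by (simp add: mult.assoc[symmetric])
  qed auto
  also have "\<dots> = \<beta> (- 1) * transv_op n (avg_op n F) X"
    using X by (subst sum.swap) (simp add: transv_op_def sum_distrib_left)
  finally have units: "(\<Sum>c\<in>- {0}. \<Sum>v\<in>hspace n. \<Phi> v c) = \<beta> (- 1) * transv_op n (avg_op n F) X" .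
  have "(\<Sum>c\<in>- {0}. \<Sum>v\<in>N. \<Phi> v c) = (\<Sum>c\<in>- {0}. \<Sum>v\<in>N. \<beta> c * avg_op n F X)"
  proof (intro sum.cong refl)
    fix c :: 'a and v assume c: "c \<in> - {0}" and v: "v \<in> N"
    have "transv n v (- inverse c) \<circ> X = X"
    proof
      show "(transv n v (- inverse c) \<circ> X) i = X i" for i
        using v framesD(3)[OF X, of i] by (cases "i < n") (auto simp: N_def transv_def)
    qed
    then show "\<Phi> v c = \<beta> c * avg_op n F X" using invert[of v c] c v by (auto simp: N_def)
  qed
  also have "\<dots> = of_nat (card N) * ((\<Sum>c\<in>- {0}. \<beta> c) * avg_op n F X)"
    by (simp add: sum_distrib_left sum_distrib_right)
  finally have "(\<Sum>c\<in>- {0}. \<Sum>v\<in>N. \<Phi> v c) = 0" by (simp add: sum_units)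
  then have "(\<Sum>c\<in>- {0}. \<Sum>v\<in>hspace n - N. \<Phi> v c) = \<beta> (- 1) * transv_op n (avg_op n F) X"
    using units by (simp add: split sum.distrib)
  moreover have "(\<Sum>c\<in>- {0}. \<Sum>v\<in>hspace n - N. \<Phi> v c) = (\<Sum>c\<in>- {0 :: 'a}. \<Sum>v\<in>hspace n - N. \<Phi> v 0)"
    by (intro sum.cong refl equi)
  ultimately have "(q - 1) * (\<Sum>v\<in>hspace n - N. \<Phi> v 0) = \<beta> (- 1) * transv_op n (avg_op n F) X"
    by (simp add: card_units)
  moreover have "(\<Sum>v\<in>hspace n. \<Sum>c\<in>UNIV. \<Phi> v c) = (\<Sum>v\<in>hspace n - N. \<Phi> v 0) + (\<Sum>v\<in>N. \<Phi> v 0)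
      + \<beta> (- 1) * transv_op n (avg_op n F) X"
    using units sum_split_zero[of "\<lambda>c. \<Sum>v\<in>hspace n. \<Phi> v c"] by (subst sum.swap) (simp add: split)
  ultimately show ?thesis unfolding sum_N by (simp add: \<Phi>_def algebra_simps)
qed

text \<open>
  The average commutes with \<open>transv_op\<close>, so that the transvections may be applied to the single
  frame \<open>snoc n X (fvec n)\<close> and to a function invariant under all \<open>nu n v c\<close>.  Then the argument of \<open>res_transv\<close> applies with
  \<open>e\<close> and \<open>f\<close> interchanged, except that the translates of the frame that arise are by \<open>mu\<close>, and they are
  summed by \<open>sum_avg_mu\<close>.
\<close>
lemma avg_transv:
  assumes F: "F \<in> sections (Suc n)" and X: "X \<in> frames n"
  shows "avg_op n (transv_op (Suc n) F) X =
    q\<^sup>2 * transv_op n (avg_op n F) X + \<beta> (- 1) * (q - 1)\<^sup>2 * q ^ (3 * n + 1) * res_op n F X"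
proof -
  note Xh = framesD(2)[OF X]
  note Xf = frames_snoc_fvec[OF X]
  define H where "H = avg n F"
  have H: "H \<in> sections (Suc n)" unfolding H_def by (rule sections_avg[OF F])
  define \<Phi> where "\<Phi> = (\<lambda>v c. H (mu n v c \<circ> snoc n X (evec n)))"
  define T where "T = (\<lambda>u a b t. \<beta> t * H (transv (Suc n) (hcons n u a b) t \<circ> snoc n X (fvec n)))"
  have T0: "T u 0 b t = \<beta> t * avg_op n F (transv n u t \<circ> X)" if u: "u \<in> hspace n" for u b t
  proof -
    have fr: "transv n u t \<circ> X \<in> frames n" by (rule frames_isometry[OF transv_isometry[OF u] X])
    have "transv (Suc n) (hcons n u 0 b) t \<circ> snoc n X (fvec n) =
      snoc n (\<lambda>i. (transv n u t \<circ> X) i + (t * sform n (X i) u * b) *s fvec n) (1 *s fvec n)"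
      unfolding transv_hcons_snoc[of X n, OF Xh u] transv_hcons_fvec[OF u]
      by (rule snoc_cong) (auto simp: transv_def hcons_def fun_eq_iff algebra_simps)
    then show ?thesis
      using sections_add_last[OF H frames_snoc_fvec[OF fr], of 1 "\<lambda>i. t * sform n (X i) u * b"] fr
      by (simp add: T_def avg_op_def H_def)
  qed
  \<comment> \<open>The last vector is now \<open>- t a^2 w\<close>, which is where the sign \<open>\<beta> (-1)\<close> comes from.\<close>
  have T1: "T u a b t = \<beta> (- 1) * \<Phi> (inverse a *s u) (inverse a * b + - 1 / (t * a * a))"
    if u: "u \<in> hspace n" and a: "a \<noteq> 0" and t: "t \<noteq> 0" for u a b t
  proof -
    let ?v = "inverse a *s u" and ?c = "inverse a * b + - 1 / (t * a * a)"
    have v: "?v \<in> hspace n" using u by (rule hspace_smul)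
    define w where "w = evec n + (?v + ?c *s fvec n)"
    define Y where "Y = (\<lambda>i. X i + sform n (X i) ?v *s fvec n)"
    have mu: "mu n ?v ?c \<circ> snoc n X (evec n) = snoc n Y w"
      unfolding Y_def w_def by (rule mu_snoc_evec[of X n, OF Xh])
    have fr: "snoc n Y w \<in> frames (Suc n)"
      unfolding mu[symmetric] by (rule frames_isometry[OF mu_isometry[OF v] frames_snoc_evec[OF X]])
    have "transv (Suc n) (hcons n u a b) t \<circ> snoc n X (fvec n) =
        snoc n (\<lambda>i. Y i + (t * sform n (X i) u * a) *s w) ((- t * a * a) *s w)"
      unfolding transv_hcons_snoc[of X n, OF Xh u] transv_hcons_fvec[OF u]
      by (rule snoc_cong) (use a t in \<open>auto simp: Y_def w_def hcons_def fun_eq_iff sform_linear field_simps\<close>)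
    then have "T u a b t = \<beta> t * (\<beta> (- t * a * a) * H (snoc n Y w))"
      using sections_add_last[OF H fr, of "- t * a * a"] a t by (simp add: T_def)
    also have "\<beta> (- t * a * a) = \<beta> (- 1) * \<beta> t"
      using mult_square[of "- t" a] mult[of "- 1" t] a t by simp
    also have "\<beta> t * (\<beta> (- 1) * \<beta> t * H (snoc n Y w)) = \<beta> (- 1) * (\<beta> t * \<beta> t) * H (snoc n Y w)"
      by (simp add: algebra_simps)
    finally show ?thesis using square[OF t] mu by (simp add: \<Phi>_def)
  qed
  have "avg_op n (transv_op (Suc n) F) X =
      (\<Sum>v\<in>hspace n. \<Sum>c\<in>UNIV. \<Sum>u\<in>hspace (Suc n). \<Sum>t\<in>- {0}.
        \<beta> t * F (nu n v c \<circ> (transv (Suc n) u t \<circ> snoc n X (fvec n))))"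
    unfolding avg_op_eq[OF X] by (intro sum.cong refl transv_op_translate[OF nu_isometry Xf])
  also have "\<dots> = (\<Sum>u\<in>hspace (Suc n). \<Sum>t\<in>- {0}. \<beta> t * H (transv (Suc n) u t \<circ> snoc n X (fvec n)))"
    using frames_isometry[OF transv_isometry Xf]
    by (subst sum_swap_pairs) (simp add: H_def avg_def sum_distrib_left cong: sum.cong)
  also have "\<dots> = (\<Sum>u\<in>hspace n. \<Sum>a\<in>UNIV. \<Sum>b\<in>UNIV. \<Sum>t\<in>- {0}. T u a b t)"
    by (simp add: sum_hspace_Suc T_def)
  also have "\<dots> = (\<Sum>u\<in>hspace n. \<Sum>b\<in>(UNIV :: 'a set). \<Sum>t\<in>- {0}. T u 0 b t)
      + (\<Sum>u\<in>hspace n. \<Sum>a\<in>- {0}. \<Sum>b\<in>UNIV. \<Sum>t\<in>- {0}. T u a b t)"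
    by (simp add: sum_split_zero[of "\<lambda>a. \<Sum>b\<in>UNIV. \<Sum>t\<in>- {0}. T _ a b t"] sum.distrib)
  also have "(\<Sum>u\<in>hspace n. \<Sum>b\<in>(UNIV :: 'a set). \<Sum>t\<in>- {0}. T u 0 b t) = q * transv_op n (avg_op n F) X"
    using X by (simp add: T0 transv_op_def q_def sum_distrib_left cong: sum.cong)
  also have "(\<Sum>u\<in>hspace n. \<Sum>a\<in>- {0}. \<Sum>b\<in>UNIV. \<Sum>t\<in>- {0}. T u a b t) =
      (\<Sum>u\<in>hspace n. \<Sum>a\<in>- {0}. \<Sum>t\<in>- {0}. \<Sum>b\<in>UNIV. T u a b t)"
    by (rule sum.cong [OF refl], rule sum.cong [OF refl], rule sum.swap)
  also have "\<dots> = (\<Sum>a\<in>- {0}. \<Sum>t\<in>- {0}. \<Sum>u\<in>hspace n. \<Sum>b\<in>UNIV. T u a b t)"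
    by (rule trans, rule sum.swap, rule sum.cong [OF refl], rule sum.swap)
  also have "\<dots> = (\<Sum>a\<in>- {0 :: 'a}. \<Sum>t\<in>- {0 :: 'a}. \<beta> (- 1) * (\<Sum>v\<in>hspace n. \<Sum>c\<in>UNIV. \<Phi> v c))"
  proof (intro sum.cong refl)
    fix a t :: 'a assume at: "a \<in> - {0}" "t \<in> - {0}"
    then have a: "inverse a \<noteq> 0" by simp
    have "(\<Sum>u\<in>hspace n. \<Sum>b\<in>UNIV. T u a b t) =
          (\<Sum>u\<in>hspace n. \<Sum>b\<in>UNIV. \<beta> (- 1) * \<Phi> (inverse a *s u) (inverse a * b + - 1 / (t * a * a)))"
      using at by (intro sum.cong refl T1) auto
    also have "\<dots> = (\<Sum>u\<in>hspace n. \<Sum>b\<in>UNIV. \<beta> (- 1) * \<Phi> (inverse a *s u) b)"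
      by (intro sum.cong refl sum_field_affine a)
    also have "\<dots> = (\<Sum>u\<in>hspace n. \<Sum>b\<in>UNIV. \<beta> (- 1) * \<Phi> u b)"
      by (rule sum_hspace_smul[OF a])
    finally show "(\<Sum>u\<in>hspace n. \<Sum>b\<in>UNIV. T u a b t) = \<beta> (- 1) * (\<Sum>v\<in>hspace n. \<Sum>c\<in>UNIV. \<Phi> v c)"
      by (simp add: sum_distrib_left)
  qed
  also have "\<dots> = (q - 1) * \<beta> (- 1) * ((q - 1) * (\<Sum>v\<in>hspace n. \<Sum>c\<in>UNIV. \<Phi> v c))"
    by (simp add: card_units)
  also have "(q - 1) * (\<Sum>v\<in>hspace n. \<Sum>c\<in>UNIV. \<Phi> v c) =
      (q - 1) * q ^ (3 * n + 1) * res_op n F X + \<beta> (- 1) * q * transv_op n (avg_op n F) X"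
    unfolding \<Phi>_def H_def by (rule sum_avg_mu[OF F X])
  also have "q * transv_op n (avg_op n F) X + (q - 1) * \<beta> (- 1) * \<dots> =
      (q + (q - 1) * q * (\<beta> (- 1) * \<beta> (- 1))) * transv_op n (avg_op n F) X
      + \<beta> (- 1) * (q - 1)\<^sup>2 * q ^ (3 * n + 1) * res_op n F X"
    by (simp add: algebra_simps power2_eq_square)
  finally show ?thesis using square[of "- 1"] by (simp add: algebra_simps power2_eq_square)
qed

end

section \<open>The opposition operator and the restriction\<close>

lemma duals_frames:
  assumes X: "X \<in> isotuples n" and Z: "Z \<in> duals n X"
  shows "Z \<in> frames n"
proof -
  have "(\<lambda>i. - X i) \<in> duals n Z"
    using X Z sform_skew[of n "X _" "Z _"]
    by (auto simp: duals_def isotuples_def sform_linear intro: hspace_uminus)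
  then show ?thesis using Z by (auto simp: frames_def duals_def)
qed

text \<open>
  An isotropic tuple dual to \<open>(X, e)\<close> has last vector \<open>- (f + v + c e)\<close> with \<open>v\<close> orthogonal to \<open>X\<close>, and its other
  vectors are those of a tuple dual to \<open>X\<close>, corrected by multiples of \<open>e\<close> that \<open>v\<close> determines.
\<close>
lemma duals_snoc_bij:
  fixes X :: "nat \<Rightarrow> 'a::field hvec"
  assumes X: "X \<in> frames n"
  defines "N \<equiv> {v \<in> hspace n. \<forall>i<n. sform n (X i) v = 0}"
  shows "bij_betw (\<lambda>(Z, v, c). snoc n (\<lambda>i. Z i - sform n (Z i) v *s evec n) (- 1 *s (fvec n + (v + c *s evec n))))
    (duals n X \<times> N \<times> UNIV) (duals (Suc n) (snoc n X (evec n)))"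
proof (rule bij_betwI[where g = "\<lambda>W. (\<lambda>i. if i < n then W i - W i (n, True) *s evec n else 0,
      W n (n, True) *s evec n - W n - fvec n, - W n (n, True))"], goal_cases)
  case 1
  note Xh = hspace_top_coord[OF framesD(2)[OF X]]
  have "snoc n (\<lambda>i. Z i - sform n (Z i) v *s evec n) (- 1 *s (fvec n + (v + c *s evec n))) \<in> duals (Suc n) (snoc n X (evec n))"
    if Z: "Z \<in> duals n X" and v: "v \<in> N" for Z v c
  proof -
    have Zt: "Z \<in> isotuples n" and ZX: "\<And>i j. i < n \<Longrightarrow> j < n \<Longrightarrow> sform n (Z i) (X j) = (if i = j then 1 else 0)"
      using Z by (auto simp: duals_def)
    have vh: "v \<in> hspace n" and vX: "\<And>i. i < n \<Longrightarrow> sform n (X i) v = 0" using v by (auto simp: N_def)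
    have vX': "sform n v (X i) = 0" if "i < n" for i using vX[OF that] sform_skew[of n v "X i"] by simp
    note coord = Xh hspace_top_coord[OF vh] hspace_top_coord[OF isotuplesD(1)[OF Zt]]
    have "Z i - sform n (Z i) v *s evec n \<in> hspace (Suc n)" for i
      by (intro hspace_diff hspace_smul hspace_SucI[OF isotuplesD(1)[OF Zt]]) simp
    moreover have "- 1 *s (fvec n + (v + c *s evec n)) \<in> hspace (Suc n)"
      by (intro hspace_add hspace_smul hspace_SucI[OF vh]) simp_all
    ultimately show ?thesis
      by (auto simp: duals_def isotuples_def snoc_def less_Suc_eq sform_Suc sform_linear coord
          isotuplesD(3)[OF Zt] ZX vX' sform_skew[of n v "Z _"])
  qed
  then show ?case by auto
next
  case 2
  have "(\<lambda>i. if i < n then W i - W i (n, True) *s evec n else 0) \<in> duals n X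
     \<and> W n (n, True) *s evec n - W n - fvec n \<in> N"
    if W: "W \<in> duals (Suc n) (snoc n X (evec n))" for W
  proof -
    have Wt: "W \<in> isotuples (Suc n)" and
      WX: "\<And>i j. i < Suc n \<Longrightarrow> j < Suc n \<Longrightarrow> sform (Suc n) (W i) (snoc n X (evec n) j) = (if i = j then 1 else 0)"
      using W by (auto simp: duals_def)
    note Xh = hspace_top_coord[OF framesD(2)[OF X]]
    have W1: "sform n (W i) (X j) = (if i = j then 1 else 0)" if "i < Suc n" "j < n" for i j
      using WX[OF that(1), of j] that by (simp add: snoc_def sform_Suc Xh)
    have W2: "W i (n, False) = (if i = n then - 1 else 0)" if "i < Suc n" for i
      using WX[OF that, of n] by (simp add: snoc_def sform_Suc minus_equation_iff split: if_splits)
    have W3: "sform n (W i) (W j) = 0" if "i < n" "j < n" for i j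
      using isotuplesD(3)[OF Wt, of i j] W2[of i] W2[of j] that by (simp add: sform_Suc)
    have Wh: "W i (k, b) = 0" if "Suc n \<le> k" for i k b
      using isotuplesD(1)[OF Wt, of i] that by (auto simp: hspace_def)
    have coord: "(W i - W i (n, True) *s evec n) (k, b) = 0" if "i < n" "n \<le> k" for i k b
      using W2[of i] Wh[of k i b] that by (cases "k = n"; cases b) auto
    have "W i - W i (n, True) *s evec n \<in> hspace n" if "i < n" for i
      unfolding hspace_def using coord[OF that] by blast
    moreover have coord': "(W n (n, True) *s evec n - W n - fvec n) (k, b) = 0" if "n \<le> k" for k b
      using W2[of n] Wh[of k n b] that by (cases "k = n"; cases b) auto
    then have "W n (n, True) *s evec n - W n - fvec n \<in> hspace n"
      unfolding hspace_def by blast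
    moreover have "sform n (X i) (W n) = 0" if "i < n" for i
      using W1[of n i] that sform_skew[of n "X i" "W n"] by simp
    ultimately show ?thesis using W1 W3
      by (auto simp: duals_def isotuples_def N_def sform_linear)
  qed
  then show ?case by auto
next
  case (3 p)
  then obtain Z v c where p: "p = (Z, v, c)" and Z: "Z \<in> isotuples n" and v: "v \<in> hspace n"
    by (cases p) (auto simp: N_def duals_def)
  show ?case
    using hspace_top_coord[OF v] hspace_top_coord[OF isotuplesD(1)[OF Z]] isotuplesD(2)[OF Z]
    by (auto simp: p snoc_def fun_eq_iff)
next
  case (4 W)
  then have Wt: "W \<in> isotuples (Suc n)" and
      WX': "\<And>i j. i < Suc n \<Longrightarrow> j < Suc n \<Longrightarrow> sform (Suc n) (W i) (snoc n X (evec n) j) = (if i = j then 1 else 0)"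
    by (auto simp: duals_def)
  have WX: "sform (Suc n) (W i) (evec n) = (if i = n then 1 else 0)" if "i < Suc n" for i
    using WX'[OF that, of n] by (simp add: snoc_def)
  have W2: "W i (n, False) = (if i = n then - 1 else 0)" if "i < Suc n" for i
    using WX[OF that] by (simp add: sform_Suc minus_equation_iff split: if_splits)
  have "sform n (W i) (W n) = W i (n, True)" if "i < n" for i
    using isotuplesD(3)[OF Wt, of i n] W2[of i] W2[of n] that by (simp add: sform_Suc)
  then show ?case using isotuplesD(2)[OF Wt]
    by (auto simp: snoc_def fun_eq_iff sform_linear)
qed

definition std_frame :: "nat \<Rightarrow> nat \<Rightarrow> 'a::field hvec" where
  "std_frame n = (\<lambda>i. if i < n then evec i else 0)"

lemma std_frame_Suc: "std_frame (Suc n) = snoc n (std_frame n) (evec n)"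
  by (auto simp: std_frame_def snoc_def)

lemma std_frame_frames: "std_frame n \<in> frames n"
proof (induction n)
  case 0
  have "0 \<in> duals 0 (std_frame 0 :: nat \<Rightarrow> 'a hvec)" by (auto simp: duals_def isotuples_def)
  moreover have "(std_frame 0 :: nat \<Rightarrow> 'a hvec) \<in> isotuples 0" by (simp add: isotuples_def std_frame_def)
  ultimately show ?case by (auto simp: frames_def)
qed (simp add: std_frame_Suc frames_snoc_evec)

text \<open>
  Witt's theorem for Lagrangian frames.
\<close>
lemma frames_transitive:
  assumes X: "X \<in> frames n"
  obtains g where "g \<in> isometries n" "X = g \<circ> std_frame n"
proof -
  obtain Z where Z: "Z \<in> duals n X" using X by (auto simp: frames_def)
  have Xt: "X \<in> isotuples n" using X by (simp add: frames_def)
  let ?g = "\<lambda>x. lincomb n (\<lambda>i. x (i, True)) X - lincomb n (\<lambda>i. x (i, False)) Z"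
  have "X = ?g \<circ> std_frame n"
  proof
    fix i
    show "X i = (?g \<circ> std_frame n) i"
    proof (cases "i < n")
      case True
      have "lincomb n (\<lambda>j. evec i (j, True)) X = X i"
        using lincomb_delta[OF True, of X] by (simp add: eq_commute[of i] cong: if_cong)
      then show ?thesis using True by (simp add: std_frame_def) (simp add: lincomb_def)
    next
      case False
      then show ?thesis using framesD(3)[OF X, of i] by (simp add: std_frame_def lincomb_def)
    qed
  qed
  then show thesis by (rule that[OF frame_isometry[OF Xt Z]])
qed

lemma finite_carrier_mat: "finite (carrier_mat n m :: 'a::finite mat set)"
proof -
  have "A \<in> mat n m ` (({0..<n} \<times> {0..<m}) \<rightarrow>\<^sub>E UNIV)" if "A \<in> carrier_mat n m" for A :: "'a mat"
  proof
    show "A = mat n m (restrict (\<lambda>(i, j). A $$ (i, j)) ({0..<n} \<times> {0..<m}))"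
      using that by (intro eq_matI) auto
  qed auto
  then show ?thesis by (intro finite_subset[of "carrier_mat n m" "mat n m ` (({0..<n} \<times> {0..<m}) \<rightarrow>\<^sub>E UNIV)"]) (auto intro!: finite_PiE)
qed

context quadratic_character
begin

text \<open>
  The Lagrangians opposite to one through \<open>e\<close> do not contain \<open>e\<close>; modulo \<open>e\<close> they are opposite to the
  Lagrangian of \<open>X\<close>, and the fibres are orbits of the maps \<open>nu n v c\<close> with \<open>v\<close> orthogonal to \<open>X\<close>.  The average
  runs over all \<open>v\<close> instead, and since adding to \<open>v\<close> a vector of the span of \<open>Z\<close> is a base change,
  it counts every term \<open>q^n\<close> times.
\<close>
lemma res_opp:
  assumes F: "F \<in> sections (Suc n)" and X: "X \<in> frames n"
  shows "q ^ n * res_op n (opp_op (Suc n) F) X = \<beta> (- 1) * opp_op n (avg_op n F) X"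
proof -
  define N where "N = {v \<in> hspace n. \<forall>i<n. sform n (X i) v = 0}"
  define G where "G = (\<lambda>Z v. \<Sum>c\<in>UNIV. F (nu n v c \<circ> snoc n Z (fvec n)))"
  have Xt: "X \<in> isotuples n" using X by (simp add: frames_def)
  have frZ: "Z \<in> frames n" if "Z \<in> duals n X" for Z
    by (rule duals_frames[OF Xt that])
  have neg: "F (snoc n (\<lambda>i. Z i - sform n (Z i) v *s evec n) (- 1 *s (fvec n + (v + c *s evec n))))
      = \<beta> (- 1) * F (nu n v c \<circ> snoc n Z (fvec n))" if Z: "Z \<in> duals n X" and v: "v \<in> hspace n" for Z v c
  proof -
    have nu: "nu n v c \<circ> snoc n Z (fvec n) =
      snoc n (\<lambda>i. Z i - sform n (Z i) v *s evec n) (fvec n + (v + c *s evec n))"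
      by (rule nu_snoc_fvec[of Z n, OF framesD(2)[OF frZ[OF Z]]])
    show ?thesis
      using sections_add_last[OF F, of "\<lambda>i. Z i - sform n (Z i) v *s evec n" "fvec n + (v + c *s evec n)" "- 1" "\<lambda>_. 0"]
        frames_isometry[OF nu_isometry[OF v, of c] frames_snoc_fvec[OF frZ[OF Z]]]
      unfolding nu by simp
  qed
  \<comment> \<open>Every vector is uniquely \<open>w + lincomb n a Z\<close> with \<open>w\<close> orthogonal to \<open>X\<close>, because \<open>Z\<close> is dual to \<open>X\<close>.\<close>
  have perp: "(\<Sum>v\<in>hspace n. G Z v) = q ^ n * (\<Sum>v\<in>N. G Z v)" if Z: "Z \<in> duals n X" for Z
  proof -
    have Zt: "Z \<in> isotuples n" and ZX: "\<And>i j. i < n \<Longrightarrow> j < n \<Longrightarrow> sform n (Z i) (X j) = (if i = j then 1 else 0)"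
      using Z by (auto simp: duals_def)
    note Zh = framesD(2)[OF frZ[OF Z]]
    have lX: "sform n (lincomb n a Z) (X j) = a j" if j: "j < n" for a j
      using sum_delta_mult[OF j, of "\<lambda>i. sform n (Z i) (X j)" 1 a] ZX[OF _ j] by (simp add: sform_lincomb_left)
    have lZ: "sform n (Z i) (lincomb n a Z) = 0" for i a
      by (simp add: sform_lincomb_right isotuplesD(3)[OF Zt])
    have lh: "lincomb n a Z \<in> hspace n" for a by (rule lincomb_hspace) (rule Zh)
    have inv: "G Z (w + lincomb n a Z) = G Z w" if w: "w \<in> hspace n" for w a
    proof -
      have "F (nu n (w + lincomb n a Z) (c + - sform n (lincomb n a Z) w) \<circ> snoc n Z (fvec n)) =
            F (nu n w c \<circ> snoc n Z (fvec n))" for c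
      proof -
        define T where "T = (\<lambda>i. Z i - sform n (Z i) w *s evec n)"
        have nu: "nu n w c \<circ> snoc n Z (fvec n) = snoc n T (fvec n + (w + c *s evec n))"
          unfolding T_def by (rule nu_snoc_fvec[of Z n, OF Zh])
        have "lincomb n a T = lincomb n a Z - sform n (lincomb n a Z) w *s evec n"
          by (simp add: T_def sform_lincomb_left lincomb_def fun_eq_iff sum_fun_apply right_diff_distrib
              sum_subtractf sum_distrib_right mult.assoc sform_sum_left sform_smul_left)
        then have "nu n (w + lincomb n a Z) (c + - sform n (lincomb n a Z) w) \<circ> snoc n Z (fvec n) =
            snoc n T (fvec n + (w + c *s evec n) + lincomb n a T)"
          unfolding nu_snoc_fvec[of Z n, OF Zh]
          by (intro snoc_cong) (simp_all add: T_def sform_linear lZ fun_eq_iff algebra_simps)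
        then show ?thesis
          using sections_add_to_last[OF F, of T "fvec n + (w + c *s evec n)" a]
            frames_isometry[OF nu_isometry[OF w, of c] frames_snoc_fvec[OF frZ[OF Z]]] nu by simp
      qed
      then show ?thesis
        using sum_field_shift[of "\<lambda>c. F (nu n (w + lincomb n a Z) c \<circ> snoc n Z (fvec n))" "- sform n (lincomb n a Z) w"]
        by (simp add: G_def)
    qed
    have "(\<Sum>v\<in>hspace n. G Z v) = (\<Sum>p\<in>coeff_vecs n \<times> N. G Z (snd p + lincomb n (fst p) Z))"
    proof (rule sum.reindex_bij_witness[where i = "\<lambda>p. snd p + lincomb n (fst p) Z" and
          j = "\<lambda>v. (\<lambda>i. if i < n then sform n v (X i) else 0, v - lincomb n (\<lambda>i. if i < n then sform n v (X i) else 0) Z)"], goal_cases)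
      case (2 v)
      then show ?case using lh lX sform_skew[of n "X _" "v - _"]
        by (auto simp: coeff_vecs_def N_def sform_diff_left intro: hspace_closed)
    next
      case (3 p)
      then have "(\<lambda>i. if i < n then sform n (snd p + lincomb n (fst p) Z) (X i) else 0) = fst p"
        using lX sform_skew[of n "snd p" "X _"]
        by (auto simp: coeff_vecs_def N_def sform_add_left fun_eq_iff)
      then show ?case by simp
    qed (auto simp: N_def intro: hspace_closed lh)
    also have "\<dots> = (\<Sum>p\<in>(coeff_vecs n :: (nat \<Rightarrow> 'a) set) \<times> N. G Z (snd p))"
      by (rule sum.cong) (auto simp: inv N_def)
    also have "\<dots> = (\<Sum>a\<in>(coeff_vecs n :: (nat \<Rightarrow> 'a) set). \<Sum>v\<in>N. G Z v)"
      unfolding sum.cartesian_product by (simp only: case_prod_unfold)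
    finally show ?thesis by (simp add: card_coeff_vecs q_def)
  qed
  have "res_op n (opp_op (Suc n) F) X = (\<Sum>W\<in>duals (Suc n) (snoc n X (evec n)). F W)"
    using X frames_snoc_evec[OF X] by (simp add: res_op_def opp_op_def)
  also have "\<dots> = (\<Sum>p\<in>duals n X \<times> N \<times> UNIV. \<beta> (- 1) * F (nu n (fst (snd p)) (snd (snd p)) \<circ> snoc n (fst p) (fvec n)))"
    unfolding sum.reindex_bij_betw[OF duals_snoc_bij[OF X], symmetric] N_def[symmetric]
    by (rule sum.cong) (auto simp: neg N_def)
  also have "\<dots> = \<beta> (- 1) * (\<Sum>Z\<in>duals n X. \<Sum>v\<in>N. G Z v)"
    by (simp add: G_def sum.cartesian_product case_prod_unfold sum_distrib_left)
  finally have "q ^ n * res_op n (opp_op (Suc n) F) X = \<beta> (- 1) * (\<Sum>Z\<in>duals n X. q ^ n * (\<Sum>v\<in>N. G Z v))"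
    by (simp add: sum_distrib_left algebra_simps)
  also have "(\<Sum>Z\<in>duals n X. q ^ n * (\<Sum>v\<in>N. G Z v)) = (\<Sum>Z\<in>duals n X. avg_op n F Z)"
  proof (rule sum.cong [OF refl])
    fix Z assume Z: "Z \<in> duals n X"
    show "q ^ n * (\<Sum>v\<in>N. G Z v) = avg_op n F Z"
      using perp[OF Z] unfolding avg_op_eq[OF frZ[OF Z]] G_def by simp
  qed
  finally show ?thesis using X by (simp add: opp_op_def[of n])
qed

lemma opp_op_translate:
  assumes g: "g \<in> isometries n" and X: "X \<in> frames n"
  shows "opp_op n F (g \<circ> X) = opp_op n (translate n g F) X"
proof -
  have Xt: "X \<in> isotuples n" using X by (simp add: frames_def)
  have "opp_op n F (g \<circ> X) = (\<Sum>Z\<in>duals n X. F (g \<circ> Z))"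
    using frames_isometry[OF g X] sum.reindex_bij_betw[OF duals_isometry[OF g Xt], of F] by (simp add: opp_op_def)
  then show ?thesis using X duals_frames[OF Xt] by (simp add: opp_op_def translate_def)
qed

text \<open>
  The function on frames through \<open>e\<close> induced by \<open>\<phi>\<close>, made equivariant by summing over the general linear
  group.  A base change of \<open>(X, e)\<close> has \<open>e\<close> as its last vector only if its last row is a unit vector, and then the
  summand is \<open>\<phi> X\<close>; this is why the restriction is a positive multiple of \<open>\<phi>\<close>.
\<close>
lemma sections_extension:
  assumes \<phi>: "\<phi> \<in> sections n"
  obtains F k where "F \<in> sections (Suc n)" "k \<noteq> 0" "\<And>X. res_op n F X = k * \<phi> X" "\<And>X. avg_op n F X = 0"
proof -
  define GL where "GL = {h \<in> carrier_mat (Suc n) (Suc n). det h \<noteq> (0 :: 'a)}"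
  have GL: "finite GL" unfolding GL_def by (rule finite_subset[OF _ finite_carrier_mat]) auto
  define \<Phi> where "\<Phi> = (\<lambda>Y. if Y n = evec n
    then \<phi> (\<lambda>i. if i < n then Y i - Y i (n, True) *s evec n else 0) else 0)"
  define F where "F = (\<lambda>X. if X \<in> frames (Suc n)
    then \<Sum>h\<in>GL. \<beta> (det h) * \<Phi> (row_act (Suc n) h X) else 0)"
  have last: "row_act (Suc n) h (snoc n X w) n = lincomb n (\<lambda>j. h $$ (n, j)) X + h $$ (n, n) *s w" for h X w
    by (simp add: row_act_def lincomb_Suc lincomb_snoc) (simp add: snoc_def)
  have F1: "F \<in> sections (Suc n)"
  proof -
    have "F (row_act (Suc n) D X) = \<beta> (det D) * F X"
      if D: "D \<in> carrier_mat (Suc n) (Suc n)" "det D \<noteq> 0" and X: "X \<in> frames (Suc n)" for D X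
    proof -
      obtain B where B: "B \<in> carrier_mat (Suc n) (Suc n)" "B * D = 1\<^sub>m (Suc n)" "D * B = 1\<^sub>m (Suc n)" "det B \<noteq> 0"
        using det_nonzero_inverse[OF D] by blast
      have "F (row_act (Suc n) D X) = (\<Sum>h\<in>GL. \<beta> (det h) * \<Phi> (row_act (Suc n) (h * D) X))"
        using frames_row_act[OF D X] D by (simp add: F_def GL_def row_act_row_act)
      also have "\<dots> = (\<Sum>h\<in>GL. \<beta> (det D) * (\<beta> (det h) * \<Phi> (row_act (Suc n) h X)))"
      proof (rule sum.reindex_bij_witness[where i = "\<lambda>h. h * B" and j = "\<lambda>h. h * D"], goal_cases)
        case (5 h)
        then have "\<beta> (det D) * \<beta> (det (h * D)) = \<beta> (det h)"
          using D square[of "det D"] by (simp add: GL_def det_mult[of _ "Suc n"] mult)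
        then show ?case by (simp add: mult.assoc[symmetric])
      qed (use D B in \<open>auto simp: GL_def det_mult[of _ "Suc n"] assoc_mult_mat[of _ "Suc n" "Suc n" _ "Suc n" _ "Suc n"]\<close>)
      finally show ?thesis using X by (simp add: F_def sum_distrib_left)
    qed
    then show ?thesis by (auto simp: sections_def F_def)
  qed
  define S where "S = {h \<in> GL. \<forall>j<Suc n. h $$ (n, j) = (if j = n then 1 else 0)}"
  have one: "1\<^sub>m (Suc n) \<in> S" by (auto simp: S_def GL_def)
  have F2: "res_op n F X = of_nat (card S) * \<phi> X" for X
  proof (cases "X \<in> frames n")
    case True
    note Xh = framesD(2)[OF True]
    obtain Z where Z: "Z \<in> duals n X" using True by (auto simp: frames_def)
    have summand: "\<beta> (det h) * \<Phi> (row_act (Suc n) h (snoc n X (evec n))) = (if h \<in> S then \<phi> X else 0)"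
      if h: "h \<in> GL" for h
    proof (cases "h \<in> S")
      case False
      have "lincomb n (\<lambda>j. h $$ (n, j)) X + h $$ (n, n) *s evec n \<noteq> evec n"
      proof
        assume eq: "lincomb n (\<lambda>j. h $$ (n, j)) X + h $$ (n, n) *s evec n = evec n"
        have lh: "lincomb n (\<lambda>j. h $$ (n, j)) X \<in> hspace n" by (rule lincomb_hspace) (rule Xh)
        have nn: "h $$ (n, n) = 1"
          using fun_cong[OF eq, of "(n, True)"] hspace_top_coord[OF lh] by simp
        have "h $$ (n, j) = 0" if j: "j < n" for j
        proof -
          have "sform n (Z j) (lincomb n (\<lambda>j. h $$ (n, j)) X) = h $$ (n, j) * 1"
            unfolding sform_lincomb_right using Z j by (intro sum_delta_mult) (auto simp: duals_def)
          moreover have "lincomb n (\<lambda>j. h $$ (n, j)) X = 0" using eq nn by simp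
          ultimately show ?thesis by simp
        qed
        then show False using False nn h by (auto simp: S_def less_Suc_eq)
      qed
      then show ?thesis using False by (simp add: \<Phi>_def last)
    next
      case True
      then have hc: "h \<in> carrier_mat (Suc n) (Suc n)" "det h \<noteq> 0" and
        hn: "\<And>j. j < n \<Longrightarrow> h $$ (n, j) = 0" "h $$ (n, n) = 1" by (auto simp: S_def GL_def)
      define M where "M = mat n n (\<lambda>(i, j). h $$ (i, j))"
      have M: "M \<in> carrier_mat n n" by (simp add: M_def)
      have "h = four_block_mat M (mat n 1 (\<lambda>(i, _). h $$ (i, n))) (0\<^sub>m 1 n) (mat 1 1 (\<lambda>_. 1))"
        using hc hn by (intro eq_matI) (auto simp: M_def less_Suc_eq)
      moreover have "det (mat 1 1 (\<lambda>_. 1 :: 'a)) = 1" by (subst det_single) auto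
      ultimately have det: "det h = det M"
        using det_four_block_mat_lower_left_zero[OF M, of "mat n 1 (\<lambda>(i, _). h $$ (i, n))" 1 "0\<^sub>m 1 n" "mat 1 1 (\<lambda>_. 1)"] by simp
      let ?Y = "row_act (Suc n) h (snoc n X (evec n))"
      have "lincomb n (\<lambda>j. h $$ (n, j)) X = 0"
        using hn lincomb_cong[of n "\<lambda>j. h $$ (n, j)" "\<lambda>_. 0" X X] by (simp add: lincomb_def)
      then have "?Y n = evec n" using hn by (simp add: last)
      moreover have "(\<lambda>i. if i < n then ?Y i - ?Y i (n, True) *s evec n else 0) = row_act n M X"
      proof
        fix i
        have lh: "lincomb n (\<lambda>j. M $$ (i, j)) X \<in> hspace n" by (rule lincomb_hspace) (rule Xh)
        have "?Y i = lincomb n (\<lambda>j. M $$ (i, j)) X + h $$ (i, n) *s evec n" if "i < n"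
          using that lincomb_cong[of n "\<lambda>j. h $$ (i, j)" "\<lambda>j. M $$ (i, j)" X X]
          by (simp add: row_act_def lincomb_Suc lincomb_snoc M_def) (simp add: snoc_def)
        then show "(if i < n then ?Y i - ?Y i (n, True) *s evec n else 0) = row_act n M X i"
          using hspace_top_coord[OF lh] by (auto simp: row_act_def fun_eq_iff)
      qed
      ultimately have "\<Phi> ?Y = \<beta> (det M) * \<phi> X"
        using sections_row_act[OF \<phi> M _ \<open>X \<in> frames n\<close>] det hc by (simp add: \<Phi>_def)
      then show ?thesis using True det hc square[of "det M"] by (simp add: mult.assoc[symmetric])
    qed
    have "res_op n F X = (\<Sum>h\<in>GL. if h \<in> S then \<phi> X else 0)"
      using True frames_snoc_evec[OF True] by (simp add: res_op_def F_def summand)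
    also have "\<dots> = of_nat (card S) * \<phi> X"
    proof -
      have "GL \<inter> S = S" by (auto simp: S_def)
      then show ?thesis using sum.inter_restrict[OF GL, of "\<lambda>_. \<phi> X" S] by simp
    qed
    finally show ?thesis .
  next
    case False
    then show ?thesis using \<phi> by (simp add: res_op_def sections_def)
  qed
  have F3: "avg_op n F X = 0" for X
  proof (cases "X \<in> frames n")
    case True
    note Xf = frames_snoc_fvec[OF True]
    have "F (nu n v c \<circ> snoc n X (fvec n)) = 0" if v: "v \<in> hspace n" for v c
    proof -
      note nu = nu_isometry[OF v, of c]
      have "row_act (Suc n) h (nu n v c \<circ> snoc n X (fvec n)) n \<noteq> evec n" for h
      proof
        let ?x = "lincomb n (\<lambda>j. h $$ (n, j)) X + h $$ (n, n) *s fvec n"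
        assume "row_act (Suc n) h (nu n v c \<circ> snoc n X (fvec n)) n = evec n"
        then have "nu n v c ?x = evec n"
          by (simp add: row_act_isometry[OF nu, symmetric] last)
        also have "evec n = nu n v c (evec n)" by (simp add: nu_def fun_eq_iff)
        finally have eq: "nu n v c ?x = nu n v c (evec n)" .
        have lh: "lincomb n (\<lambda>j. h $$ (n, j)) X \<in> hspace n" by (rule lincomb_hspace) (rule framesD(2)[OF True])
        have "?x \<in> hspace (Suc n)" by (intro hspace_add hspace_smul hspace_SucI[OF lh]) simp
        then have "?x = evec n"
          using isometry_bij[OF nu] eq by (auto simp: bij_betw_def inj_on_def)
        from fun_cong[OF this, of "(n, True)"] show False using hspace_top_coord[OF lh] by simp
      qed
      then show ?thesis by (simp add: F_def \<Phi>_def)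
    qed
    then show ?thesis by (simp add: avg_op_eq[OF True])
  qed (simp add: avg_op_def)
  have "finite S" using GL by (simp add: S_def)
  then have "of_nat (card S) \<noteq> (0 :: complex)" using one by auto
  then show thesis using that F1 F2 F3 by blast
qed

end

section \<open>Simultaneous eigenspaces\<close>

abbreviation linear_op :: "(('b \<Rightarrow> complex) \<Rightarrow> ('c \<Rightarrow> complex)) \<Rightarrow> bool" where
  "linear_op T \<equiv> module_hom fun_scale fun_scale T"

lemma linear_opI:
  assumes "\<And>F G. T (F + G) = T F + T G" "\<And>c F. T (fun_scale c F) = fun_scale c (T F)"
  shows "linear_op T"
  unfolding module_hom_def module_hom_axioms_def by (intro conjI allI cfun.module_axioms assms)

text \<open>
  The product of the operators \<open>T - c\<close> for \<open>c\<close> in the list.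
\<close>
definition eigen_factors :: "(('b \<Rightarrow> complex) \<Rightarrow> ('b \<Rightarrow> complex)) \<Rightarrow> complex list \<Rightarrow> ('b \<Rightarrow> complex) \<Rightarrow> 'b \<Rightarrow> complex" where
  "eigen_factors T cs F = foldr (\<lambda>c G. T G - fun_scale c G) cs F"

lemma eigen_factors_Nil [simp]: "eigen_factors T [] F = F"
  and eigen_factors_Cons [simp]: "eigen_factors T (c # cs) F = T (eigen_factors T cs F) - fun_scale c (eigen_factors T cs F)"
  by (simp_all add: eigen_factors_def)

lemma eigen_factors_append: "eigen_factors T (cs @ ds) F = eigen_factors T cs (eigen_factors T ds F)"
  by (simp add: eigen_factors_def)

context
  fixes T :: "('b \<Rightarrow> complex) \<Rightarrow> ('b \<Rightarrow> complex)"
  assumes T: "linear_op T"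
begin

lemma linear_op_eigen_factors: "linear_op (eigen_factors T cs)"
proof (rule linear_opI)
  show "eigen_factors T cs (F + G) = eigen_factors T cs F + eigen_factors T cs G" for F G
    by (induction cs) (simp_all only: eigen_factors_Nil eigen_factors_Cons module_hom.add[OF T] cfun.scale_right_distrib,
      simp add: fun_eq_iff algebra_simps)
  show "eigen_factors T cs (fun_scale c F) = fun_scale c (eigen_factors T cs F)" for c F
    by (induction cs) (simp_all only: eigen_factors_Nil eigen_factors_Cons module_hom.scale[OF T]
      cfun.scale_right_diff_distrib cfun.scale_left_commute)
qed

lemma eigen_factors_comm_op: "eigen_factors T cs (T F) = T (eigen_factors T cs F)"
  by (induction cs) (simp_all only: eigen_factors_Nil eigen_factors_Cons module_hom.diff[OF T] module_hom.scale[OF T])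

lemma eigen_factors_comm: "eigen_factors T cs (eigen_factors T ds F) = eigen_factors T ds (eigen_factors T cs F)"
proof (induction ds)
  case (Cons d ds)
  then show ?case
    by (simp only: eigen_factors_Cons module_hom.diff[OF linear_op_eigen_factors]
        module_hom.scale[OF linear_op_eigen_factors] eigen_factors_comm_op)
qed simp

lemma eigen_factors_eigenvector:
  assumes "T F = fun_scale a F"
  shows "eigen_factors T cs F = fun_scale (\<Prod>c\<leftarrow>cs. a - c) F"
proof (induction cs)
  case (Cons c cs)
  then show ?case
    using assms by (simp only: eigen_factors_Cons module_hom.scale[OF T])
      (simp add: fun_scale_def fun_eq_iff algebra_simps)
qed (simp add: fun_scale_def)

lemma eigen_factors_in_subspace:
  assumes "cfun.subspace W" "\<And>F. F \<in> W \<Longrightarrow> T F \<in> W" "F \<in> W"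
  shows "eigen_factors T cs F \<in> W"
  using assms by (induction cs) (auto intro: cfun.subspace_diff cfun.subspace_scale)

text \<open>
  Induction on the list: subtracting from \<open>F\<close> a multiple of its image under the product over \<open>cs\<close>,
  which is an eigenvector for \<open>c\<close>, gives a vector that is annihilated by the product over \<open>cs\<close>.
\<close>
lemma eigen_decomposition:
  assumes W: "cfun.subspace W" "\<And>F. F \<in> W \<Longrightarrow> T F \<in> W"
    and "distinct cs" "F \<in> W" "eigen_factors T cs F = 0"
  shows "\<exists>f. (\<forall>c\<in>set cs. f c \<in> W \<and> T (f c) = fun_scale c (f c)) \<and> F = (\<Sum>c\<in>set cs. f c)"
  using assms(3-)
proof (induction cs arbitrary: F)
  case (Cons c cs)
  define G where "G = eigen_factors T cs F"
  have "T G - fun_scale c G = 0" using Cons.prems(3) by (simp only: G_def eigen_factors_Cons)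
  then have G: "T G = fun_scale c G" by (simp only: right_minus_eq)
  have GW: "G \<in> W" using Cons.prems(2) eigen_factors_in_subspace[OF W] by (simp add: G_def)
  define p where "p = (\<Prod>d\<leftarrow>cs. c - d)"
  have p: "p \<noteq> 0" using Cons.prems(1) by (auto simp: p_def prod_list_zero_iff)
  define H where "H = fun_scale (inverse p) G"
  have H: "T H = fun_scale c H" "H \<in> W"
    using G GW W by (auto simp: H_def module_hom.scale[OF T] cfun.scale_left_commute intro: cfun.subspace_scale)
  have "eigen_factors T cs H = G"
    using p eigen_factors_eigenvector[OF H(1), of cs] by (simp add: p_def[symmetric] H_def)
  then have "eigen_factors T cs (F - H) = 0"
    by (simp add: module_hom.diff[OF linear_op_eigen_factors] G_def)
  moreover have "distinct cs" using Cons.prems(1) by simp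
  moreover have "F - H \<in> W" using Cons.prems H W by (auto intro: cfun.subspace_diff)
  ultimately obtain f where f: "\<forall>d\<in>set cs. f d \<in> W \<and> T (f d) = fun_scale d (f d)" "F - H = (\<Sum>d\<in>set cs. f d)"
    using Cons.IH[of "F - H"] \<open>distinct cs\<close> by blast
  have "(\<Sum>d\<in>set cs. (f(c := H)) d) = (\<Sum>d\<in>set cs. f d)"
    using Cons.prems(1) by (intro sum.cong) auto
  then have "F = (\<Sum>d\<in>set (c # cs). (f(c := H)) d)"
    using Cons.prems(1) f(2) by (simp add: algebra_simps)
  moreover have "\<forall>d\<in>set (c # cs). (f(c := H)) d \<in> W \<and> T ((f(c := H)) d) = fun_scale d ((f(c := H)) d)"
    using f(1) H by auto
  ultimately show ?case by blast
qed simp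

end

context quadratic_character
begin

lemma subspace_sections: "cfun.subspace (sections n)"
  unfolding cfun.subspace_def sections_def fun_scale_def by (auto simp: algebra_simps)

lemma linear_transv_op: "linear_op (transv_op n)"
  by (rule linear_opI) (auto simp: transv_op_def fun_scale_def fun_eq_iff sum.distrib algebra_simps sum_distrib_left)

lemma linear_opp_op: "linear_op (opp_op n)"
  by (rule linear_opI) (auto simp: opp_op_def fun_scale_def fun_eq_iff sum.distrib sum_distrib_left)

lemma linear_res_op: "linear_op (res_op n)"
  by (rule linear_opI) (auto simp: res_op_def fun_scale_def fun_eq_iff)

lemma linear_avg_op: "linear_op (avg_op n)"
  by (rule linear_opI) (auto simp: avg_op_def avg_def fun_scale_def fun_eq_iff sum.distrib sum_distrib_left)

lemma linear_translate: "linear_op (translate n g)"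
  by (rule linear_opI) (auto simp: translate_def fun_scale_def fun_eq_iff)

lemma transv_op_translate_comm:
  assumes "g \<in> isometries n"
  shows "transv_op n (translate n g F) = translate n g (transv_op n F)"
proof
  show "transv_op n (translate n g F) X = translate n g (transv_op n F) X" for X
  proof (cases "X \<in> frames n")
    case True
    have "transv_op n (translate n g F) X = (\<Sum>u\<in>hspace n. \<Sum>t\<in>- {0}. \<beta> t * F (g \<circ> (transv n u t \<circ> X)))"
      using True frames_isometry[OF transv_isometry True] by (simp add: translate_def transv_op_def)
    then show ?thesis using True by (simp add: translate_def transv_op_translate[OF assms])
  qed (simp add: translate_def transv_op_def)
qed

lemma eigen_factors_translate:
  assumes "g \<in> isometries n"
  shows "eigen_factors (transv_op n) cs (translate n g F) = translate n g (eigen_factors (transv_op n) cs F)"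
  by (induction cs) (simp_all only: eigen_factors_Nil eigen_factors_Cons transv_op_translate_comm[OF assms]
      module_hom.diff[OF linear_translate] module_hom.scale[OF linear_translate])

lemma frames_Suc_cases:
  assumes "X \<in> frames (Suc n)"
  obtains g where "g \<in> isometries (Suc n)" "X = g \<circ> snoc n (std_frame n) (evec n)"
  using frames_transitive[OF assms] by (auto simp: std_frame_Suc)

text \<open>
  Isometries act transitively on frames, so the values at frames through \<open>evec n\<close> of all translates are
  all values.
\<close>
lemma zero_if_res_zero:
  assumes F: "F \<in> sections (Suc n)"
    and "\<And>g. g \<in> isometries (Suc n) \<Longrightarrow> res_op n (translate (Suc n) g F) = 0"
  shows "F = 0"
proof
  fix X
  show "F X = 0 X"
  proof (cases "X \<in> frames (Suc n)")
    case True
    then obtain g where g: "g \<in> isometries (Suc n)" "X = g \<circ> snoc n (std_frame n) (evec n)"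
      by (rule frames_Suc_cases)
    then show ?thesis
      using fun_cong[OF assms(2)[OF g(1)], of "std_frame n"]
      by (simp add: res_op_def translate_def std_frame_frames frames_snoc_evec)
  qed (use F in \<open>simp add: sections_def\<close>)
qed

end

section \<open>Induction on the rank\<close>

locale quadratic_character_root = quadratic_character +
  fixes s :: complex
  assumes s: "s * s = \<beta> (- 1) * q"
begin

text \<open>
  The factor \<open>q^n / q\<close> is \<open>q^(n - 1)\<close>, without a truncated exponent.
\<close>
definition transv_ev :: "nat \<Rightarrow> nat \<Rightarrow> complex" where
  "transv_ev n j = (q - 1) / q * s * q ^ n * (q ^ (n - j) - q ^ j)"

definition opp_ev :: "nat \<Rightarrow> nat \<Rightarrow> complex" where
  "opp_ev n j = (\<beta> (- 1) * s) ^ n * (- 1) ^ j * q ^ ((n - j choose 2) + (j choose 2))"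

lemma s_nonzero: "s \<noteq> 0"
  using s nonzero[of "- 1"] by auto

lemma q_gt_1: "1 < CARD('a)"
  using card_mono[of UNIV "{0, 1 :: 'a}"] by simp

lemma q_minus_1_nonzero: "q - 1 \<noteq> 0"
  using q_gt_1 by (simp add: q_def)

lemma transv_ev_inj:
  assumes "i \<le> n" "j \<le> n" "transv_ev n i = transv_ev n j"
  shows "i = j"
proof -
  have less: "CARD('a) ^ (n - j) + CARD('a) ^ i < CARD('a) ^ (n - i) + CARD('a) ^ j" if "i < j" "j \<le> n" for i j
    using that q_gt_1 by (intro add_strict_mono power_strict_increasing) auto
  have "q ^ (n - i) - q ^ i = q ^ (n - j) - q ^ j"
    using assms(3) s_nonzero q_minus_1_nonzero by (simp add: transv_ev_def)
  then have "of_nat (CARD('a) ^ (n - i) + CARD('a) ^ j) = (of_nat (CARD('a) ^ (n - j) + CARD('a) ^ i) :: complex)"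
    by (simp add: q_def algebra_simps)
  then have "CARD('a) ^ (n - i) + CARD('a) ^ j = CARD('a) ^ (n - j) + CARD('a) ^ i"
    by (simp only: of_nat_eq_iff)
  then show ?thesis using less[of i j] less[of j i] assms(1,2) by (cases i j rule: linorder_cases) auto
qed

text \<open>
  The product of the off-diagonal entries of the recursion matrix is \<open>(q - 1)^2 * coupling n\<close>.
\<close>
abbreviation coupling :: "nat \<Rightarrow> complex" where
  "coupling n \<equiv> \<beta> (- 1) * (q - 1)\<^sup>2 * q ^ (3 * n + 1)"

lemma transv_ev_diff:
  assumes "j \<le> n"
  shows "transv_ev (Suc n) j - q * transv_ev n j = (q - 1)\<^sup>2 * s * q ^ n * q ^ (n - j)"
    and "transv_ev (Suc n) (Suc j) - q * transv_ev n j = - (q - 1)\<^sup>2 * s * q ^ n * q ^ j"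
    and "transv_ev (Suc n) j + transv_ev (Suc n) (Suc j) = (q + q\<^sup>2) * transv_ev n j"
  using assms by (simp_all add: transv_ev_def Suc_diff_le field_simps power2_eq_square)

text \<open>
  The recursion for \<open>res_op\<close> and \<open>avg_op\<close> has the matrix with rows \<open>(q a, (q - 1)^2)\<close> and
  \<open>(coupling n, q^2 a)\<close> over the eigenvalue \<open>a\<close> with index \<open>j\<close> in rank \<open>n\<close>; its eigenvalues are those with the indices
  \<open>j\<close> and \<open>j + 1\<close> in rank \<open>n + 1\<close>.  Here the root \<open>s\<close> of \<open>\<beta> (-1) q\<close> is needed.
\<close>
lemma transv_ev_charpoly:
  assumes "j \<le> n"
  shows "(q * transv_ev n j - transv_ev (Suc n) j) *
    (q * transv_ev n j - transv_ev (Suc n) (Suc j)) + (q - 1)\<^sup>2 * coupling n = 0"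
proof -
  have "(q * transv_ev n j - transv_ev (Suc n) j) = - ((q - 1)\<^sup>2 * s * q ^ n * q ^ (n - j))"
    "(q * transv_ev n j - transv_ev (Suc n) (Suc j)) = (q - 1)\<^sup>2 * s * q ^ n * q ^ j"
    using transv_ev_diff(1,2)[OF assms] by (simp_all add: algebra_simps)
  then have "(q * transv_ev n j - transv_ev (Suc n) j) *
    (q * transv_ev n j - transv_ev (Suc n) (Suc j)) =
    - ((q - 1)\<^sup>2 * (q - 1)\<^sup>2 * (s * s) * (q ^ n * q ^ n * (q ^ (n - j) * q ^ j)))"
    by (simp only:) (simp add: algebra_simps)
  also have "q ^ n * q ^ n * (q ^ (n - j) * q ^ j) = q ^ (3 * n)"
    unfolding power_add[symmetric] using assms by (intro arg_cong[of _ _ "(^) q"]) simp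
  finally show ?thesis unfolding s by simp
qed

lemma res_avg_recursion:
  assumes F: "F \<in> sections (Suc n)"
    and \<pi>: "linear_op \<pi>" "\<And>\<phi>. \<phi> \<in> sections n \<Longrightarrow> \<pi> (transv_op n \<phi>) = fun_scale a' (\<pi> \<phi>)"
  shows "\<pi> (res_op n (transv_op (Suc n) F)) = fun_scale (q * a') (\<pi> (res_op n F)) + fun_scale ((q - 1)\<^sup>2) (\<pi> (avg_op n F))"
    and "\<pi> (avg_op n (transv_op (Suc n) F)) = fun_scale (q\<^sup>2 * a') (\<pi> (avg_op n F)) + fun_scale (coupling n) (\<pi> (res_op n F))"
proof -
  have "res_op n (transv_op (Suc n) F) = fun_scale q (transv_op n (res_op n F)) + fun_scale ((q - 1)\<^sup>2) (avg_op n F)"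
  proof
    show "res_op n (transv_op (Suc n) F) X = (fun_scale q (transv_op n (res_op n F)) + fun_scale ((q - 1)\<^sup>2) (avg_op n F)) X" for X
      using res_transv[OF F, of X] by (cases "X \<in> frames n") (simp_all add: fun_scale_def res_op_def transv_op_def avg_op_def)
  qed
  then show "\<pi> (res_op n (transv_op (Suc n) F)) = fun_scale (q * a') (\<pi> (res_op n F)) + fun_scale ((q - 1)\<^sup>2) (\<pi> (avg_op n F))"
    by (simp only: module_hom.add[OF \<pi>(1)] module_hom.scale[OF \<pi>(1)] \<pi>(2)[OF sections_res_op[OF F]] cfun.scale_scale)
  have "avg_op n (transv_op (Suc n) F) = fun_scale (q\<^sup>2) (transv_op n (avg_op n F)) + fun_scale (coupling n) (res_op n F)"
  proof
    show "avg_op n (transv_op (Suc n) F) X = (fun_scale (q\<^sup>2) (transv_op n (avg_op n F)) + fun_scale (coupling n) (res_op n F)) X" for X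
      using avg_transv[OF F, of X] by (cases "X \<in> frames n") (simp_all add: fun_scale_def res_op_def transv_op_def avg_op_def)
  qed
  then show "\<pi> (avg_op n (transv_op (Suc n) F)) = fun_scale (q\<^sup>2 * a') (\<pi> (avg_op n F)) + fun_scale (coupling n) (\<pi> (res_op n F))"
    by (simp only: module_hom.add[OF \<pi>(1)] module_hom.scale[OF \<pi>(1)] \<pi>(2)[OF sections_avg_op[OF F]] cfun.scale_scale)
qed

lemma opp_ev_Suc:
  assumes "j \<le> n"
  shows "opp_ev (Suc n) j = \<beta> (- 1) * s * q ^ (n - j) * opp_ev n j"
    and "opp_ev (Suc n) (Suc j) = - \<beta> (- 1) * s * q ^ j * opp_ev n j"
proof -
  have "(Suc n - j choose 2) = (n - j choose 2) + (n - j)" "(Suc j choose 2) = (j choose 2) + j"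
    using assms by (simp_all add: Suc_diff_le numeral_2_eq_2)
  then show "opp_ev (Suc n) j = \<beta> (- 1) * s * q ^ (n - j) * opp_ev n j"
    "opp_ev (Suc n) (Suc j) = - \<beta> (- 1) * s * q ^ j * opp_ev n j"
    by (simp_all add: opp_ev_def power_add)
qed

text \<open>
  Only the properties that the induction uses are recorded; the images for different \<open>j\<close> lie in
  different eigenspaces of \<open>transv_op\<close>, by \<open>transv_ev_inj\<close>.
\<close>
definition spectral_projections :: "nat \<Rightarrow> (nat \<Rightarrow> 'a frame_fun \<Rightarrow> 'a frame_fun) \<Rightarrow> bool" where
  "spectral_projections n \<pi> \<longleftrightarrow> (\<forall>j\<le>n. linear_op (\<pi> j) \<and> (\<forall>\<phi>\<in>sections n. \<pi> j \<phi> \<in> sections n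
      \<and> \<pi> j (transv_op n \<phi>) = fun_scale (transv_ev n j) (\<pi> j \<phi>)
      \<and> transv_op n (\<pi> j \<phi>) = fun_scale (transv_ev n j) (\<pi> j \<phi>)
      \<and> opp_op n (\<pi> j \<phi>) = fun_scale (opp_ev n j) (\<pi> j \<phi>)))
    \<and> (\<forall>\<phi>\<in>sections n. \<phi> = (\<Sum>j\<le>n. \<pi> j \<phi>))"

text \<open>
  The pair formed by the two components on the left is an eigenvector of the recursion matrix or zero,
  which leaves only two indices \<open>i\<close>.
\<close>
lemma transv_eigenvector_pieces:
  assumes F: "F \<in> sections (Suc n)" and i: "i \<le> Suc n"
    and eig: "transv_op (Suc n) F = fun_scale (transv_ev (Suc n) i) F"
    and j: "j \<le> n" and \<pi>: "spectral_projections n \<pi>"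
  shows "fun_scale (transv_ev (Suc n) i - q * transv_ev n j) (\<pi> j (res_op n F)) =
      fun_scale ((q - 1)\<^sup>2) (\<pi> j (avg_op n F))"
    and "i \<noteq> j \<Longrightarrow> i \<noteq> Suc j \<Longrightarrow> \<pi> j (res_op n F) = 0"
proof -
  define a where "a = transv_ev (Suc n) i"
  define a' where "a' = transv_ev n j"
  define x where "x = \<pi> j (res_op n F)"
  define y where "y = \<pi> j (avg_op n F)"
  have lin: "linear_op (\<pi> j)" using \<pi> j by (simp add: spectral_projections_def)
  have comm: "\<pi> j (transv_op n \<phi>) = fun_scale a' (\<pi> j \<phi>)" if "\<phi> \<in> sections n" for \<phi>
    using \<pi> j that by (simp add: spectral_projections_def a'_def)
  note rec = res_avg_recursion[OF F lin comm]
  have 1: "fun_scale a x = fun_scale (q * a') x + fun_scale ((q - 1)\<^sup>2) y"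
    using rec(1) unfolding eig module_hom.scale[OF linear_res_op] module_hom.scale[OF lin]
    by (simp add: x_def y_def a_def)
  have 2: "fun_scale a y = fun_scale (q\<^sup>2 * a') y + fun_scale (coupling n) x"
    using rec(2) unfolding eig module_hom.scale[OF linear_avg_op] module_hom.scale[OF lin]
    by (simp add: x_def y_def a_def)
  show 3: "fun_scale (transv_ev (Suc n) i - q * transv_ev n j) (\<pi> j (res_op n F)) =
      fun_scale ((q - 1)\<^sup>2) (\<pi> j (avg_op n F))"
    using 1 by (simp add: fun_scale_def fun_eq_iff x_def y_def a_def a'_def algebra_simps)
  assume ij: "i \<noteq> j" "i \<noteq> Suc j"
  show "\<pi> j (res_op n F) = 0"
  proof
    fix X
    define b where "b = transv_ev (Suc n) j"
    define c where "c = transv_ev (Suc n) (Suc j)"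
    have bc: "b + c = (q + q\<^sup>2) * a'" "(q * a' - b) * (q * a' - c) + (q - 1)\<^sup>2 * coupling n = 0"
      using transv_ev_diff(3)[OF j] transv_ev_charpoly[OF j] by (simp_all add: a'_def b_def c_def)
    have x: "(a - q * a') * x X = (q - 1)\<^sup>2 * y X" and y: "(a - q\<^sup>2 * a') * y X = coupling n * x X"
      using fun_cong[OF 1, of X] fun_cong[OF 2, of X] by (simp_all add: fun_scale_def algebra_simps)
    have "((a - q * a') * (a - q\<^sup>2 * a')) * x X = (a - q\<^sup>2 * a') * ((a - q * a') * x X)"
      by (simp only: mult.assoc mult.left_commute)
    also have "\<dots> = (q - 1)\<^sup>2 * ((a - q\<^sup>2 * a') * y X)"
      unfolding x by (simp only: mult.left_commute)
    also have "\<dots> = ((q - 1)\<^sup>2 * coupling n) * x X" unfolding y by (simp only: mult.assoc)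
    finally have E1: "((a - q * a') * (a - q\<^sup>2 * a') - (q - 1)\<^sup>2 * coupling n) * x X = 0"
      by (simp only: left_diff_distrib diff_self)
    have E2: "(a - q * a') * (a - q\<^sup>2 * a') - (q - 1)\<^sup>2 * coupling n = (a - b) * (a - c)"
    proof -
      have c: "c = (q + q\<^sup>2) * a' - b" using bc(1) by (simp add: algebra_simps)
      have k: "(q - 1)\<^sup>2 * coupling n = - ((q * a' - b) * (q * a' - c))" using bc(2) by (simp add: add_eq_0_iff)
      show ?thesis unfolding k unfolding c by (simp add: algebra_simps)
    qed
    have "(a - b) * (a - c) * x X = 0" using E1 unfolding E2 .
    moreover have "a \<noteq> b" "a \<noteq> c"
      using ij transv_ev_inj[OF i, of j] transv_ev_inj[OF i, of "Suc j"] j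
      by (auto simp: a_def b_def c_def)
    ultimately show "\<pi> j (res_op n F) X = 0 X" by (simp add: x_def)
  qed
qed

text \<open>
  By \<open>res_opp\<close> the restriction of \<open>opp_op (Suc n) F\<close> is known from the average of \<open>F\<close>, and on each piece the average is a
  known multiple of the restriction.  The multiples fit together because
  \<open>opp_ev (Suc n) i / opp_ev n j\<close> equals \<open>\<beta> (-1) / (q^n (q - 1)^2)\<close> times the difference of
  \<open>transv_ev (Suc n) i\<close> and \<open>q * transv_ev n j\<close>.
\<close>
lemma opp_on_transv_eigenvector:
  assumes F: "F \<in> sections (Suc n)" and i: "i \<le> Suc n"
    and eig: "transv_op (Suc n) F = fun_scale (transv_ev (Suc n) i) F"
    and \<pi>: "spectral_projections n \<pi>" and X: "X \<in> frames n"
  shows "res_op n (opp_op (Suc n) F) X = opp_ev (Suc n) i * res_op n F X"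
proof -
  have piece: "\<beta> (- 1) * (opp_ev n j * \<pi> j (avg_op n F) X) = q ^ n * (opp_ev (Suc n) i * \<pi> j (res_op n F) X)"
    if j: "j \<le> n" for j
  proof -
    note P = transv_eigenvector_pieces[OF F i eig j \<pi>]
    have 1: "(q - 1)\<^sup>2 * \<pi> j (avg_op n F) X = (transv_ev (Suc n) i - q * transv_ev n j) * \<pi> j (res_op n F) X"
      using fun_cong[OF P(1), of X] by (simp add: fun_scale_def)
    show ?thesis
    proof (cases "i = j \<or> i = Suc j")
      case False
      then have 0: "\<pi> j (res_op n F) X = 0" using P(2) by simp
      then show ?thesis using 1 q_minus_1_nonzero by simp
    next
      case True
      have "(q - 1)\<^sup>2 * (\<beta> (- 1) * (opp_ev n j * \<pi> j (avg_op n F) X)) =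
          \<beta> (- 1) * opp_ev n j * ((q - 1)\<^sup>2 * \<pi> j (avg_op n F) X)"
        by (simp only: mult_ac)
      also have "\<dots> = (q - 1)\<^sup>2 * (q ^ n * (opp_ev (Suc n) i * \<pi> j (res_op n F) X))"
        unfolding 1 using True transv_ev_diff(1,2)[OF j] opp_ev_Suc[OF j] by auto
      finally show ?thesis using q_minus_1_nonzero by simp
    qed
  qed
  have S: "avg_op n F \<in> sections n" by (rule sections_avg_op[OF F])
  have avg: "avg_op n F = (\<Sum>j\<le>n. \<pi> j (avg_op n F))" and res: "res_op n F = (\<Sum>j\<le>n. \<pi> j (res_op n F))"
    using \<pi> S sections_res_op[OF F] by (auto simp: spectral_projections_def)
  have "opp_op n (avg_op n F) = (\<Sum>j\<le>n. opp_op n (\<pi> j (avg_op n F)))"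
    by (subst avg) (rule module_hom.sum[OF linear_opp_op])
  also have "\<dots> = (\<Sum>j\<le>n. fun_scale (opp_ev n j) (\<pi> j (avg_op n F)))"
    using \<pi> S by (intro sum.cong) (auto simp: spectral_projections_def)
  finally have opp: "opp_op n (avg_op n F) X = (\<Sum>j\<le>n. opp_ev n j * \<pi> j (avg_op n F) X)"
    by (simp add: sum_fun_apply fun_scale_def)
  have "q ^ n * res_op n (opp_op (Suc n) F) X = (\<Sum>j\<le>n. \<beta> (- 1) * (opp_ev n j * \<pi> j (avg_op n F) X))"
    unfolding res_opp[OF F X] opp sum_distrib_left ..
  also have "\<dots> = (\<Sum>j\<le>n. q ^ n * (opp_ev (Suc n) i * \<pi> j (res_op n F) X))"
    by (intro sum.cong refl piece) simp
  also have "\<dots> = q ^ n * (opp_ev (Suc n) i * res_op n F X)"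
    by (subst (2) res) (simp add: sum_fun_apply sum_distrib_left)
  finally show ?thesis by simp
qed

lemma opp_eigenvector:
  assumes F: "F \<in> sections (Suc n)" and i: "i \<le> Suc n"
    and eig: "transv_op (Suc n) F = fun_scale (transv_ev (Suc n) i) F"
    and \<pi>: "spectral_projections n \<pi>"
  shows "opp_op (Suc n) F = fun_scale (opp_ev (Suc n) i) F"
proof
  fix X
  show "opp_op (Suc n) F X = fun_scale (opp_ev (Suc n) i) F X"
  proof (cases "X \<in> frames (Suc n)")
    case True
    then obtain g where g: "g \<in> isometries (Suc n)" "X = g \<circ> snoc n (std_frame n) (evec n)"
      by (rule frames_Suc_cases)
    define G where "G = translate (Suc n) g F"
    have G: "G \<in> sections (Suc n)" unfolding G_def by (rule sections_translate[OF F g(1)])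
    have "transv_op (Suc n) G = fun_scale (transv_ev (Suc n) i) G"
      unfolding G_def transv_op_translate_comm[OF g(1)] eig by (rule module_hom.scale[OF linear_translate])
    from opp_on_transv_eigenvector[OF G i this \<pi> std_frame_frames]
    have "opp_op (Suc n) G (snoc n (std_frame n) (evec n)) = opp_ev (Suc n) i * G (snoc n (std_frame n) (evec n))"
      by (simp add: res_op_def std_frame_frames)
    then show ?thesis
      unfolding g(2) opp_op_translate[OF g(1) frames_snoc_evec[OF std_frame_frames]] G_def[symmetric]
      by (simp add: fun_scale_def G_def translate_def frames_snoc_evec[OF std_frame_frames])
  next
    case False
    then show ?thesis using F by (simp add: opp_op_def fun_scale_def sections_def)
  qed
qed

lemma sections_eigen_factors:
  "F \<in> sections n \<Longrightarrow> eigen_factors (transv_op n) cs F \<in> sections n"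
  by (rule eigen_factors_in_subspace[OF linear_transv_op subspace_sections sections_transv_op])

text \<open>
  The two factors form the characteristic polynomial of the recursion matrix over the \<open>j\<close>-th eigenvalue.
\<close>
lemma res_quadratic_zero:
  assumes H: "H \<in> sections (Suc n)" and j: "j \<le> n" and \<pi>: "spectral_projections n \<pi>"
  shows "\<pi> j (res_op n (eigen_factors (transv_op (Suc n))
    [transv_ev (Suc n) j, transv_ev (Suc n) (Suc j)] H)) = 0"
proof -
  define a where "a = transv_ev (Suc n) j"
  define b where "b = transv_ev (Suc n) (Suc j)"
  define a' where "a' = transv_ev n j"
  have lin: "linear_op (\<pi> j)" using \<pi> j by (simp add: spectral_projections_def)
  have comm: "\<pi> j (transv_op n \<phi>) = fun_scale a' (\<pi> j \<phi>)" if "\<phi> \<in> sections n" for \<phi>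
    using \<pi> j that by (simp add: spectral_projections_def a'_def)
  define H1 where "H1 = transv_op (Suc n) H"
  define H2 where "H2 = transv_op (Suc n) H1"
  have H1: "H1 \<in> sections (Suc n)" unfolding H1_def by (rule sections_transv_op[OF H])
  note rec = res_avg_recursion[OF H lin comm] res_avg_recursion(1)[OF H1 lin comm]
  define x where "x = \<pi> j (res_op n H)"
  define x1 where "x1 = \<pi> j (res_op n H1)"
  define x2 where "x2 = \<pi> j (res_op n H2)"
  define y where "y = \<pi> j (avg_op n H)"
  define y1 where "y1 = \<pi> j (avg_op n H1)"
  have "eigen_factors (transv_op (Suc n)) [a, b] H = H2 - fun_scale b H1 - fun_scale a (H1 - fun_scale b H)"
    by (simp only: eigen_factors_Cons eigen_factors_Nil module_hom.diff[OF linear_transv_op]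
        module_hom.scale[OF linear_transv_op] H1_def H2_def)
  then have ef: "\<pi> j (res_op n (eigen_factors (transv_op (Suc n)) [a, b] H)) = x2 - fun_scale b x1 - fun_scale a (x1 - fun_scale b x)"
    by (simp only: module_hom.diff[OF lin] module_hom.scale[OF lin] module_hom.diff[OF linear_res_op]
        module_hom.scale[OF linear_res_op] x_def x1_def x2_def)
  have "x2 X - b * x1 X - a * (x1 X - b * x X) = 0" for X
  proof -
    have 1: "x1 X = q * a' * x X + (q - 1)\<^sup>2 * y X" "y1 X = q\<^sup>2 * a' * y X + coupling n * x X"
      "x2 X = q * a' * x1 X + (q - 1)\<^sup>2 * y1 X"
      using fun_cong[OF rec(1), of X] fun_cong[OF rec(2), of X] fun_cong[OF rec(3), of X]
      by (simp_all add: x_def x1_def x2_def y_def y1_def H1_def H2_def fun_scale_def)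
    have bc: "a + b = (q + q\<^sup>2) * a'" "(q * a' - a) * (q * a' - b) + (q - 1)\<^sup>2 * coupling n = 0"
      using transv_ev_diff(3)[OF j] transv_ev_charpoly[OF j] by (simp_all add: a'_def a_def b_def)
    have b: "b = (q + q\<^sup>2) * a' - a" using bc(1) by (simp add: algebra_simps)
    have "(q - 1)\<^sup>2 * y1 X = q\<^sup>2 * a' * ((q - 1)\<^sup>2 * y X) + ((q - 1)\<^sup>2 * coupling n) * x X"
      unfolding 1(2) by (simp only: distrib_left mult_ac)
    also have "(q - 1)\<^sup>2 * coupling n = - ((q * a' - a) * (q * a' - b))" using bc(2) by (simp add: add_eq_0_iff)
    also have "(q - 1)\<^sup>2 * y X = x1 X - q * a' * x X" using 1(1) by simp
    finally show ?thesis unfolding 1(3) b by (simp add: algebra_simps power2_eq_square)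
  qed
  then show ?thesis unfolding a_def[symmetric] b_def[symmetric] ef by (simp add: fun_eq_iff fun_scale_def)
qed

text \<open>
  By \<open>zero_if_res_zero\<close> it suffices to look at restrictions.  The component with index \<open>j\<close> of the restriction is
  killed by the two factors with indices \<open>j\<close> and \<open>j + 1\<close>, which may be moved to the front.
\<close>
lemma transv_annihilated:
  assumes F: "F \<in> sections (Suc n)" and \<pi>: "spectral_projections n \<pi>"
  shows "eigen_factors (transv_op (Suc n)) (map (transv_ev (Suc n)) [0..<Suc (Suc n)]) F = 0"
proof -
  let ?A = "transv_op (Suc n)" and ?\<alpha> = "transv_ev (Suc n)"
  let ?L = "map ?\<alpha> [0..<Suc (Suc n)]"
  have res: "res_op n (eigen_factors ?A ?L F) = 0" if F: "F \<in> sections (Suc n)" for F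
  proof -
    have "\<pi> j (res_op n (eigen_factors ?A ?L F)) = 0" if j: "j \<le> n" for j
    proof -
      have "[0..<Suc (Suc n)] = [0..<j] @ [j, Suc j] @ [Suc (Suc j)..<Suc (Suc n)]"
        using j upt_add_eq_append[of 0 j "Suc (Suc n) - j"] by (simp add: upt_conv_Cons)
      then have L: "?L = map ?\<alpha> [0..<j] @ [?\<alpha> j, ?\<alpha> (Suc j)] @ map ?\<alpha> [Suc (Suc j)..<Suc (Suc n)]"
        by (simp only: map_append list.map)
      have "eigen_factors ?A ?L F = eigen_factors ?A [?\<alpha> j, ?\<alpha> (Suc j)]
          (eigen_factors ?A (map ?\<alpha> [0..<j]) (eigen_factors ?A (map ?\<alpha> [Suc (Suc j)..<Suc (Suc n)]) F))"
        unfolding L eigen_factors_append by (rule eigen_factors_comm[OF linear_transv_op])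
      then show ?thesis
        using res_quadratic_zero[OF sections_eigen_factors[OF sections_eigen_factors[OF F]] j \<pi>] by simp
    qed
    moreover have "res_op n (eigen_factors ?A ?L F) = (\<Sum>j\<le>n. \<pi> j (res_op n (eigen_factors ?A ?L F)))"
      using \<pi> sections_res_op[OF sections_eigen_factors[OF F]] unfolding spectral_projections_def by blast
    ultimately show ?thesis by simp
  qed
  show ?thesis
  proof (rule zero_if_res_zero[OF sections_eigen_factors[OF F]])
    fix g :: "'a hvec \<Rightarrow> 'a hvec" assume g: "g \<in> isometries (Suc n)"
    show "res_op n (translate (Suc n) g (eigen_factors ?A ?L F)) = 0"
      unfolding eigen_factors_translate[OF g, symmetric] by (rule res[OF sections_translate[OF F g]])
  qed
qed

lemma spectral_projections_Suc:
  assumes \<pi>: "spectral_projections n \<pi>"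
  shows "\<exists>\<pi>'. spectral_projections (Suc n) \<pi>'"
proof -
  let ?A = "transv_op (Suc n)" and ?\<alpha> = "transv_ev (Suc n)"
  define others where "others = (\<lambda>j. map ?\<alpha> (filter (\<lambda>i. i \<noteq> j) [0..<Suc (Suc n)]))"
  define p where "p = (\<lambda>j. \<Prod>c\<leftarrow>others j. ?\<alpha> j - c)"
  define \<pi>' where "\<pi>' = (\<lambda>j F. fun_scale (inverse (p j)) (eigen_factors ?A (others j) F))"
  have p: "p j \<noteq> 0" if "j \<le> Suc n" for j
  proof
    assume "p j = 0"
    then obtain i where "i < Suc (Suc n)" "i \<noteq> j" "?\<alpha> j = ?\<alpha> i"
      unfolding p_def others_def prod_list_zero_iff by (auto simp del: upt_Suc)
    then show False using transv_ev_inj[OF that, of i] by simp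
  qed
  have lin: "linear_op (\<pi>' j)" for j
    by (rule linear_opI) (simp_all only: \<pi>'_def module_hom.add[OF linear_op_eigen_factors[OF linear_transv_op]]
        module_hom.scale[OF linear_op_eigen_factors[OF linear_transv_op]] cfun.scale_right_distrib cfun.scale_left_commute)
  have inj: "inj_on ?\<alpha> {..Suc n}"
    using transv_ev_inj by (auto simp: inj_on_def)
  have dist: "distinct (map ?\<alpha> [0..<Suc (Suc n)])"
    using inj by (simp add: distinct_map atLeast0LessThan lessThan_Suc_atMost del: upt_Suc)
  have main: "\<exists>h. (\<forall>i\<le>Suc n. h i \<in> sections (Suc n) \<and> ?A (h i) = fun_scale (?\<alpha> i) (h i)) \<and> F = (\<Sum>i\<le>Suc n. h i)
      \<and> (\<forall>j\<le>Suc n. \<pi>' j F = h j \<and> \<pi>' j (?A F) = fun_scale (?\<alpha> j) (h j))" if F: "F \<in> sections (Suc n)" for F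
  proof -
    obtain f where f: "\<forall>c\<in>set (map ?\<alpha> [0..<Suc (Suc n)]). f c \<in> sections (Suc n) \<and> ?A (f c) = fun_scale c (f c)"
      "F = (\<Sum>c\<in>set (map ?\<alpha> [0..<Suc (Suc n)]). f c)"
      using eigen_decomposition[OF linear_transv_op subspace_sections sections_transv_op dist F transv_annihilated[OF F \<pi>]]
      by blast
    have set: "set (map ?\<alpha> [0..<Suc (Suc n)]) = ?\<alpha> ` {..Suc n}"
      by (simp add: atLeast0LessThan lessThan_Suc_atMost del: upt_Suc)
    define h where "h = (\<lambda>i. f (?\<alpha> i))"
    have h: "h i \<in> sections (Suc n)" "?A (h i) = fun_scale (?\<alpha> i) (h i)" if "i \<le> Suc n" for i
      using f(1) that unfolding set h_def by auto
    have F: "F = (\<Sum>i\<le>Suc n. h i)" using f(2) unfolding set sum.reindex[OF inj] by (simp add: h_def o_def)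
    have proj: "\<pi>' j (h i) = (if i = j then h j else 0)" if "i \<le> Suc n" "j \<le> Suc n" for i j
    proof (cases "i = j")
      case True
      have "eigen_factors ?A (others j) (h j) = fun_scale (p j) (h j)"
        unfolding p_def by (rule eigen_factors_eigenvector[OF linear_transv_op h(2)[OF that(2)]])
      then show ?thesis using p[OF that(2)] True by (simp add: \<pi>'_def)
    next
      case False
      then have "?\<alpha> i \<in> set (others j)"
        using that by (auto simp: others_def simp del: upt_Suc)
      then have "(\<Prod>c\<leftarrow>others j. ?\<alpha> i - c) = 0"
        unfolding prod_list_zero_iff by force
      then show ?thesis
        using False that eigen_factors_eigenvector[OF linear_transv_op h(2)[of i], of "others j"]
        by (simp add: \<pi>'_def)
    qed
    have 1: "\<pi>' j F = h j" if j: "j \<le> Suc n" for j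
    proof -
      have "\<pi>' j F = (\<Sum>i\<le>Suc n. \<pi>' j (h i))" unfolding F by (rule module_hom.sum[OF lin])
      also have "\<dots> = (\<Sum>i\<le>Suc n. if i = j then h j else 0)" by (rule sum.cong) (use proj j in auto)
      finally show ?thesis using j by (simp only: sum.delta finite_atMost atMost_iff if_True)
    qed
    have 2: "\<pi>' j (?A F) = fun_scale (?\<alpha> j) (h j)" if j: "j \<le> Suc n" for j
    proof -
      have "\<pi>' j (?A F) = (\<Sum>i\<le>Suc n. \<pi>' j (?A (h i)))"
        unfolding F module_hom.sum[OF linear_transv_op] by (rule module_hom.sum[OF lin])
      also have "\<dots> = (\<Sum>i\<le>Suc n. if i = j then fun_scale (?\<alpha> j) (h j) else 0)"
        by (rule sum.cong) (use proj j h in \<open>auto simp: module_hom.scale[OF lin]\<close>)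
      finally show ?thesis using j by (simp only: sum.delta finite_atMost atMost_iff if_True)
    qed
    show ?thesis using h F 1 2 by blast
  qed
  have "spectral_projections (Suc n) \<pi>'"
    unfolding spectral_projections_def
  proof (intro conjI allI impI ballI lin)
    fix F j assume F: "F \<in> sections (Suc n)" and j: "j \<le> Suc n"
    obtain h where h: "\<forall>i\<le>Suc n. h i \<in> sections (Suc n) \<and> ?A (h i) = fun_scale (?\<alpha> i) (h i)"
      "\<forall>j\<le>Suc n. \<pi>' j F = h j \<and> \<pi>' j (?A F) = fun_scale (?\<alpha> j) (h j)" using main[OF F] by blast
    show "\<pi>' j F \<in> sections (Suc n)" "\<pi>' j (?A F) = fun_scale (?\<alpha> j) (\<pi>' j F)" "?A (\<pi>' j F) = fun_scale (?\<alpha> j) (\<pi>' j F)"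
      using h j by auto
    then show "opp_op (Suc n) (\<pi>' j F) = fun_scale (opp_ev (Suc n) j) (\<pi>' j F)"
      using opp_eigenvector[OF _ j _ \<pi>] by blast
  next
    fix F assume "F \<in> sections (Suc n)"
    from main[OF this] obtain h where h: "F = (\<Sum>i\<le>Suc n. h i)" "\<forall>j\<le>Suc n. \<pi>' j F = h j" by blast
    have "(\<Sum>i\<le>Suc n. h i) = (\<Sum>i\<le>Suc n. \<pi>' i F)" by (rule sum.cong) (use h(2) in auto)
    then show "F = (\<Sum>j\<le>Suc n. \<pi>' j F)" using h(1) by simp
  qed
  then show ?thesis by blast
qed

text \<open>
  Extend an element of the \<open>j\<close>-th eigenspace by zero off the frames through \<open>evec n\<close>.  If one of the two
  components above \<open>j\<close> vanished, the restriction and the average of the other one would be proportional by a nonzero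
  factor; but the average is zero and the restriction is not.
\<close>
lemma projections_nonzero_Suc:
  assumes \<pi>: "spectral_projections n \<pi>" and \<pi>': "spectral_projections (Suc n) \<pi>'"
    and j: "j \<le> n" and \<phi>: "\<phi> \<in> sections n" "\<pi> j \<phi> \<noteq> 0"
  shows "\<exists>F\<in>sections (Suc n). \<pi>' j F \<noteq> 0 \<and> \<pi>' (Suc j) F \<noteq> 0"
proof -
  obtain F k where F: "F \<in> sections (Suc n)" "k \<noteq> 0" "\<And>X. res_op n F X = k * \<phi> X" "\<And>X. avg_op n F X = 0"
    by (rule sections_extension[OF \<phi>(1)]) (rule that)
  have lin: "linear_op (\<pi> j)" using \<pi> j by (simp add: spectral_projections_def)
  define h where "h = (\<lambda>i. \<pi>' i F)"
  have h: "h i \<in> sections (Suc n)" "transv_op (Suc n) (h i) = fun_scale (transv_ev (Suc n) i) (h i)" if "i \<le> Suc n" for i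
    using \<pi>' F(1) that by (auto simp: h_def spectral_projections_def)
  have Fh: "F = (\<Sum>i\<le>Suc n. h i)" using \<pi>' F(1) unfolding h_def spectral_projections_def by blast
  obtain X where X: "\<pi> j \<phi> X \<noteq> 0" using \<phi>(2) by (auto simp: fun_eq_iff)
  define x where "x = (\<lambda>i. \<pi> j (res_op n (h i)) X)"
  define y where "y = (\<lambda>i. \<pi> j (avg_op n (h i)) X)"
  have xy: "(transv_ev (Suc n) i - q * transv_ev n j) * x i = (q - 1)\<^sup>2 * y i" if "i \<le> Suc n" for i
    using fun_cong[OF transv_eigenvector_pieces(1)[OF h(1)[OF that] that h(2)[OF that] j \<pi>], of X]
    by (simp add: x_def y_def fun_scale_def)
  have x0: "x i = 0" if "i \<le> Suc n" "i \<noteq> j" "i \<noteq> Suc j" for i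
    using transv_eigenvector_pieces(2)[OF h(1)[OF that(1)] that(1) h(2)[OF that(1)] j \<pi> that(2,3)] by (simp add: x_def)
  then have y0: "y i = 0" if "i \<le> Suc n" "i \<noteq> j" "i \<noteq> Suc j" for i
    using xy[OF that(1)] that q_minus_1_nonzero by simp
  have two: "(\<Sum>i\<le>Suc n. z i) = z j + z (Suc j)" if "\<And>i. i \<le> Suc n \<Longrightarrow> i \<noteq> j \<Longrightarrow> i \<noteq> Suc j \<Longrightarrow> z i = 0" for z :: "nat \<Rightarrow> complex"
  proof -
    have "(\<Sum>i\<le>Suc n. z i) = (\<Sum>i\<in>{j, Suc j}. z i)"
      by (rule sum.mono_neutral_right) (use j that in auto)
    then show ?thesis by simp
  qed
  have sum_x: "(\<Sum>i\<le>Suc n. x i) = x j + x (Suc j)" and sum_y: "(\<Sum>i\<le>Suc n. y i) = y j + y (Suc j)"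
    by (rule two, rule x0, assumption+) (rule two, rule y0, assumption+)
  have "\<pi> j (res_op n F) X = (\<Sum>i\<le>Suc n. x i)"
    by (subst Fh) (simp only: module_hom.sum[OF linear_res_op] module_hom.sum[OF lin] sum_fun_apply x_def)
  moreover have "res_op n F = fun_scale k \<phi>" using F(3) by (simp add: fun_scale_def fun_eq_iff)
  ultimately have x: "x j + x (Suc j) = k * \<pi> j \<phi> X"
    unfolding sum_x by (simp add: module_hom.scale[OF lin]) (simp add: fun_scale_def)
  have "\<pi> j (avg_op n F) X = (\<Sum>i\<le>Suc n. y i)"
    by (subst Fh) (simp only: module_hom.sum[OF linear_avg_op] module_hom.sum[OF lin] sum_fun_apply y_def)
  moreover have "avg_op n F = 0" using F(4) by (simp add: fun_eq_iff)
  ultimately have y: "y j + y (Suc j) = 0"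
    unfolding sum_y by (simp add: module_hom.zero[OF lin])
  have "x j \<noteq> 0 \<and> x (Suc j) \<noteq> 0"
  proof -
    define u where "u = transv_ev (Suc n) j - q * transv_ev n j"
    define w where "w = transv_ev (Suc n) (Suc j) - q * transv_ev n j"
    have uw: "u \<noteq> 0" "w \<noteq> 0"
      using transv_ev_diff(1,2)[OF j] s_nonzero q_minus_1_nonzero by (simp_all add: u_def w_def)
    have "u * x j + w * x (Suc j) = (q - 1)\<^sup>2 * (y j + y (Suc j))"
      using xy[of j] xy[of "Suc j"] j by (simp add: u_def w_def distrib_left)
    then have "u * x j + w * x (Suc j) = 0" using y by simp
    then show ?thesis using uw x X F(2) by auto
  qed
  then have "h j \<noteq> 0 \<and> h (Suc j) \<noteq> 0"
    by (auto simp: x_def module_hom.zero[OF lin] module_hom.zero[OF linear_res_op])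
  then show ?thesis using F(1) by (auto simp: h_def)
qed

lemma frames_0: "frames 0 = {0 :: nat \<Rightarrow> 'a hvec}"
proof -
  have "isotuples 0 = {0 :: nat \<Rightarrow> 'a hvec}" by (auto simp: isotuples_def fun_eq_iff)
  then show ?thesis using std_frame_frames[of 0, where 'a = 'a] by (auto simp: frames_def)
qed

lemma spectral_projections_0: "spectral_projections 0 (\<lambda>_ F. F)"
proof -
  have "linear_op (\<lambda>F :: (nat \<Rightarrow> 'a hvec) \<Rightarrow> complex. F)" by (rule linear_opI) simp_all
  moreover have "transv_op 0 F = fun_scale (transv_ev 0 0) F" for F
  proof
    fix X
    have "(\<Sum>t\<in>- {0}. \<beta> t * F (transv 0 0 t \<circ> 0)) = (\<Sum>t\<in>- {0}. \<beta> t) * F 0"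
      unfolding sum_distrib_right by (rule sum.cong) (auto simp: fun_eq_iff intro!: arg_cong[of _ _ F])
    then show "transv_op 0 F X = fun_scale (transv_ev 0 0) F X"
      by (simp add: transv_op_def frames_0 transv_ev_def fun_scale_def sum_units)
  qed
  moreover have "opp_op 0 F = fun_scale (opp_ev 0 0) F" if F: "F \<in> sections 0" for F
  proof
    fix X
    have "duals 0 (0 :: nat \<Rightarrow> 'a hvec) = {0}" by (auto simp: duals_def isotuples_def fun_eq_iff)
    then show "opp_op 0 F X = fun_scale (opp_ev 0 0) F X"
      using F by (simp add: opp_op_def frames_0 opp_ev_def fun_scale_def sections_def binomial_eq_0)
  qed
  ultimately show ?thesis by (simp add: spectral_projections_def)
qed

theorem spectral_theorem:
  "\<exists>\<pi>. spectral_projections n \<pi> \<and> (\<forall>j\<le>n. \<exists>F\<in>sections n. \<pi> j F \<noteq> 0)"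
proof (induction n)
  case 0
  define F where "F = (\<lambda>X :: nat \<Rightarrow> 'a hvec. if X = 0 then 1 else 0 :: complex)"
  have "F \<in> sections 0" by (auto simp: sections_def frames_0 F_def row_act_def fun_eq_iff)
  moreover have "F \<noteq> 0" by (auto simp: F_def fun_eq_iff)
  ultimately have "\<forall>j\<le>0. \<exists>F\<in>sections 0. F \<noteq> 0" by blast
  then show ?case using spectral_projections_0 by blast
next
  case (Suc n)
  then obtain \<pi> where \<pi>: "spectral_projections n \<pi>" "\<And>j. j \<le> n \<Longrightarrow> \<exists>F\<in>sections n. \<pi> j F \<noteq> 0" by blast
  obtain \<pi>' where \<pi>': "spectral_projections (Suc n) \<pi>'" using spectral_projections_Suc[OF \<pi>(1)] by blast
  have step: "\<exists>F\<in>sections (Suc n). \<pi>' j F \<noteq> 0 \<and> \<pi>' (Suc j) F \<noteq> 0" if "j \<le> n" for j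
    using \<pi>(2)[OF that] projections_nonzero_Suc[OF \<pi>(1) \<pi>' that] by blast
  have "\<exists>F\<in>sections (Suc n). \<pi>' j F \<noteq> 0" if "j \<le> Suc n" for j
    using step[of j] step[of "j - 1"] that by (cases j) auto
  then show ?case using \<pi>' by blast
qed

end

section \<open>Symplectic matrices and frames\<close>

abbreviation square_mats :: "nat \<Rightarrow> 'a mat set" where
  "square_mats n \<equiv> carrier_mat (2 * n) (2 * n)"

definition row_hvec :: "nat \<Rightarrow> 'a::field mat \<Rightarrow> nat \<Rightarrow> 'a hvec" where
  "row_hvec n g i = (\<lambda>(k, b). if k < n then (if b then g $$ (i, n + k) else g $$ (i, k)) else 0)"

definition top_rows :: "nat \<Rightarrow> 'a::field mat \<Rightarrow> nat \<Rightarrow> 'a hvec" where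
  "top_rows n g = (\<lambda>i. if i < n then row_hvec n g i else 0)"

definition bottom_rows :: "nat \<Rightarrow> 'a::field mat \<Rightarrow> nat \<Rightarrow> 'a hvec" where
  "bottom_rows n g = (\<lambda>i. if i < n then row_hvec n g (n + i) else 0)"

definition mat_of_rows2 :: "nat \<Rightarrow> (nat \<Rightarrow> 'a::field hvec) \<Rightarrow> (nat \<Rightarrow> 'a hvec) \<Rightarrow> 'a mat" where
  "mat_of_rows2 n Y X = mat (2 * n) (2 * n) (\<lambda>(i, j). (if i < n then Y i else X (i - n)) (if j < n then (j, False) else (j - n, True)))"

lemma row_hvec_apply [simp]:
  "row_hvec n g i (k, b) = (if k < n then (if b then g $$ (i, n + k) else g $$ (i, k)) else 0)"
  by (simp add: row_hvec_def)

lemma row_hvec_hspace: "row_hvec n g i \<in> hspace n"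
  by (auto simp: hspace_def)

lemma sum_lessThan_add: "(\<Sum>i<n + m :: nat. f i) = (\<Sum>i<n. f i) + (\<Sum>i<m. f (n + i) :: 'a::comm_monoid_add)"
  by (induction m) (simp_all add: add.assoc)

lemma half_cases:
  assumes "(i :: nat) < 2 * n"
  obtains (low) "i < n" | (high) k where "k < n" "i = n + k"
  using assms by (metis add_diff_inverse_nat mult_2 nat_add_left_cancel_less)

lemma sum_double: "(\<Sum>i = 0..<2 * n :: nat. f i) = (\<Sum>i<n. f i) + (\<Sum>i<n. f (n + i) :: 'a::comm_monoid_add)"
  using sum_lessThan_add[of f n n] by (simp add: lessThan_atLeast0 mult_2)

lemma J_mat_carrier [simp]: "J_mat n \<in> square_mats n"
  by (simp add: J_mat_def mult_2)

lemma J_mat_dim [simp]: "dim_row (J_mat n) = 2 * n" "dim_col (J_mat n) = 2 * n"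
  using J_mat_carrier by blast+

lemma J_mat_index:
  "i < n \<Longrightarrow> j < n \<Longrightarrow> J_mat n $$ (i, j) = 0"
  "i < n \<Longrightarrow> j < n \<Longrightarrow> J_mat n $$ (i, n + j) = (if i = j then - 1 else 0)"
  "i < n \<Longrightarrow> j < n \<Longrightarrow> J_mat n $$ (n + i, j) = (if i = j then 1 else 0)"
  "i < n \<Longrightarrow> j < n \<Longrightarrow> J_mat n $$ (n + i, n + j) = 0"
  by (auto simp: J_mat_def)

lemma mult_index_double:
  assumes "A \<in> square_mats n" "B \<in> square_mats n" "i < 2 * n" "j < 2 * n"
  shows "(A * B) $$ (i, j) = (\<Sum>k<n. A $$ (i, k) * B $$ (k, j)) + (\<Sum>k<n. A $$ (i, n + k) * B $$ (n + k, j))"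
  using assms by (simp add: scalar_prod_def sum_double)

lemma row_hvec_mult:
  assumes "h \<in> square_mats n" "g \<in> square_mats n" "i < 2 * n"
  shows "row_hvec n (h * g) i = lincomb n (\<lambda>k. h $$ (i, k)) (top_rows n g) + lincomb n (\<lambda>k. h $$ (i, n + k)) (bottom_rows n g)"
proof
  fix p :: "nat \<times> bool"
  obtain k b where p: "p = (k, b)" by (cases p)
  show "row_hvec n (h * g) i p = (lincomb n (\<lambda>k. h $$ (i, k)) (top_rows n g) + lincomb n (\<lambda>k. h $$ (i, n + k)) (bottom_rows n g)) p"
    using mult_index_double[OF assms, of k] mult_index_double[OF assms, of "n + k"]
    by (auto simp: p lincomb_def sum_fun_apply top_rows_def bottom_rows_def)
qed

lemma J_sandwich_index:
  assumes g: "g \<in> square_mats n" and ij: "i < 2 * n" "j < 2 * n"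
  shows "(g * J_mat n * transpose_mat g) $$ (i, j) = sform n (row_hvec n g i) (row_hvec n g j)"
proof -
  have 1: "(g * J_mat n) $$ (i, k) = g $$ (i, n + k)" if k: "k < n" for k
    using mult_index_double[OF g J_mat_carrier ij(1), of k] k sum_delta_mult[OF k, of "\<lambda>l. J_mat n $$ (n + l, k)" 1 "\<lambda>l. g $$ (i, n + l)"]
    by (simp add: J_mat_index)
  have 2: "(g * J_mat n) $$ (i, n + k) = - g $$ (i, k)" if k: "k < n" for k
    using mult_index_double[OF g J_mat_carrier ij(1), of "n + k"] k sum_delta_mult[OF k, of "\<lambda>l. J_mat n $$ (l, n + k)" "- 1" "\<lambda>l. g $$ (i, l)"]
    by (simp add: J_mat_index)
  have "g * J_mat n \<in> square_mats n" using g by simp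
  moreover have "transpose_mat g \<in> square_mats n" using g by simp
  ultimately have "(g * J_mat n * transpose_mat g) $$ (i, j) =
      (\<Sum>k<n. (g * J_mat n) $$ (i, k) * transpose_mat g $$ (k, j)) + (\<Sum>k<n. (g * J_mat n) $$ (i, n + k) * transpose_mat g $$ (n + k, j))"
    using ij by (rule mult_index_double)
  also have "\<dots> = (\<Sum>k<n. g $$ (i, n + k) * g $$ (j, k)) + (\<Sum>k<n. - g $$ (i, k) * g $$ (j, n + k))"
    using g ij 1 2 by (intro arg_cong2[of _ _ _ _ "(+)"] sum.cong) auto
  also have "\<dots> = sform n (row_hvec n g i) (row_hvec n g j)"
    by (simp add: sform_def sum_subtractf sum_negf)
  finally show ?thesis .
qed

lemma J_mat_J_mat: "J_mat n * (- J_mat n) = (1\<^sub>m (2 * n) :: 'a::field mat)"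
  "- J_mat n * J_mat n = (1\<^sub>m (2 * n) :: 'a mat)" "J_mat n * J_mat n = (- 1\<^sub>m (2 * n) :: 'a mat)"
proof -
  show JJ: "J_mat n * J_mat n = (- 1\<^sub>m (2 * n) :: 'a mat)"
  proof (rule eq_matI)
    fix i j assume "i < dim_row (- 1\<^sub>m (2 * n) :: 'a mat)" "j < dim_col (- 1\<^sub>m (2 * n) :: 'a mat)"
    then have ij: "i < 2 * n" "j < 2 * n" by auto
    show "(J_mat n * J_mat n :: 'a mat) $$ (i, j) = (- 1\<^sub>m (2 * n)) $$ (i, j)"
      using ij(1)
    proof (cases i rule: half_cases)
      case low
      then have "(J_mat n * J_mat n :: 'a mat) $$ (i, j) = (\<Sum>k<n. J_mat n $$ (n + k, j) * (if k = i then - 1 else 0))"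
        unfolding mult_index_double[OF J_mat_carrier J_mat_carrier ij]
        by (auto simp: J_mat_index mult.commute intro!: sum.cong)
      also have "\<dots> = J_mat n $$ (n + i, j) * - 1" by (rule sum_delta_mult) (use low in auto)
      finally have eq: "(J_mat n * J_mat n :: 'a mat) $$ (i, j) = J_mat n $$ (n + i, j) * - 1" .
      show ?thesis unfolding eq using ij(2) by (cases j rule: half_cases) (use low in \<open>auto simp: J_mat_index\<close>)
    next
      case (high l)
      then have "(J_mat n * J_mat n :: 'a mat) $$ (i, j) = (\<Sum>k<n. J_mat n $$ (k, j) * (if k = l then 1 else 0))"
        unfolding mult_index_double[OF J_mat_carrier J_mat_carrier ij]
        by (auto simp: J_mat_index intro!: sum.cong)
      also have "\<dots> = J_mat n $$ (l, j) * 1" by (rule sum_delta_mult) (use high in auto)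
      finally have eq: "(J_mat n * J_mat n :: 'a mat) $$ (i, j) = J_mat n $$ (l, j) * 1" .
      show ?thesis unfolding eq using ij(2) by (cases j rule: half_cases) (use high in \<open>auto simp: J_mat_index\<close>)
    qed
  qed auto
  show "J_mat n * (- J_mat n) = (1\<^sub>m (2 * n) :: 'a mat)" "- J_mat n * J_mat n = (1\<^sub>m (2 * n) :: 'a mat)"
    using JJ by simp_all
qed


lemma square_mat_mult_closed:
  "A \<in> carrier_mat m m \<Longrightarrow> B \<in> carrier_mat m m \<Longrightarrow> A * B \<in> carrier_mat m m"
  by simp

lemma square_mat_mult_assoc:
  "A \<in> carrier_mat m m \<Longrightarrow> B \<in> carrier_mat m m \<Longrightarrow> C \<in> carrier_mat m m \<Longrightarrow> A * B * C = A * (B * C)"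
  by (rule assoc_mult_mat)

lemma transpose_J_mat: "transpose_mat (J_mat n) = - (J_mat n :: 'a::field mat)" "transpose_mat (- J_mat n) = (J_mat n :: 'a mat)"
proof -
  show *: "transpose_mat (J_mat n) = (- J_mat n :: 'a mat)"
  proof (rule eq_matI)
    fix i j assume "i < dim_row (- J_mat n :: 'a mat)" "j < dim_col (- J_mat n :: 'a mat)"
    then have ij: "i < 2 * n" "j < 2 * n" by auto
    show "transpose_mat (J_mat n) $$ (i, j) = (- J_mat n :: 'a mat) $$ (i, j)"
      using ij(1)
    proof (cases i rule: half_cases)
      case low
      show ?thesis using ij(2) by (cases j rule: half_cases) (use low in \<open>auto simp: J_mat_index\<close>)
    next
      case (high k)
      show ?thesis using ij(2) by (cases j rule: half_cases) (use high in \<open>auto simp: J_mat_index\<close>)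
    qed
  qed auto
  show "transpose_mat (- J_mat n) = (J_mat n :: 'a mat)"
    unfolding *[symmetric] by simp
qed

text \<open>
  The condition on the rows of \<open>g\<close> is the same as that on the columns, because \<open>J\<close> has square \<open>-1\<close>.
\<close>
lemma Sp_iff_right:
  assumes g: "g \<in> square_mats n"
  shows "g \<in> carrier (Sp n) \<longleftrightarrow> g * J_mat n * transpose_mat g = (J_mat n :: 'a::field mat)"
proof -
  let ?J = "J_mat n :: 'a mat" and ?t = "transpose_mat g"
  have t: "?t \<in> square_mats n" and J: "?J \<in> square_mats n" using g by auto
  have nJ: "- ?J \<in> square_mats n" by simp
  note closed = square_mat_mult_closed[of _ "2 * n"] and assoc = square_mat_mult_assoc[of _ "2 * n"]
  have swap: "X * ?J * Y = ?J \<Longrightarrow> Y * ?J * X = ?J"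
    if X: "X \<in> square_mats n" and Y: "Y \<in> square_mats n" for X Y
  proof -
    assume XJY: "X * ?J * Y = ?J"
    have "X * ?J * (Y * - ?J) = X * ?J * Y * - ?J"
      by (simp only: assoc closed X Y J nJ)
    also have "\<dots> = 1\<^sub>m (2 * n)" unfolding XJY by (rule J_mat_J_mat)
    finally have "Y * - ?J * (X * ?J) = 1\<^sub>m (2 * n)"
      by (rule mat_mult_left_right_inverse[OF closed[OF X J] closed[OF Y nJ]])
    then have "Y * - ?J * (X * ?J) * - ?J = - ?J" by simp
    moreover have "Y * - ?J * (X * ?J) * - ?J = Y * - ?J * X * (?J * - ?J)"
      by (simp only: assoc closed X Y J nJ)
    moreover have "\<dots> = Y * - ?J * X"
      unfolding J_mat_J_mat by (rule right_mult_one_mat[OF closed[OF closed[OF Y nJ] X]])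
    ultimately have "Y * - ?J * X = - ?J" by simp
    then have "- (- (Y * ?J * X)) = - (- ?J)" using X Y by simp
    then show ?thesis by simp
  qed
  show ?thesis
  proof
    assume "g \<in> carrier (Sp n)"
    then show "g * ?J * ?t = ?J" using swap[OF t g] by (simp add: Sp_def)
  next
    assume *: "g * ?J * ?t = ?J"
    have gJ: "?J * (?t * - ?J) \<in> square_mats n" using t J nJ by auto
    have "g * (?J * (?t * - ?J)) = g * ?J * ?t * - ?J"
      by (simp only: assoc closed g t J nJ)
    then have inv: "g * (?J * (?t * - ?J)) = 1\<^sub>m (2 * n)" unfolding * by (simp only: J_mat_J_mat)
    from mat_mult_left_right_inverse[OF g gJ this] inv have "invertible_mat g"
      using g gJ unfolding invertible_mat_def inverts_mat_def
      by (intro conjI exI[of _ "?J * (?t * - ?J)"]) auto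
    then show "g \<in> carrier (Sp n)" using swap[OF g t *] g by (simp add: Sp_def)
  qed
qed

lemma Sp_carrier: "g \<in> carrier (Sp n) \<Longrightarrow> g \<in> square_mats n"
  by (simp add: Sp_def)

lemma top_isotuple_iff:
  "top_rows n g \<in> isotuples n \<longleftrightarrow> (\<forall>i<n. \<forall>j<n. sform n (row_hvec n g i) (row_hvec n g j) = 0)"
  "bottom_rows n g \<in> isotuples n \<longleftrightarrow> (\<forall>i<n. \<forall>j<n. sform n (row_hvec n g (n + i)) (row_hvec n g (n + j)) = 0)"
  by (auto simp: isotuples_def top_rows_def bottom_rows_def row_hvec_hspace)

lemma Sp_iff_rows:
  assumes g: "g \<in> square_mats n"
  shows "g \<in> carrier (Sp n) \<longleftrightarrow> top_rows n g \<in> isotuples n \<and> bottom_rows n g \<in> duals n (top_rows n g)"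
    (is "?L = ?R")
proof
  assume ?L
  then have eq: "g * J_mat n * transpose_mat g = J_mat n" using Sp_iff_right[OF g] by simp
  have "sform n (row_hvec n g i) (row_hvec n g j) = J_mat n $$ (i, j)" if "i < 2 * n" "j < 2 * n" for i j
    using J_sandwich_index[OF g that] eq by simp
  then show ?R
    by (simp add: duals_def top_isotuple_iff) (simp add: top_rows_def bottom_rows_def J_mat_index)
next
  assume R: ?R
  then have rows: "sform n (row_hvec n g i) (row_hvec n g j) = 0"
    "sform n (row_hvec n g (n + i)) (row_hvec n g (n + j)) = 0"
    "sform n (row_hvec n g (n + i)) (row_hvec n g j) = (if i = j then 1 else 0)"
    "sform n (row_hvec n g i) (row_hvec n g (n + j)) = (if i = j then - 1 else 0)"
    if "i < n" "j < n" for i j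
    using that sform_skew[of n "row_hvec n g i" "row_hvec n g (n + j)"]
    by (simp_all add: duals_def top_isotuple_iff) (simp_all add: top_rows_def bottom_rows_def)
  have "g * J_mat n * transpose_mat g = J_mat n"
  proof (rule eq_matI)
    fix i j assume "i < dim_row (J_mat n :: 'a mat)" "j < dim_col (J_mat n :: 'a mat)"
    then have ij: "i < 2 * n" "j < 2 * n" by auto
    show "(g * J_mat n * transpose_mat g) $$ (i, j) = J_mat n $$ (i, j)"
      unfolding J_sandwich_index[OF g ij] using ij(1)
    proof (cases i rule: half_cases)
      case low
      show "sform n (row_hvec n g i) (row_hvec n g j) = J_mat n $$ (i, j)"
        using ij(2) by (cases j rule: half_cases) (use low in \<open>auto simp: rows J_mat_index\<close>)
    next
      case (high k)
      show "sform n (row_hvec n g i) (row_hvec n g j) = J_mat n $$ (i, j)"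
        using ij(2) by (cases j rule: half_cases) (use high in \<open>auto simp: rows J_mat_index\<close>)
    qed
  qed (use g in auto)
  then show ?L using Sp_iff_right[OF g] by simp
qed

lemma bottom_rows_frame: "g \<in> carrier (Sp n) \<Longrightarrow> bottom_rows n g \<in> frames n"
  using Sp_iff_rows[OF Sp_carrier] duals_frames by blast

lemma rows_mat_of_rows2:
  assumes "Y \<in> isotuples n" "X \<in> isotuples n"
  shows "top_rows n (mat_of_rows2 n Y X) = Y" "bottom_rows n (mat_of_rows2 n Y X) = X"
  using assms by (auto simp: top_rows_def bottom_rows_def mat_of_rows2_def row_hvec_def fun_eq_iff
      isotuples_def hspace_def not_less)

lemma mat_of_rows2_Sp:
  assumes "Y \<in> isotuples n" "X \<in> duals n Y"
  shows "mat_of_rows2 n Y X \<in> carrier (Sp n)"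
proof -
  have "X \<in> isotuples n" using assms(2) by (simp add: duals_def)
  moreover have "mat_of_rows2 n Y X \<in> square_mats n" by (simp add: mat_of_rows2_def)
  ultimately show ?thesis using Sp_iff_rows[of "mat_of_rows2 n Y X" n] rows_mat_of_rows2[OF assms(1)] assms by simp
qed

lemma frame_is_bottom:
  assumes X: "X \<in> frames n"
  shows "\<exists>g\<in>carrier (Sp n). bottom_rows n g = X"
proof -
  obtain Z where Z: "Z \<in> duals n X" using X by (auto simp: frames_def)
  have Xt: "X \<in> isotuples n" using X by (simp add: frames_def)
  define Y where "Y = (\<lambda>i. - Z i)"
  have Y: "Y \<in> isotuples n"
    using Z by (auto simp: Y_def duals_def isotuples_def sform_linear intro: hspace_uminus)
  have "sform n (X i) (Y j) = (if i = j then 1 else 0)" if "i < n" "j < n" for i j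
    using Z that sform_skew[of n "X i" "Z j"] by (simp add: Y_def sform_linear duals_def)
  then have "X \<in> duals n Y" using Xt by (simp add: duals_def)
  then show ?thesis using mat_of_rows2_Sp[OF Y] rows_mat_of_rows2[OF Y Xt] by blast
qed

lemma rows_eqI:
  assumes "g \<in> square_mats n" "h \<in> square_mats n"
    "top_rows n g = top_rows n h" "bottom_rows n g = bottom_rows n h"
  shows "g = h"
proof (rule eq_matI)
  have rows: "row_hvec n g i = row_hvec n h i" if i: "i < 2 * n" for i
    using i
  proof (cases i rule: half_cases)
    case low then show ?thesis using fun_cong[OF assms(3), of i] by (simp add: top_rows_def)
  next
    case (high k) then show ?thesis using fun_cong[OF assms(4), of k] by (simp add: bottom_rows_def)
  qed
  fix i j assume "i < dim_row h" "j < dim_col h"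
  then have ij: "i < 2 * n" "j < 2 * n" using assms by auto
  show "g $$ (i, j) = h $$ (i, j)" using ij(2)
  proof (cases j rule: half_cases)
    case low then show ?thesis using fun_cong[OF rows[OF ij(1)], of "(j, False)"] by simp
  next
    case (high k) then show ?thesis using fun_cong[OF rows[OF ij(1)], of "(k, True)"] by simp
  qed
qed (use assms in auto)

lemma Sp_mult:
  assumes "g \<in> carrier (Sp n)" "h \<in> carrier (Sp n)"
  shows "g * h \<in> carrier (Sp n)"
proof -
  have g: "g \<in> square_mats n" and h: "h \<in> square_mats n"
    using assms by (simp_all add: Sp_def)
  let ?tg = "transpose_mat g" and ?th = "transpose_mat h"
  have t: "?tg \<in> square_mats n" "?th \<in> square_mats n" using g h by auto
  note closed = square_mat_mult_closed[of _ "2 * n"] and assoc = square_mat_mult_assoc[of _ "2 * n"]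
  have "g * h * J_mat n * transpose_mat (g * h) = g * h * J_mat n * (?th * ?tg)"
    using transpose_mult[OF g h] by simp
  also have "\<dots> = g * (h * J_mat n * ?th) * ?tg"
    by (simp only: assoc closed g h t J_mat_carrier)
  also have "\<dots> = J_mat n" using assms Sp_iff_right[OF g] Sp_iff_right[OF h] by simp
  finally show ?thesis using Sp_iff_right[of "g * h" n] g h by simp
qed

lemma Sp_inverse:
  assumes "g \<in> carrier (Sp n)"
  obtains h where "h \<in> carrier (Sp n)" "g * h = 1\<^sub>m (2 * n)" "h * g = 1\<^sub>m (2 * n)"
proof -
  have g: "g \<in> square_mats n" using assms by (simp add: Sp_def)
  obtain h where "g * h = 1\<^sub>m (2 * n)" "h * g = 1\<^sub>m (dim_row h)"
    using assms g by (auto simp: Sp_def invertible_mat_def inverts_mat_def)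
  moreover from this have "dim_col h = 2 * n" "dim_row h = 2 * n"
    using g by (metis carrier_matD(2) index_mult_mat(3) index_one_mat(3)) (metis calculation(2) carrier_matD(2) g index_mult_mat(3) index_one_mat(3))
  ultimately have h: "h \<in> square_mats n" "g * h = 1\<^sub>m (2 * n)" "h * g = 1\<^sub>m (2 * n)" by auto
  note closed = square_mat_mult_closed[of _ "2 * n"] and assoc = square_mat_mult_assoc[of _ "2 * n"]
  let ?tg = "transpose_mat g" and ?th = "transpose_mat h"
  have t: "?tg \<in> square_mats n" "?th \<in> square_mats n" using g h by auto
  have tt: "?tg * ?th = 1\<^sub>m (2 * n)" using transpose_mult[OF h(1) g] h(3) by simp
  have "h * J_mat n * ?th = h * (g * J_mat n * ?tg) * ?th"
    using assms Sp_iff_right[OF g] by simp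
  also have "\<dots> = (h * g) * J_mat n * (?tg * ?th)"
    by (simp only: assoc closed g h(1) t J_mat_carrier)
  also have "\<dots> = J_mat n" unfolding tt h(3) by simp
  finally have "h \<in> carrier (Sp n)" using Sp_iff_right[OF h(1)] by simp
  then show thesis using that h by blast
qed

lemma J_mat_Sp: "(J_mat n :: 'a::field mat) \<in> carrier (Sp n)" "(- J_mat n :: 'a mat) \<in> carrier (Sp n)"
proof -
  have "J_mat n * J_mat n * transpose_mat (J_mat n) = (J_mat n :: 'a::field mat)"
    unfolding J_mat_J_mat transpose_J_mat by simp
  moreover have "- J_mat n * J_mat n * transpose_mat (- J_mat n) = (J_mat n :: 'a mat)"
    unfolding J_mat_J_mat transpose_J_mat by simp
  ultimately show "(J_mat n :: 'a mat) \<in> carrier (Sp n)" "(- J_mat n :: 'a mat) \<in> carrier (Sp n)"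
    using Sp_iff_right[of "J_mat n :: 'a mat" n] Sp_iff_right[of "- J_mat n :: 'a mat" n] by auto
qed

lemma Sp_ops: "x \<otimes>\<^bsub>Sp n\<^esub> y = x * y" "\<one>\<^bsub>Sp n\<^esub> = 1\<^sub>m (2 * n)"
  by (simp_all add: Sp_def)

lemma inv_J_mat: "inv\<^bsub>Sp n\<^esub> (J_mat n) = - (J_mat n :: 'a::field mat)"
  unfolding m_inv_def
proof (rule the_equality)
  show "- J_mat n \<in> carrier (Sp n) \<and> J_mat n \<otimes>\<^bsub>Sp n\<^esub> - J_mat n = \<one>\<^bsub>Sp n\<^esub> \<and> - J_mat n \<otimes>\<^bsub>Sp n\<^esub> J_mat n = (\<one>\<^bsub>Sp n\<^esub> :: 'a mat)"
    unfolding Sp_ops by (intro conjI J_mat_Sp J_mat_J_mat)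
next
  fix y :: "'a mat"
  assume y: "y \<in> carrier (Sp n) \<and> J_mat n \<otimes>\<^bsub>Sp n\<^esub> y = \<one>\<^bsub>Sp n\<^esub> \<and> y \<otimes>\<^bsub>Sp n\<^esub> J_mat n = \<one>\<^bsub>Sp n\<^esub>"
  then have yc: "y \<in> square_mats n" and yJ: "y * J_mat n = 1\<^sub>m (2 * n)"
    unfolding Sp_ops by (simp_all add: Sp_carrier)
  have "y = y * (J_mat n * - J_mat n)" using yc by (simp only: J_mat_J_mat right_mult_one_mat)
  also have "\<dots> = y * J_mat n * - J_mat n"
    using yc by (intro assoc_mult_mat[symmetric, of _ "2 * n" "2 * n" _ "2 * n" _ "2 * n"]) auto
  also have "\<dots> = - J_mat n" unfolding yJ by simp
  finally show "y = - J_mat n" .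
qed

section \<open>The Siegel parabolic and the induced representation\<close>

lemma block_rows:
  assumes p: "p = four_block_mat A B (0\<^sub>m n n) D" and "A \<in> carrier_mat n n" "B \<in> carrier_mat n n" "D \<in> carrier_mat n n"
    and i: "i < n" and j: "j < n"
  shows "p $$ (i, j) = A $$ (i, j)" "p $$ (i, n + j) = B $$ (i, j)" "p $$ (n + i, j) = 0" "p $$ (n + i, n + j) = D $$ (i, j)"
  using assms by auto

lemma siegel_diagonal_inverse:
  fixes A B D :: "'a::field mat"
  assumes p: "four_block_mat A B (0\<^sub>m n n) D \<in> carrier (Sp n)" (is "?p \<in> _")
    and c: "A \<in> carrier_mat n n" "B \<in> carrier_mat n n" "D \<in> carrier_mat n n"
  shows "D * transpose_mat A = 1\<^sub>m n"
proof (rule eq_matI)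
  fix i j assume "i < dim_row (1\<^sub>m n :: 'a mat)" "j < dim_col (1\<^sub>m n :: 'a mat)"
  then have ij: "i < n" "j < n" by auto
  have "bottom_rows n ?p \<in> duals n (top_rows n ?p)"
    using p Sp_iff_rows[OF Sp_carrier[OF p]] by simp
  then have "sform n (row_hvec n ?p (n + i)) (row_hvec n ?p j) = (if i = j then 1 else 0)"
    using ij by (auto simp: duals_def top_rows_def bottom_rows_def)
  moreover have "sform n (row_hvec n ?p (n + i)) (row_hvec n ?p j) = (\<Sum>k<n. D $$ (i, k) * A $$ (j, k))"
    unfolding sform_def by (rule sum.cong) (use c ij block_rows[OF refl c] in auto)
  moreover have "(D * transpose_mat A) $$ (i, j) = (\<Sum>k<n. D $$ (i, k) * A $$ (j, k))"
    using c ij by (simp add: scalar_prod_def lessThan_atLeast0)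
  ultimately show "(D * transpose_mat A) $$ (i, j) = 1\<^sub>m n $$ (i, j)" using ij by simp
qed (use c in auto)

lemma siegel_det:
  fixes A B D :: "'a::field mat"
  assumes "four_block_mat A B (0\<^sub>m n n) D \<in> carrier (Sp n)"
    and c: "A \<in> carrier_mat n n" "B \<in> carrier_mat n n" "D \<in> carrier_mat n n"
  shows "det D * det A = 1"
proof -
  have "det (D * transpose_mat A) = 1" unfolding siegel_diagonal_inverse[OF assms] by simp
  then show ?thesis using c det_mult[of D n "transpose_mat A"] by (simp add: det_transpose)
qed

lemma split_block_four_block:
  assumes "A \<in> carrier_mat n n" "B \<in> carrier_mat n n" "C \<in> carrier_mat n n" "D \<in> carrier_mat n n"
  shows "split_block (four_block_mat A B C D) n n = (A, B, C, D)"
  using assms by (auto simp: split_block_def Let_def)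

lemma chi_det_four_block:
  assumes "A \<in> carrier_mat n n" "B \<in> carrier_mat n n" "C \<in> carrier_mat n n" "D \<in> carrier_mat n n"
  shows "chi_det n (four_block_mat A B C D) = inverse (det D)"
  by (simp add: chi_det_def split_block_four_block[OF assms])

lemma bottom_rows_siegel:
  assumes c: "A \<in> carrier_mat n n" "B \<in> carrier_mat n n" "D \<in> carrier_mat n n" and g: "g \<in> square_mats n"
  shows "bottom_rows n (four_block_mat A B (0\<^sub>m n n) D * g) = row_act n D (bottom_rows n g)"
proof
  fix i
  let ?p = "four_block_mat A B (0\<^sub>m n n) D"
  show "bottom_rows n (?p * g) i = row_act n D (bottom_rows n g) i"
  proof (cases "i < n")
    case True
    have p: "?p \<in> square_mats n" using c by (simp add: mult_2)
    have "row_hvec n (?p * g) (n + i) = lincomb n (\<lambda>k. ?p $$ (n + i, k)) (top_rows n g) + lincomb n (\<lambda>k. ?p $$ (n + i, n + k)) (bottom_rows n g)"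
      by (rule row_hvec_mult[OF p g]) (use True in simp)
    also have "lincomb n (\<lambda>k. ?p $$ (n + i, k)) (top_rows n g) = lincomb n (\<lambda>_. 0) (top_rows n g)"
      by (rule lincomb_cong) (use True c block_rows[OF refl c] in auto)
    also have "lincomb n (\<lambda>k. ?p $$ (n + i, n + k)) (bottom_rows n g) = lincomb n (\<lambda>k. D $$ (i, k)) (bottom_rows n g)"
      by (rule lincomb_cong) (use True c block_rows[OF refl c] in auto)
    finally show ?thesis using True by (simp add: bottom_rows_def[of n "?p * g"] row_act_def) (simp add: lincomb_def)
  qed (simp add: bottom_rows_def row_act_def)
qed

text \<open>
  The lower half of \<open>h g^(-1)\<close> is \<open>(0 D)\<close>, since multiplication by \<open>g\<close> and then by \<open>g^(-1)\<close> acts on each row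
  separately.
\<close>
lemma siegel_coset:
  fixes g h :: "'a::field mat"
  assumes g: "g \<in> carrier (Sp n)" and h: "h \<in> carrier (Sp n)"
    and D: "D \<in> carrier_mat n n" and rows: "bottom_rows n h = row_act n D (bottom_rows n g)"
  obtains A B where "A \<in> carrier_mat n n" "B \<in> carrier_mat n n"
    "four_block_mat A B (0\<^sub>m n n) D \<in> siegel_P n" "h = four_block_mat A B (0\<^sub>m n n) D * g"
proof -
  obtain k where k: "k \<in> carrier (Sp n)" "g * k = 1\<^sub>m (2 * n)" "k * g = 1\<^sub>m (2 * n)"
    by (rule Sp_inverse[OF g]) (rule that)
  note gc = Sp_carrier[OF g] and hc = Sp_carrier[OF h] and kc = Sp_carrier[OF k(1)]
  define p where "p = h * k"
  have p: "p \<in> carrier (Sp n)" unfolding p_def by (rule Sp_mult[OF h k(1)])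
  note pc = Sp_carrier[OF p]
  have "p * g = h * (k * g)" unfolding p_def by (rule square_mat_mult_assoc[OF hc kc gc])
  then have hpg: "h = p * g" unfolding k(3) using hc by simp
  define A where "A = mat n n (\<lambda>(i, j). p $$ (i, j))"
  define B where "B = mat n n (\<lambda>(i, j). p $$ (i, n + j))"
  have AB: "A \<in> carrier_mat n n" "B \<in> carrier_mat n n" by (simp_all add: A_def B_def)
  define W where "W = four_block_mat A B (0\<^sub>m n n) D"
  have W: "W \<in> square_mats n" using AB D by (simp add: W_def mult_2)
  have low: "p $$ (n + i, j) = W $$ (n + i, j)" if ij: "i < n" "j < 2 * n" for i j
  proof -
    have Wk: "W = W * g * k"
      unfolding square_mat_mult_assoc[OF W gc kc] k(2) using W by simp
    have r: "row_hvec n h (n + i) = row_hvec n (W * g) (n + i)"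
      using fun_cong[OF rows, of i] fun_cong[OF bottom_rows_siegel[OF AB D gc], of i] ij
      by (simp add: W_def bottom_rows_def)
    have hW: "h $$ (n + i, l) = (W * g) $$ (n + i, l)" if "l < 2 * n" for l
      using that
    proof (cases l rule: half_cases)
      case low then show ?thesis using fun_cong[OF r, of "(l, False)"] by simp
    next
      case (high m) then show ?thesis using fun_cong[OF r, of "(m, True)"] by simp
    qed
    have ni: "n + i < 2 * n" using ij by simp
    have "p $$ (n + i, j) = (W * g * k) $$ (n + i, j)"
      unfolding p_def mult_index_double[OF hc kc ni ij(2)] mult_index_double[OF square_mat_mult_closed[OF W gc] kc ni ij(2)]
      by (intro arg_cong2[of _ _ _ _ "(+)"] sum.cong refl) (simp_all add: hW)
    then show ?thesis using Wk by simp
  qed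
  have "p = W"
  proof (rule eq_matI)
    fix i j assume "i < dim_row W" "j < dim_col W"
    then have ij: "i < 2 * n" "j < 2 * n" using W by auto
    show "p $$ (i, j) = W $$ (i, j)" using ij(1)
    proof (cases i rule: half_cases)
      case low
      show ?thesis using ij(2)
        by (cases j rule: half_cases) (use low block_rows[OF W_def AB D] in \<open>auto simp: A_def B_def\<close>)
    next
      case (high m)
      then show ?thesis using low ij(2) by simp
    qed
  qed (use W pc in auto)
  then have "W \<in> siegel_P n" "h = W * g" using p hpg AB D unfolding siegel_P_def W_def by blast+
  then show thesis unfolding W_def by (rule that[OF AB])
qed

context quadratic_character
begin

definition of_section :: "nat \<Rightarrow> 'a frame_fun \<Rightarrow> 'a mat \<Rightarrow> complex" where
  "of_section n F g = (if g \<in> carrier (Sp n) then F (bottom_rows n g) else 0)"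

lemma linear_of_section: "linear_op (of_section n)"
  by (rule linear_opI) (auto simp: of_section_def fun_scale_def fun_eq_iff)

lemma of_section_eq_0:
  assumes F: "F \<in> sections n" and "of_section n F = 0"
  shows "F = 0"
proof
  fix X
  show "F X = 0 X"
  proof (cases "X \<in> frames n")
    case True
    then obtain g where g: "g \<in> carrier (Sp n)" "bottom_rows n g = X" using frame_is_bottom by blast
    then show ?thesis using fun_cong[OF assms(2), of g] by (simp add: of_section_def)
  qed (use F in \<open>simp add: sections_def\<close>)
qed

lemma of_section_in_Ind:
  assumes F: "F \<in> sections n" and \<chi>: "\<forall>p\<in>siegel_P n. \<chi> p = \<beta> (chi_det n p)"
  shows "of_section n F \<in> Ind n \<chi>"
  unfolding Ind_def
proof (intro CollectI conjI allI impI ballI)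
  show "of_section n F g = 0" if "g \<notin> carrier (Sp n)" for g using that by (simp add: of_section_def)
  fix p g :: "'a mat" assume p: "p \<in> siegel_P n" and g: "g \<in> carrier (Sp n)"
  obtain A B D where c: "A \<in> carrier_mat n n" "B \<in> carrier_mat n n" "D \<in> carrier_mat n n"
    and pb: "p = four_block_mat A B (0\<^sub>m n n) D" and ps: "p \<in> carrier (Sp n)" using p by (auto simp: siegel_P_def)
  have "det D \<noteq> 0" using siegel_det[OF ps[unfolded pb] c] by auto
  moreover have "\<chi> p = \<beta> (det D)"
    using \<chi> p c inverse[OF \<open>det D \<noteq> 0\<close>] by (simp add: pb chi_det_four_block)
  ultimately show "of_section n F (p * g) = \<chi> p * of_section n F g"
    using Sp_mult[OF ps g] g sections_row_act[OF F c(3) _ bottom_rows_frame[OF g]] bottom_rows_siegel[OF c Sp_carrier[OF g]]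
    by (simp add: of_section_def pb)
qed

text \<open>
  By \<open>siegel_coset\<close> the value \<open>f g\<close> depends only on the bottom rows of \<open>g\<close>.
\<close>
lemma Ind_of_section:
  assumes f: "f \<in> Ind n \<chi>" and \<chi>: "\<forall>p\<in>siegel_P n. \<chi> p = \<beta> (chi_det n p)"
  shows "\<exists>F\<in>sections n. f = of_section n F"
proof -
  define lift where "lift = (\<lambda>X. SOME g :: 'a mat. g \<in> carrier (Sp n) \<and> bottom_rows n g = X)"
  have lift: "lift X \<in> carrier (Sp n)" "bottom_rows n (lift X) = X" if "X \<in> frames n" for X
    using someI_ex[of "\<lambda>g :: 'a mat. g \<in> carrier (Sp n) \<and> bottom_rows n g = X"] frame_is_bottom[OF that]
    by (auto simp: lift_def)
  have transf: "f h = \<beta> (det D) * f g"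
    if g: "g \<in> carrier (Sp n)" and h: "h \<in> carrier (Sp n)" and D: "D \<in> carrier_mat n n" "det D \<noteq> 0"
      and rows: "bottom_rows n h = row_act n D (bottom_rows n g)" for g h D
  proof -
    obtain A B where AB: "A \<in> carrier_mat n n" "B \<in> carrier_mat n n"
      and p: "four_block_mat A B (0\<^sub>m n n) D \<in> siegel_P n" "h = four_block_mat A B (0\<^sub>m n n) D * g"
      by (rule siegel_coset[OF g h D(1) rows]) (rule that)
    have "\<chi> (four_block_mat A B (0\<^sub>m n n) D) = \<beta> (det D)"
      using \<chi> p(1) chi_det_four_block[OF AB _ D(1), of "0\<^sub>m n n"] inverse[OF D(2)] by simp
    then show ?thesis using f p g by (simp add: Ind_def)
  qed
  define F where "F = (\<lambda>X. if X \<in> frames n then f (lift X) else 0)"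
  have "F (row_act n D X) = \<beta> (det D) * F X" if D: "D \<in> carrier_mat n n" "det D \<noteq> 0" and X: "X \<in> frames n" for D X
    using transf[OF lift(1)[OF X] lift(1)[OF frames_row_act[OF D X]] D] lift(2)[OF X] lift(2)[OF frames_row_act[OF D X]]
      X frames_row_act[OF D X] by (simp add: F_def)
  then have F: "F \<in> sections n" by (auto simp: sections_def F_def)
  have "f g = of_section n F g" for g
  proof (cases "g \<in> carrier (Sp n)")
    case True
    note X = bottom_rows_frame[OF True]
    have "row_act n (1\<^sub>m n) (bottom_rows n g) = bottom_rows n g"
      by (rule row_act_one) (simp add: bottom_rows_def)
    then have "f (lift (bottom_rows n g)) = f g"
      using transf[OF True lift(1)[OF X], of "1\<^sub>m n"] lift(2)[OF X] by simp
    then show ?thesis using True X by (simp add: of_section_def F_def)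
  next
    case False
    then show ?thesis using f by (simp add: of_section_def Ind_def)
  qed
  then show ?thesis using F by blast
qed

lemma neg_J_mult_rows:
  fixes M :: "'a mat"
  assumes M: "M \<in> square_mats n"
  shows "top_rows n (- J_mat n * M) = bottom_rows n M" "bottom_rows n (J_mat n * M) = top_rows n M"
proof -
  have nJ: "- J_mat n \<in> square_mats n" by simp
  have top: "row_hvec n (- J_mat n * M) i = row_hvec n M (n + i)" if i: "i < n" for i
  proof -
    have "row_hvec n (- J_mat n * M) i = lincomb n (\<lambda>k. (- J_mat n) $$ (i, k)) (top_rows n M) + lincomb n (\<lambda>k. (- J_mat n) $$ (i, n + k)) (bottom_rows n M)"
      by (rule row_hvec_mult[OF nJ M]) (use i in simp)
    also have "lincomb n (\<lambda>k. (- J_mat n) $$ (i, k)) (top_rows n M) = lincomb n (\<lambda>k. 0) (top_rows n M)"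
      by (rule lincomb_cong) (use i in \<open>auto simp: J_mat_index\<close>)
    also have "lincomb n (\<lambda>k. (- J_mat n) $$ (i, n + k)) (bottom_rows n M) = lincomb n (\<lambda>k. if i = k then 1 else 0) (bottom_rows n M)"
      by (rule lincomb_cong) (use i in \<open>auto simp: J_mat_index\<close>)
    finally show ?thesis using i by (simp add: lincomb_delta) (simp add: lincomb_def bottom_rows_def)
  qed
  have bottom: "row_hvec n (J_mat n * M) (n + i) = row_hvec n M i" if i: "i < n" for i
  proof -
    have "row_hvec n (J_mat n * M) (n + i) = lincomb n (\<lambda>k. J_mat n $$ (n + i, k)) (top_rows n M) + lincomb n (\<lambda>k. J_mat n $$ (n + i, n + k)) (bottom_rows n M)"
      by (rule row_hvec_mult[OF J_mat_carrier M]) (use i in simp)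
    also have "lincomb n (\<lambda>k. J_mat n $$ (n + i, k)) (top_rows n M) = lincomb n (\<lambda>k. if i = k then 1 else 0) (top_rows n M)"
      by (rule lincomb_cong) (use i in \<open>auto simp: J_mat_index\<close>)
    also have "lincomb n (\<lambda>k. J_mat n $$ (n + i, n + k)) (bottom_rows n M) = lincomb n (\<lambda>k. 0) (bottom_rows n M)"
      by (rule lincomb_cong) (use i in \<open>auto simp: J_mat_index\<close>)
    finally show ?thesis using i by (simp add: lincomb_delta) (simp add: lincomb_def top_rows_def)
  qed
  show "top_rows n (- J_mat n * M) = bottom_rows n M" "bottom_rows n (J_mat n * M) = top_rows n M"
    using top bottom by (auto simp: top_rows_def bottom_rows_def)
qed

lemma siegel_U_iff:
  fixes B :: "'a mat"
  assumes "A \<in> carrier_mat n n" "B \<in> carrier_mat n n" "four_block_mat A B (0\<^sub>m n n) (1\<^sub>m n) \<in> siegel_P n"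
  shows "four_block_mat A B (0\<^sub>m n n) (1\<^sub>m n) \<in> siegel_U n"
proof -
  have Sp: "four_block_mat A B (0\<^sub>m n n) (1\<^sub>m n) \<in> carrier (Sp n)" using assms(3) by (simp add: siegel_P_def)
  have "transpose_mat A = 1\<^sub>m n"
    using siegel_diagonal_inverse[OF Sp assms(1,2) one_carrier_mat] assms(1) by simp
  then have "A = 1\<^sub>m n" using transpose_transpose[of A] by simp
  then show ?thesis using Sp assms(2) by (auto simp: siegel_U_def)
qed

text \<open>
  The matrix \<open>J^(-1) u g\<close> has the bottom rows of \<open>g\<close> as its top rows, and a symplectic matrix with given top
  rows is determined by its bottom rows, which form an arbitrary dual tuple.
\<close>
lemma unipotent_duals_bij:
  fixes g :: "'a mat"
  assumes g: "g \<in> carrier (Sp n)"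
  shows "bij_betw (\<lambda>u. bottom_rows n (- J_mat n * u * g)) (siegel_U n) (duals n (bottom_rows n g))"
proof -
  note gc = Sp_carrier[OF g]
  have nJ: "- J_mat n \<in> square_mats n" by simp
  have u: "u \<in> carrier (Sp n)" "- J_mat n * u * g \<in> carrier (Sp n)" "top_rows n (- J_mat n * u * g) = bottom_rows n g"
    if u: "u \<in> siegel_U n" for u
  proof -
    show uS: "u \<in> carrier (Sp n)" using u by (simp add: siegel_U_def)
    show "- J_mat n * u * g \<in> carrier (Sp n)" by (intro Sp_mult J_mat_Sp uS g)
    obtain B where B: "B \<in> carrier_mat n n" "u = four_block_mat (1\<^sub>m n) B (0\<^sub>m n n) (1\<^sub>m n)"
      using u by (auto simp: siegel_U_def)
    have "bottom_rows n (u * g) = row_act n (1\<^sub>m n) (bottom_rows n g)"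
      unfolding B(2) by (rule bottom_rows_siegel[OF one_carrier_mat B(1) one_carrier_mat gc])
    also have "\<dots> = bottom_rows n g" by (rule row_act_one) (simp add: bottom_rows_def)
    finally show "top_rows n (- J_mat n * u * g) = bottom_rows n g"
      unfolding square_mat_mult_assoc[OF nJ Sp_carrier[OF uS] gc] neg_J_mult_rows(1)[OF square_mat_mult_closed[OF Sp_carrier[OF uS] gc]] .
  qed
  have cancel: "J_mat n * (- J_mat n * u * g) = u * g" if "u \<in> carrier (Sp n)" for u
  proof -
    note uc = Sp_carrier[OF that]
    have "J_mat n * (- J_mat n * u * g) = J_mat n * - J_mat n * (u * g)"
      by (simp only: square_mat_mult_assoc[of _ "2 * n"] square_mat_mult_closed[of _ "2 * n"] J_mat_carrier nJ uc gc)
    then show ?thesis unfolding J_mat_J_mat left_mult_one_mat[OF square_mat_mult_closed[OF uc gc]] .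
  qed
  obtain k where k: "k \<in> carrier (Sp n)" "g * k = 1\<^sub>m (2 * n)" by (rule Sp_inverse[OF g]) (rule that)
  show ?thesis
  proof (rule bij_betw_imageI)
    show "inj_on (\<lambda>u. bottom_rows n (- J_mat n * u * g)) (siegel_U n)"
    proof (rule inj_onI)
      fix u v assume uv: "u \<in> siegel_U n" "v \<in> siegel_U n"
        "bottom_rows n (- J_mat n * u * g) = bottom_rows n (- J_mat n * v * g)"
      have "- J_mat n * u * g = - J_mat n * v * g"
        using rows_eqI[OF Sp_carrier[OF u(2)[OF uv(1)]] Sp_carrier[OF u(2)[OF uv(2)]]] u(3)[OF uv(1)] u(3)[OF uv(2)] uv(3) by simp
      then have "u * g = v * g" using cancel[OF u(1)[OF uv(1)]] cancel[OF u(1)[OF uv(2)]] by simp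
      then have "u * g * k = v * g * k" by simp
      then have "u * (g * k) = v * (g * k)"
        using square_mat_mult_assoc[OF Sp_carrier[OF u(1)[OF uv(1)]] gc Sp_carrier[OF k(1)]]
          square_mat_mult_assoc[OF Sp_carrier[OF u(1)[OF uv(2)]] gc Sp_carrier[OF k(1)]] by simp
      then show "u = v"
        unfolding k(2) using Sp_carrier[OF u(1)[OF uv(1)]] Sp_carrier[OF u(1)[OF uv(2)]] by simp
    qed
    show "(\<lambda>u. bottom_rows n (- J_mat n * u * g)) ` siegel_U n = duals n (bottom_rows n g)"
    proof (intro equalityI subsetI)
      fix Z assume "Z \<in> (\<lambda>u. bottom_rows n (- J_mat n * u * g)) ` siegel_U n"
      then obtain v where v: "v \<in> siegel_U n" "Z = bottom_rows n (- J_mat n * v * g)" by blast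
      then show "Z \<in> duals n (bottom_rows n g)"
        using u(2,3)[OF v(1)] Sp_iff_rows[OF Sp_carrier[OF u(2)[OF v(1)]]] by simp
    next
      fix Z assume Z: "Z \<in> duals n (bottom_rows n g)"
      have Xt: "bottom_rows n g \<in> isotuples n" and Zt: "Z \<in> isotuples n"
        using bottom_rows_frame[OF g] Z by (simp_all add: frames_def duals_def)
      define M where "M = mat_of_rows2 n (bottom_rows n g) Z"
      have M: "M \<in> carrier (Sp n)" "top_rows n M = bottom_rows n g" "bottom_rows n M = Z"
        unfolding M_def by (rule mat_of_rows2_Sp[OF Xt Z] rows_mat_of_rows2[OF Xt Zt])+
      note Mc = Sp_carrier[OF M(1)]
      have "bottom_rows n (J_mat n * M) = row_act n (1\<^sub>m n) (bottom_rows n g)"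
        unfolding neg_J_mult_rows(2)[OF Mc] M(2) by (rule row_act_one[symmetric]) (simp add: bottom_rows_def)
      then obtain A B where AB: "A \<in> carrier_mat n n" "B \<in> carrier_mat n n"
        and p: "four_block_mat A B (0\<^sub>m n n) (1\<^sub>m n) \<in> siegel_P n" "J_mat n * M = four_block_mat A B (0\<^sub>m n n) (1\<^sub>m n) * g"
        by (rule siegel_coset[OF g Sp_mult[OF J_mat_Sp(1) M(1)] one_carrier_mat]) (rule that)
      define v where "v = four_block_mat A B (0\<^sub>m n n) (1\<^sub>m n)"
      have v: "v \<in> siegel_U n" unfolding v_def by (rule siegel_U_iff[OF AB p(1)])
      note vc = Sp_carrier[OF u(1)[OF v]]
      have "- J_mat n * v * g = - J_mat n * (J_mat n * M)"
        unfolding p(2) v_def[symmetric] by (rule square_mat_mult_assoc[OF nJ vc gc])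
      also have "\<dots> = - J_mat n * J_mat n * M"
        by (rule square_mat_mult_assoc[OF nJ J_mat_carrier Mc, symmetric])
      also have "\<dots> = M" unfolding J_mat_J_mat using Mc by simp
      finally show "Z \<in> (\<lambda>u. bottom_rows n (- J_mat n * u * g)) ` siegel_U n" using v M(3) by auto
    qed
  qed
qed

lemma intertwiner_of_section: "intertwiner n (of_section n F) = of_section n (opp_op n F)"
proof
  fix g :: "'a mat"
  show "intertwiner n (of_section n F) g = of_section n (opp_op n F) g"
  proof (cases "g \<in> carrier (Sp n)")
    case True
    have "intertwiner n (of_section n F) g = (\<Sum>u\<in>siegel_U n. F (bottom_rows n (- J_mat n * u * g)))"
    proof -
      have "of_section n F (- J_mat n * u * g) = F (bottom_rows n (- J_mat n * u * g))" if "u \<in> siegel_U n" for u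
      proof -
        have "- J_mat n * u * g \<in> carrier (Sp n)"
          using that by (intro Sp_mult J_mat_Sp True) (simp add: siegel_U_def)
        then show ?thesis by (simp only: of_section_def if_True)
      qed
      then show ?thesis unfolding intertwiner_def inv_J_mat using True by simp
    qed
    also have "\<dots> = (\<Sum>Z\<in>duals n (bottom_rows n g). F Z)"
      by (rule sum.reindex_bij_betw[OF unipotent_duals_bij[OF True]])
    finally show ?thesis using True bottom_rows_frame[OF True] by (simp add: of_section_def opp_op_def)
  qed (simp add: intertwiner_def of_section_def)
qed

end

section \<open>The spectrum of the intertwining operator\<close>

context quadratic_character_root
begin

text \<open>
  The components of all sections span the induced representation and are eigenvectors, so a basis can be selected from
  them.  Any eigenvalue is a root of the product of the \<open>opp_op n - opp_ev n j\<close>, which annihilates every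
  component.
\<close>
theorem intertwiner_spectrum:
  assumes \<chi>: "\<forall>p\<in>siegel_P n. \<chi> p = \<beta> (chi_det n p)"
  shows "diagonalizable_on (Ind n \<chi>) (intertwiner n)"
    and "eigenvalues_on (Ind n \<chi>) (intertwiner n) = opp_ev n ` {..n}"
proof -
  let ?T = "intertwiner n" and ?\<Psi> = "of_section n"
  obtain \<pi> where \<pi>: "spectral_projections n \<pi>" and nz: "\<And>j. j \<le> n \<Longrightarrow> \<exists>F\<in>sections n. \<pi> j F \<noteq> 0"
    using spectral_theorem by blast
  have \<pi>_sec: "\<pi> j F \<in> sections n" and \<pi>_opp: "opp_op n (\<pi> j F) = fun_scale (opp_ev n j) (\<pi> j F)"
    if "j \<le> n" "F \<in> sections n" for j F
    using \<pi> that by (auto simp: spectral_projections_def)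
  have \<pi>_sum: "F = (\<Sum>j\<le>n. \<pi> j F)" if "F \<in> sections n" for F
    using \<pi> that unfolding spectral_projections_def by blast
  have T_eig: "?T (?\<Psi> (\<pi> j F)) = fun_scale (opp_ev n j) (?\<Psi> (\<pi> j F))" if "j \<le> n" "F \<in> sections n" for j F
    unfolding intertwiner_of_section \<pi>_opp[OF that] by (rule module_hom.scale[OF linear_of_section])
  define S where "S = {?\<Psi> (\<pi> j F) | j F. j \<le> n \<and> F \<in> sections n}"
  have Ind: "cfun.subspace (Ind n \<chi>)"
    unfolding cfun.subspace_def Ind_def by (auto simp: fun_scale_def algebra_simps)
  have "S \<subseteq> Ind n \<chi>" using of_section_in_Ind[OF \<pi>_sec \<chi>] by (auto simp: S_def)
  have "Ind n \<chi> \<subseteq> cfun.span S"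
  proof
    fix f assume "f \<in> Ind n \<chi>"
    then obtain F where F: "F \<in> sections n" "f = ?\<Psi> F" using Ind_of_section[OF _ \<chi>] by blast
    have "f = ?\<Psi> (\<Sum>j\<le>n. \<pi> j F)" using F \<pi>_sum[OF F(1)] by simp
    also have "\<dots> = (\<Sum>j\<le>n. ?\<Psi> (\<pi> j F))" by (rule module_hom.sum[OF linear_of_section])
    also have "\<dots> \<in> cfun.span S" by (intro cfun.span_sum cfun.span_base) (use F in \<open>auto simp: S_def\<close>)
    finally show "f \<in> cfun.span S" .
  qed
  obtain B where B: "B \<subseteq> S" "cfun.independent B" "S \<subseteq> cfun.span B"
    using cfun.maximal_independent_subset[of S] by blast
  have "cfun.span B = Ind n \<chi>"
  proof
    show "cfun.span B \<subseteq> Ind n \<chi>" using B(1) \<open>S \<subseteq> Ind n \<chi>\<close> by (intro cfun.span_minimal Ind) auto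
    show "Ind n \<chi> \<subseteq> cfun.span B" using \<open>Ind n \<chi> \<subseteq> cfun.span S\<close> cfun.span_minimal[OF B(3) cfun.subspace_span] by blast
  qed
  moreover have "\<exists>c. ?T b = fun_scale c b" if "b \<in> B" for b
    using that B(1) T_eig by (auto simp: S_def)
  ultimately show "diagonalizable_on (Ind n \<chi>) ?T" using B(2) unfolding diagonalizable_on_def by blast
  show "eigenvalues_on (Ind n \<chi>) ?T = opp_ev n ` {..n}"
  proof (intro equalityI subsetI)
    fix c assume "c \<in> eigenvalues_on (Ind n \<chi>) ?T"
    then obtain f where f: "f \<in> Ind n \<chi>" "f \<noteq> 0" "?T f = fun_scale c f" by (auto simp: eigenvalues_on_def)
    then obtain F where F: "F \<in> sections n" "f = ?\<Psi> F" using Ind_of_section[OF _ \<chi>] by blast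
    let ?cs = "map (opp_ev n) [0..<Suc n]"
    note lin_T = linear_op_eigen_factors[OF linear_opp_op]
    have F0: "F \<noteq> 0" using f(2) F(2) by (auto simp: module_hom.zero[OF linear_of_section])
    have "opp_op n F = (\<Sum>j\<le>n. opp_op n (\<pi> j F))"
      by (subst \<pi>_sum[OF F(1)]) (rule module_hom.sum[OF linear_opp_op])
    also have "\<dots> = (\<Sum>j\<le>n. fun_scale (opp_ev n j) (\<pi> j F))"
      using \<pi>_opp[OF _ F(1)] by (intro sum.cong) auto
    also have "\<dots> \<in> sections n"
      by (intro cfun.subspace_sum[OF subspace_sections] cfun.subspace_scale[OF subspace_sections] \<pi>_sec F(1)) simp
    finally have "opp_op n F - fun_scale c F \<in> sections n"
      by (intro cfun.subspace_diff[OF subspace_sections] cfun.subspace_scale[OF subspace_sections] F(1))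
    moreover have "?\<Psi> (opp_op n F - fun_scale c F) = 0"
      using f(3) unfolding F(2) intertwiner_of_section
      by (simp only: module_hom.diff[OF linear_of_section] module_hom.scale[OF linear_of_section] diff_self)
    ultimately have "opp_op n F - fun_scale c F = 0" by (rule of_section_eq_0)
    then have "opp_op n F = fun_scale c F" by (simp only: right_minus_eq)
    then have 1: "eigen_factors (opp_op n) ?cs F = fun_scale (\<Prod>d\<leftarrow>?cs. c - d) F"
      by (rule eigen_factors_eigenvector[OF linear_opp_op])
    have "eigen_factors (opp_op n) ?cs (\<pi> j F) = 0" if j: "j \<le> n" for j
    proof -
      have "opp_ev n j \<in> set ?cs" using j by (auto simp del: upt_Suc)
      then have "(\<Prod>d\<leftarrow>?cs. opp_ev n j - d) = 0" unfolding prod_list_zero_iff by force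
      then show ?thesis
        using eigen_factors_eigenvector[OF linear_opp_op \<pi>_opp[OF j F(1)], of ?cs] by (simp del: upt_Suc)
    qed
    then have "(\<Sum>j\<le>n. eigen_factors (opp_op n) ?cs (\<pi> j F)) = 0" by (intro sum.neutral) auto
    moreover have "eigen_factors (opp_op n) ?cs F = (\<Sum>j\<le>n. eigen_factors (opp_op n) ?cs (\<pi> j F))"
      by (subst \<pi>_sum[OF F(1)]) (rule module_hom.sum[OF lin_T])
    ultimately have "(\<Prod>d\<leftarrow>?cs. c - d) = 0" using 1 F0 by (simp del: upt_Suc)
    then have "c \<in> set ?cs" unfolding prod_list_zero_iff by (auto simp del: upt_Suc)
    then show "c \<in> opp_ev n ` {..n}" by (auto simp: atLeast0LessThan lessThan_Suc_atMost simp del: upt_Suc)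
  next
    fix c assume "c \<in> opp_ev n ` {..n}"
    then obtain j where j: "j \<le> n" "c = opp_ev n j" by blast
    obtain F where F: "F \<in> sections n" "\<pi> j F \<noteq> 0" using nz[OF j(1)] by blast
    have "?\<Psi> (\<pi> j F) \<noteq> 0" using of_section_eq_0[OF \<pi>_sec[OF j(1) F(1)]] F(2) by blast
    then show "c \<in> eigenvalues_on (Ind n \<chi>) ?T"
      unfolding eigenvalues_on_def using of_section_in_Ind[OF \<pi>_sec[OF j(1) F(1)] \<chi>] T_eig[OF j(1) F(1)] j(2) by blast
  qed
qed

end

lemma levi_in_siegel_P:
  fixes A D :: "'a::field mat"
  assumes c: "D \<in> carrier_mat n n" "A \<in> carrier_mat n n" and DA: "D * transpose_mat A = 1\<^sub>m n"
  shows "four_block_mat D (0\<^sub>m n n) (0\<^sub>m n n) A \<in> siegel_P n"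
proof -
  define p where "p = four_block_mat D (0\<^sub>m n n) (0\<^sub>m n n) A"
  note rows = block_rows[OF p_def c(1) zero_carrier_mat c(2)]
  have pc: "p \<in> square_mats n" using c by (simp add: mult_2 p_def)
  have "A * transpose_mat D = transpose_mat (D * transpose_mat A)"
    using c transpose_mult[of D n n "transpose_mat A" n] by simp
  then have AD: "A * transpose_mat D = 1\<^sub>m n" unfolding DA by simp
  have dual: "sform n (row_hvec n p (n + i)) (row_hvec n p j) = (if i = j then 1 else 0)" if ij: "i < n" "j < n" for i j
  proof -
    have "sform n (row_hvec n p (n + i)) (row_hvec n p j) = (\<Sum>k<n. A $$ (i, k) * D $$ (j, k))"
      unfolding sform_def by (rule sum.cong) (use ij rows in auto)
    also have "\<dots> = (A * transpose_mat D) $$ (i, j)"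
      using c ij by (simp add: scalar_prod_def lessThan_atLeast0)
    finally show ?thesis unfolding AD using ij by simp
  qed
  have iso: "sform n (row_hvec n p i) (row_hvec n p j) = 0"
    "sform n (row_hvec n p (n + i)) (row_hvec n p (n + j)) = 0" if ij: "i < n" "j < n" for i j
  proof -
    have zero: "p $$ (a, n + k) = 0" "p $$ (n + a, k) = 0" if "a < n" "k < n" for a k
      using rows(2,3)[OF that] that by simp_all
    show "sform n (row_hvec n p i) (row_hvec n p j) = 0"
      "sform n (row_hvec n p (n + i)) (row_hvec n p (n + j)) = 0"
      unfolding sform_def by (rule sum.neutral, simp add: zero ij)+
  qed
  have "top_rows n p \<in> isotuples n" "bottom_rows n p \<in> isotuples n"
    unfolding top_isotuple_iff using iso by blast+
  moreover have "sform n (bottom_rows n p i) (top_rows n p j) = (if i = j then 1 else 0)" if "i < n" "j < n" for i j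
    unfolding bottom_rows_def top_rows_def using dual[OF that] that by simp
  ultimately have "p \<in> carrier (Sp n)"
    unfolding Sp_iff_rows[OF pc] duals_def by blast
  then show ?thesis unfolding siegel_P_def p_def[symmetric]
    by (intro CollectI conjI bexI[of _ D] bexI[of _ "0\<^sub>m n n"] bexI[of _ A] p_def c zero_carrier_mat)
qed

lemma choose_two_double: "2 * (n choose 2) + n = n * n"
  by (induction n) (simp_all add: numeral_2_eq_2)

lemma choose_two_even:
  assumes "k \<le> m"
  shows "m + ((m + k choose 2) + (m - k choose 2)) = m\<^sup>2 + k\<^sup>2"
proof -
  obtain d where m: "m = k + d" using assms le_Suc_ex by blast
  show ?thesis
    using choose_two_double[of "k + d + k"] choose_two_double[of d]
    by (simp add: m power2_eq_square algebra_simps)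
qed

lemma choose_two_odd:
  assumes "i \<le> m"
  shows "m + ((m + 1 + i choose 2) + (m - i choose 2)) = m * (m + 1) + i * (i + 1)"
proof -
  obtain d where m: "m = i + d" using assms le_Suc_ex by blast
  show ?thesis
    using choose_two_double[of "i + d + 1 + i"] choose_two_double[of d]
    by (simp add: m algebra_simps)
qed

lemma minus_one_power_cong: "even (a + b) \<Longrightarrow> (- 1 :: 'a::ring_1) ^ a = (- 1) ^ b"
  by (cases "even a") auto

theorem theorem4p5p2:
  fixes n :: nat
    and \<chi> :: "'a::{field, finite} mat \<Rightarrow> complex"
    and \<beta> :: "'a \<Rightarrow> complex"
  assumes "odd CARD('a)" and "\<not> 3 dvd CARD('a)" and "n \<ge> 1"
    and "\<chi> \<in> hom ((Sp n)\<lparr>carrier := siegel_P n\<rparr>) mult_group"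
    and "\<beta> \<in> hom mult_group mult_group"
    and "\<forall>p \<in> siegel_P n. \<chi> p = \<beta> (chi_det n p)"
    and "\<forall>x. x \<noteq> 0 \<longrightarrow> (\<beta> x)\<^sup>2 = 1"
    and "\<exists>x. x \<noteq> 0 \<and> \<beta> x \<noteq> 1"
  shows "(\<forall>p \<in> siegel_P n. char_J n \<chi> p = \<chi> p)
    \<and> (\<forall>m. n = 2 * m \<longrightarrow>
          diagonalizable_on (Ind n \<chi>) (intertwiner n)
        \<and> eigenvalues_on (Ind n \<chi>) (intertwiner n) =
            {\<beta> (- 1) ^ m * (- 1) ^ (m - i div 2) * of_nat CARD('a) ^ (m\<^sup>2 + (i div 2)\<^sup>2) | i. i \<le> n})
    \<and> (\<forall>m. n = 2 * m + 1 \<longrightarrow>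
          diagonalizable_on (Ind n \<chi>) (intertwiner n)
        \<and> eigenvalues_on (Ind n \<chi>) (intertwiner n) =
            {s * csqrt (\<beta> (- 1)) *
               of_real (real CARD('a) powr (real (m * (m + 1) + i * (i + 1)) + 1 / 2)) | s i.
             s \<in> {1, - 1} \<and> i \<le> m})"
proof -
  \<comment> \<open>With this choice \<open>\<beta> (-1) s = r\<close>, so that the eigenvalues are expressed by the root in the claim.\<close>
  define r where "r = csqrt (\<beta> (- 1)) * of_real (sqrt (real CARD('a)))"
  have \<beta>_mult: "\<beta> (x * y) = \<beta> x * \<beta> y" if "x \<noteq> 0" "y \<noteq> 0" for x y
    using assms(5) that by (auto simp: hom_def mult_group_def)
  have \<beta>_square: "\<beta> x * \<beta> x = 1" if "x \<noteq> 0" for x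
    using assms(7) that by (auto simp: power2_eq_square)
  have r: "r * r = \<beta> (- 1) * of_nat CARD('a)"
  proof -
    have "r * r = (csqrt (\<beta> (- 1)))\<^sup>2 * of_real ((sqrt (real CARD('a)))\<^sup>2)"
      by (simp only: r_def power2_eq_square of_real_mult mult_ac)
    then show ?thesis by simp
  qed
  interpret quadratic_character_root \<beta> "of_nat CARD('a)" "\<beta> (- 1) * r"
  proof
    show "\<beta> (- 1) * r * (\<beta> (- 1) * r) = \<beta> (- 1) * of_nat CARD('a)"
      using \<beta>_square[of "- 1"] r by (simp add: algebra_simps)
  qed (use \<beta>_mult \<beta>_square assms(8) in auto)
  have \<beta>r: "\<beta> (- 1) * (\<beta> (- 1) * r) = r"
    using \<beta>_square[of "- 1"] by (simp add: mult.assoc[symmetric])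
  have eig: "opp_ev n j = r ^ n * (- 1) ^ j * of_nat CARD('a) ^ ((n - j choose 2) + (j choose 2))" for j
    unfolding opp_ev_def \<beta>r ..
  have r_even: "r ^ (2 * m) = \<beta> (- 1) ^ m * of_nat CARD('a) ^ m" for m
    by (simp add: power_mult power2_eq_square r power_mult_distrib)
  have char_J: "char_J n \<chi> p = \<chi> p" if p: "p \<in> siegel_P n" for p
  proof -
    obtain A B D where c: "A \<in> carrier_mat n n" "B \<in> carrier_mat n n" "D \<in> carrier_mat n n"
      and pb: "p = four_block_mat A B (0\<^sub>m n n) D" and ps: "p \<in> carrier (Sp n)" using p by (auto simp: siegel_P_def)
    have swap: "four_block_mat D (0\<^sub>m n n) (0\<^sub>m n n) A \<in> siegel_P n"
      by (rule levi_in_siegel_P[OF c(3,1) siegel_diagonal_inverse[OF ps[unfolded pb] c]])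
    have det: "det D * det A = 1" by (rule siegel_det[OF ps[unfolded pb] c])
    then have "inverse (det A) = det D" "det D \<noteq> 0"
      using inverse_unique[of "det A" "det D"] by (auto simp: mult.commute)
    then show ?thesis
      using assms(6) p swap c inverse[of "det D"]
      by (simp add: char_J_def pb split_block_four_block chi_det_four_block)
  qed
  note spectrum = intertwiner_spectrum[OF assms(6)]
  have even: "opp_ev n ` {..n} =
      {\<beta> (- 1) ^ m * (- 1) ^ (m - i div 2) * of_nat CARD('a) ^ (m\<^sup>2 + (i div 2)\<^sup>2) | i. i \<le> n}"
    (is "_ = ?R") if n: "n = 2 * m" for m
  proof -
    \<comment> \<open>The indices \<open>m - k\<close> and \<open>m + k\<close> give the same eigenvalue, that of the list at \<open>i = 2k\<close>.\<close>
    define v where "v = (\<lambda>k. \<beta> (- 1) ^ m * (- 1) ^ (m - k) * of_nat CARD('a) ^ (m\<^sup>2 + k\<^sup>2) :: complex)"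
    have v: "opp_ev n (m - k) = v k" "opp_ev n (m + k) = v k" if k: "k \<le> m" for k
    proof -
      have "n - (m - k) = m + k" "n - (m + k) = m - k" using n k by auto
      moreover have "m\<^sup>2 + k\<^sup>2 = m + ((m + k choose 2) + (m - k choose 2))"
        using choose_two_even[OF k] by simp
      moreover have "(- 1 :: complex) ^ (m + k) = (- 1) ^ (m - k)"
        using k by (intro minus_one_power_cong) simp
      ultimately show "opp_ev n (m - k) = v k" "opp_ev n (m + k) = v k"
        unfolding eig v_def by (simp_all add: n r_even power_add add.commute)
    qed
    have "?R = v ` {..m}"
    proof (intro equalityI subsetI)
      fix x assume "x \<in> ?R"
      then obtain i where "i \<le> n" "x = v (i div 2)" by (auto simp: v_def)
      then show "x \<in> v ` {..m}" using n by auto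
    next
      fix x assume "x \<in> v ` {..m}"
      then obtain k where "k \<le> m" "x = v k" by auto
      then show "x \<in> ?R" using n by (auto simp: v_def intro!: exI[of _ "2 * k"])
    qed
    also have "\<dots> = opp_ev n ` {..n}"
    proof (intro equalityI subsetI)
      fix x assume "x \<in> v ` {..m}"
      then obtain k where "k \<le> m" "x = v k" by auto
      then show "x \<in> opp_ev n ` {..n}" using v(1)[of k] n by (intro image_eqI[of _ _ "m - k"]) auto
    next
      fix x assume "x \<in> opp_ev n ` {..n}"
      then obtain j where j: "j \<le> n" "x = opp_ev n j" by auto
      show "x \<in> v ` {..m}"
      proof (cases "j \<le> m")
        case True then show ?thesis using v(1)[of "m - j"] j by (intro image_eqI[of _ _ "m - j"]) auto
      next
        case False then show ?thesis using v(2)[of "j - m"] j n by (intro image_eqI[of _ _ "j - m"]) auto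
      qed
    qed
    finally show ?thesis by simp
  qed
  have odd: "opp_ev n ` {..n} = {s * csqrt (\<beta> (- 1)) *
      of_real (real CARD('a) powr (real (m * (m + 1) + i * (i + 1)) + 1 / 2)) | s i. s \<in> {1, - 1} \<and> i \<le> m}"
    (is "_ = ?R") if n: "n = 2 * m + 1" for m
  proof -
    define w where "w = (\<lambda>i. csqrt (\<beta> (- 1)) * of_real (real CARD('a) powr (real (m * (m + 1) + i * (i + 1)) + 1 / 2)))"
    \<comment> \<open>The indices \<open>m - i\<close> and \<open>m + 1 + i\<close> give opposite eigenvalues, and the sign in front runs over both.\<close>
    define \<epsilon> where "\<epsilon> = (\<lambda>i. \<beta> (- 1) ^ m * (- 1) ^ (m - i) :: complex)"
    have \<epsilon>: "\<epsilon> i = 1 \<or> \<epsilon> i = - 1" for i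
    proof -
      have "\<epsilon> i * \<epsilon> i = (\<beta> (- 1) * \<beta> (- 1)) ^ m * ((- 1) * (- 1)) ^ (m - i)"
        by (simp only: \<epsilon>_def power_mult_distrib mult_ac)
      then have "\<epsilon> i * \<epsilon> i = 1" using \<beta>_square[of "- 1"] by simp
      then show ?thesis by (simp add: square_eq_1_iff)
    qed
    have w: "r * of_nat CARD('a) ^ (m * (m + 1) + i * (i + 1)) = w i" for i
      by (simp add: r_def w_def powr_add powr_realpow powr_half_sqrt of_real_mult del: of_nat_add of_nat_mult)
    have v: "opp_ev n (m - i) = \<epsilon> i * w i" "opp_ev n (m + 1 + i) = - \<epsilon> i * w i" if i: "i \<le> m" for i
    proof -
      have "n - (m - i) = m + 1 + i" "n - (m + 1 + i) = m - i" using n i by auto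
      moreover have exponent: "m + ((m + 1 + i choose 2) + (m - i choose 2)) = m * (m + 1) + i * (i + 1)"
        using choose_two_odd[OF i] by simp
      moreover have "(- 1 :: complex) ^ (m + 1 + i) = - ((- 1) ^ (m - i))"
        using minus_one_power_cong[of "m + i" "m - i"] i by simp
      moreover have "r ^ n * of_nat CARD('a) ^ ((m + 1 + i choose 2) + (m - i choose 2)) = \<beta> (- 1) ^ m * w i"
      proof -
        have "r ^ n * of_nat CARD('a) ^ ((m + 1 + i choose 2) + (m - i choose 2)) =
            \<beta> (- 1) ^ m * (r * of_nat CARD('a) ^ (m + ((m + 1 + i choose 2) + (m - i choose 2))))"
          by (simp add: n r_even power_add)
        then show ?thesis unfolding exponent w .
      qed
      ultimately show "opp_ev n (m - i) = \<epsilon> i * w i" "opp_ev n (m + 1 + i) = - \<epsilon> i * w i"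
        unfolding eig \<epsilon>_def by (simp_all add: add.commute mult_ac)
    qed
    have R: "?R = {s * w i | s i. s \<in> {1, - 1} \<and> i \<le> m}" by (simp only: w_def mult.assoc)
    show ?thesis unfolding R
    proof (intro equalityI subsetI)
      fix x assume "x \<in> opp_ev n ` {..n}"
      then obtain j where j: "j \<le> n" "x = opp_ev n j" by auto
      have "\<exists>s i. x = s * w i \<and> s \<in> {1, - 1} \<and> i \<le> m"
      proof (cases "j \<le> m")
        case True
        then show ?thesis using v(1)[of "m - j"] j \<epsilon>[of "m - j"]
          by (intro exI[of _ "\<epsilon> (m - j)"] exI[of _ "m - j"]) auto
      next
        case False
        then show ?thesis using v(2)[of "j - m - 1"] j n \<epsilon>[of "j - m - 1"]
          by (intro exI[of _ "- \<epsilon> (j - m - 1)"] exI[of _ "j - m - 1"]) auto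
      qed
      then show "x \<in> {s * w i | s i. s \<in> {1, - 1} \<and> i \<le> m}" by blast
    next
      fix x assume "x \<in> {s * w i | s i. s \<in> {1, - 1} \<and> i \<le> m}"
      then obtain s i where si: "x = s * w i" "s = 1 \<or> s = - 1" "i \<le> m" by blast
      then have "x = opp_ev n (m - i) \<or> x = opp_ev n (m + 1 + i)"
        using \<epsilon>[of i] unfolding v[OF si(3)] by auto
      moreover have "m - i \<le> n" "m + 1 + i \<le> n" using si(3) n by auto
      ultimately show "x \<in> opp_ev n ` {..n}" by blast
    qed
  qed
  show ?thesis using char_J spectrum even odd by blast
qed

end
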